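(* Let $0<\varepsilon<1$ and $n,q \in \mathbb{N}$. Let $M \in \mathbb{R}^{nq \times nq}$ be a symmetric matrix with $\|M\|_{\mathrm{op}} \le 1$ such that the $n$ diagonal $q \times q$ blocks of $M$ are all identically $0$. Let $D \in \mathbb{R}^{n \times n}$ be an arbitrary diagonal matrix with non-negative entries and let $E = D \otimes \mathrm{Id}_q$. Let $k = \mathrm{rank}_{\ge \varepsilon}(M)$. Let $\mathcal{C}_q^n$ be the set of $y \in \{0,1\}^{nq}$ such that each of the $n$ consecutive blocks of $y$ (each of size $q$) has exactly one entry equal to $1$, and define $\Phi(y) = y^\top E^{1/2} M E^{1/2} y$ and \[ \mathrm{OPT} = \max_{y \in \mathcal{C}_q^n} \Phi(y). \] Then there exists an algorithm running in time $\mathrm{poly}(n) \cdot (1/\varepsilon)^{O(k)}$ that returns a random $y \in \mathcal{C}_q^n$ with \[ \mathbb{E}\, \Phi(y) \ge \mathrm{OPT} - O(\varepsilon \,\mathrm{Tr}\, D). \]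
   Context: For a square matrix $B$ with real eigenvalues, $\mathrm{rank}_{\ge \varepsilon}(B)$ is the number of eigenvalues of $B$ (counted with multiplicity) that are at least $\varepsilon$. The diagonal blocks of $M$ are the submatrices indexed by $\{(i-1)q+1,\dots,iq\}^2$ for $i\in[n]$. $O(\cdot)$ hides absolute constants.
   Formalization: The running time is poly(nq)·(1/ε)^{O(k)} instead of poly(n)·(1/ε)^{O(k)}, since a bound independent of q fails already for n = 2 (the input has (nq)² entries); n, q are positive and the algorithm runs on a real RAM with unit-cost arithmetic and square roots. *)

theory Defs
  imports
    "HOL-Probability.Probability_Mass_Function"
    "Jordan_Normal_Form.Char_Poly"
    "Jordan_Normal_Form.DL_Submatrix"
begin

section \<open>Matrices\<close>

text \<open>Indices are 0-based: block \<open>i < n\<close> is \<open>{i * q..<(i + 1) * q}\<close>.\<close>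

definition rank_ge :: "real \<Rightarrow> real mat \<Rightarrow> nat" where
  "rank_ge \<epsilon> B = (\<Sum>x | eigenvalue B x \<and> \<epsilon> \<le> x. order x (char_poly B))"

definition vec_norm2 :: "real Matrix.vec \<Rightarrow> real" where
  "vec_norm2 v = sqrt (scalar_prod v v)"

definition op_norm :: "real mat \<Rightarrow> real" where
  "op_norm A = (SUP v \<in> {v \<in> carrier_vec (dim_col A). vec_norm2 v \<le> 1}. vec_norm2 (A *\<^sub>v v))"

definition mat_trace :: "real mat \<Rightarrow> real" where
  "mat_trace A = (\<Sum>i<dim_row A. A $$ (i, i))"

definition kron :: "real mat \<Rightarrow> real mat \<Rightarrow> real mat" where
  "kron A B = Matrix.mat (dim_row A * dim_row B) (dim_col A * dim_col B)
     (\<lambda>(i, j). A $$ (i div dim_row B, j div dim_col B) * B $$ (i mod dim_row B, j mod dim_col B))"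

definition psd :: "real mat \<Rightarrow> bool" where
  "psd A \<longleftrightarrow> A\<^sup>T = A \<and> (\<forall>v \<in> carrier_vec (dim_row A). 0 \<le> scalar_prod v (A *\<^sub>v v))"

definition psd_sqrt :: "real mat \<Rightarrow> real mat" where
  "psd_sqrt A = (THE S. S \<in> carrier_mat (dim_row A) (dim_row A) \<and> psd S \<and> S * S = A)"

lemma psd_quadratic_zero:
  assumes S: "S \<in> carrier_mat n n" "psd S" and v: "v \<in> carrier_vec n"
    and z: "scalar_prod v (S *\<^sub>v v) = 0"
  shows "S *\<^sub>v v = 0\<^sub>v n"
proof -
  define u where "u = S *\<^sub>v v"
  have u: "u \<in> carrier_vec n" using S v by (simp add: u_def)
  have sym: "scalar_prod v (S *\<^sub>v u) = scalar_prod u u"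
  proof -
    have "scalar_prod v (S *\<^sub>v u) = scalar_prod (S\<^sup>T *\<^sub>v v) u"
      using transpose_vec_mult_scalar[OF S(1) u v] by simp
    then show ?thesis using S(2) by (simp add: psd_def u_def)
  qed
  define b where "b = scalar_prod u u"
  define c where "c = scalar_prod u (S *\<^sub>v u)"
  have b0: "0 \<le> b" unfolding b_def scalar_prod_def by (simp add: sum_nonneg)
  have c0: "0 \<le> c" using S u by (auto simp: c_def psd_def)
  have q: "0 \<le> t * t * c - 2 * t * b" for t
  proof -
    define w where "w = v - t \<cdot>\<^sub>v u"
    have w: "w \<in> carrier_vec n" using u v by (simp add: w_def)
    have "S *\<^sub>v w = u - t \<cdot>\<^sub>v (S *\<^sub>v u)"
      using S u v by (simp add: w_def u_def[symmetric] mult_minus_distrib_mat_vec mult_mat_vec)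
    then have "scalar_prod w (S *\<^sub>v w) = scalar_prod v u - t * scalar_prod v (S *\<^sub>v u)
        - t * (scalar_prod u u - t * scalar_prod u (S *\<^sub>v u))"
      using S u v unfolding w_def
      by (simp add: minus_scalar_prod_distrib[of _ n] scalar_prod_minus_distrib[of _ n] sym)
    also have "\<dots> = t * t * c - 2 * t * b"
      using z sym by (simp add: u_def[symmetric] b_def c_def algebra_simps)
    finally show ?thesis using S w by (auto simp: psd_def)
  qed
  have "b = 0"
  proof (rule ccontr)
    assume "b \<noteq> 0"
    then have b: "0 < b" using b0 by simp
    define t where "t = b / (c + 1)"
    have t: "0 < t" using b c0 by (simp add: t_def)
    have "0 \<le> t * (t * c - 2 * b)" using q[of t] by (simp add: algebra_simps)
    then have "2 * b \<le> t * c" using t by (simp add: zero_le_mult_iff)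
    also have "t * c \<le> b"
      using b c0 by (simp add: t_def field_simps)
    finally show False using b by simp
  qed
  then have "\<forall>i<n. vec_index u i = 0"
    using u unfolding b_def scalar_prod_def by (auto simp: sum_nonneg_eq_0_iff)
  then show ?thesis using u unfolding u_def[symmetric] by (intro eq_vecI) auto
qed

lemma psd_sqrt_diagonal:
  assumes A: "A \<in> carrier_mat n n" "diagonal_mat A" and nonneg: "\<And>i. i < n \<Longrightarrow> 0 \<le> A $$ (i, i)"
  shows "psd_sqrt A = Matrix.mat n n (\<lambda>(i, j). if i = j then sqrt (A $$ (i, i)) else 0)"
    (is "_ = ?R")
proof -
  have R: "?R \<in> carrier_mat n n" by simp
  have off: "A $$ (i, j) = 0" if "i < n" "j < n" "i \<noteq> j" for i j
    using A that by (auto simp: diagonal_mat_def)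
  have Rv: "vec_index (?R *\<^sub>v v) i = sqrt (A $$ (i, i)) * vec_index v i"
    if "v \<in> carrier_vec n" "i < n" for v i
    using that by (simp add: scalar_prod_def if_distrib[of "\<lambda>x. x * _"] cong: if_cong)
  have Rpsd: "psd ?R"
    unfolding psd_def
  proof (intro conjI ballI)
    show "?R\<^sup>T = ?R" by (intro eq_matI) auto
    fix v :: "real Matrix.vec" assume "v \<in> carrier_vec (dim_row ?R)"
    then have v: "v \<in> carrier_vec n" by simp
    have "scalar_prod v (?R *\<^sub>v v) = (\<Sum>i<n. vec_index v i * (sqrt (A $$ (i, i)) * vec_index v i))"
      using v unfolding scalar_prod_def[of v] by (intro sum.cong) (auto simp: Rv[OF v] simp del: index_mult_mat_vec)
    also have "\<dots> \<ge> 0"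
      by (intro sum_nonneg) (auto simp: nonneg mult.left_commute[of "vec_index v _"])
    finally show "0 \<le> scalar_prod v (?R *\<^sub>v v)" .
  qed
  have RR: "?R * ?R = A"
    using A off nonneg
    by (intro eq_matI)
      (auto simp: scalar_prod_def if_distrib[of "\<lambda>x. x * _"] cong: if_cong)
  show ?thesis
    unfolding psd_sqrt_def
  proof (rule the_equality)
    show "?R \<in> carrier_mat (dim_row A) (dim_row A) \<and> psd ?R \<and> ?R * ?R = A"
      using A Rpsd RR by auto
    fix S assume "S \<in> carrier_mat (dim_row A) (dim_row A) \<and> psd S \<and> S * S = A"
    then have S: "S \<in> carrier_mat n n" "psd S" "S * S = A" using A by auto
    have SA: "S * A = A * S" using S by (metis assoc_mult_mat)
    have Sij: "S $$ (i, j) * A $$ (j, j) = A $$ (i, i) * S $$ (i, j)" if "i < n" "j < n" for i j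
    proof -
      have "(S * A) $$ (i, j) = (\<Sum>l<n. S $$ (i, l) * A $$ (l, j))"
        using S A that by (auto simp: scalar_prod_def lessThan_atLeast0)
      also have "\<dots> = (\<Sum>l<n. if l = j then S $$ (i, j) * A $$ (j, j) else 0)"
        using that off by (intro sum.cong) auto
      finally have 1: "(S * A) $$ (i, j) = S $$ (i, j) * A $$ (j, j)" using that by simp
      have "(A * S) $$ (i, j) = (\<Sum>l<n. A $$ (i, l) * S $$ (l, j))"
        using S A that by (auto simp: scalar_prod_def lessThan_atLeast0)
      also have "\<dots> = (\<Sum>l<n. if l = i then A $$ (i, i) * S $$ (i, j) else 0)"
        using that off by (intro sum.cong) auto
      finally have 2: "(A * S) $$ (i, j) = A $$ (i, i) * S $$ (i, j)" using that by simp
      show ?thesis using 1 2 SA by metis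
    qed
    have SR: "S * ?R = ?R * S"
    proof (rule eq_matI)
      fix i j assume "i < dim_row (?R * S)" "j < dim_col (?R * S)"
      then have ij: "i < n" "j < n" using S by auto
      have "(S * ?R) $$ (i, j) = (\<Sum>l<n. if l = j then S $$ (i, j) * sqrt (A $$ (j, j)) else 0)"
        using S(1) ij by (simp add: scalar_prod_def if_distrib[of "\<lambda>x. _ * x"] cong: if_cong)
      also have "\<dots> = S $$ (i, j) * sqrt (A $$ (j, j))" using ij by simp
      also have "\<dots> = sqrt (A $$ (i, i)) * S $$ (i, j)"
        using Sij[OF ij] by (cases "S $$ (i, j) = 0") auto
      also have "\<dots> = (\<Sum>l<n. if l = i then sqrt (A $$ (i, i)) * S $$ (i, j) else 0)"
        using ij by simp
      also have "\<dots> = (?R * S) $$ (i, j)"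
        using S(1) ij by (simp add: scalar_prod_def if_distrib[of "\<lambda>x. x * _"] cong: if_cong)
      finally show "(S * ?R) $$ (i, j) = (?R * S) $$ (i, j)" .
    qed (use S in auto)
    define T where "T = S - ?R"
    have T: "T \<in> carrier_mat n n" unfolding T_def by (rule minus_carrier_mat[OF R])
    have Tsym: "T\<^sup>T = T"
      using S Rpsd R by (simp add: T_def psd_def transpose_minus)
    have prod0: "T * (S + ?R) = 0\<^sub>m n n"
    proof -
      have "T * (S + ?R) = (S * S + S * ?R) - (?R * S + ?R * ?R)"
        unfolding T_def minus_mult_distrib_mat[OF S(1) R add_carrier_mat[OF R]]
          mult_add_distrib_mat[OF S(1) S(1) R] mult_add_distrib_mat[OF R S(1) R] ..
      also have "\<dots> = (A + ?R * S) - (?R * S + A)" unfolding SR RR S(3) ..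
      also have "\<dots> = 0\<^sub>m n n" using A S by (intro eq_matI) auto
      finally show ?thesis .
    qed
    have Tv0: "T *\<^sub>v v = 0\<^sub>v n" if v: "v \<in> carrier_vec n" for v
    proof -
      define y where "y = T *\<^sub>v v"
      have y: "y \<in> carrier_vec n" using T v by (simp add: y_def)
      have adj: "scalar_prod y w = scalar_prod v (T *\<^sub>v w)" if "w \<in> carrier_vec n" for w
        using transpose_vec_mult_scalar[OF T that v] Tsym by (simp add: y_def)
      have "scalar_prod y (S *\<^sub>v y) + scalar_prod y (?R *\<^sub>v y) = scalar_prod y ((S + ?R) *\<^sub>v y)"
        unfolding add_mult_distrib_mat_vec[OF S(1) R y]
        by (rule scalar_prod_add_distrib[symmetric, OF y mult_mat_vec_carrier[OF S(1) y]
              mult_mat_vec_carrier[OF R y]])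
      also have "\<dots> = scalar_prod v (T *\<^sub>v ((S + ?R) *\<^sub>v y))"
        by (rule adj[OF mult_mat_vec_carrier[OF add_carrier_mat[OF R] y]])
      also have "T *\<^sub>v ((S + ?R) *\<^sub>v y) = (T * (S + ?R)) *\<^sub>v y"
        by (rule assoc_mult_mat_vec[symmetric, OF T add_carrier_mat[OF R] y])
      also have "\<dots> = 0\<^sub>v n" using y unfolding prod0 by (intro eq_vecI) auto
      finally have sum0: "scalar_prod y (S *\<^sub>v y) + scalar_prod y (?R *\<^sub>v y) = 0"
        using v by simp
      moreover have "0 \<le> scalar_prod y (S *\<^sub>v y)" "0 \<le> scalar_prod y (?R *\<^sub>v y)"
        using S Rpsd y by (auto simp: psd_def)
      ultimately have "scalar_prod y (S *\<^sub>v y) = 0" "scalar_prod y (?R *\<^sub>v y) = 0"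
        by linarith+
      then have "S *\<^sub>v y = 0\<^sub>v n" "?R *\<^sub>v y = 0\<^sub>v n"
        using psd_quadratic_zero S R Rpsd y by blast+
      then have "T *\<^sub>v y = 0\<^sub>v n"
        using S R y by (simp add: T_def minus_mult_distrib_mat_vec[OF S(1) R y])
      then have "scalar_prod y y = 0" using adj[OF y] v by simp
      then have "\<forall>i<n. vec_index y i = 0"
        using y unfolding scalar_prod_def by (auto simp: sum_nonneg_eq_0_iff)
      then show ?thesis using y unfolding y_def[symmetric] by (intro eq_vecI) auto
    qed
    show "S = ?R"
    proof (rule eq_matI)
      fix i j assume "i < dim_row ?R" "j < dim_col ?R"
      then have ij: "i < n" "j < n" by auto
      have "T $$ (i, j) = vec_index (T *\<^sub>v unit_vec n j) i"
        using T ij scalar_prod_right_unit[of j n "Matrix.row T i"] by simp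
      then have "T $$ (i, j) = 0" using Tv0[of "unit_vec n j"] ij by simp
      then show "S $$ (i, j) = ?R $$ (i, j)" using S ij by (simp add: T_def)
    qed (use S in auto)
  qed
qed

definition one_hot_blocks :: "nat \<Rightarrow> nat \<Rightarrow> real Matrix.vec set" where
  "one_hot_blocks n q = {y \<in> carrier_vec (n * q).
     (\<forall>j < n * q. vec_index y j \<in> {0, 1}) \<and>
     (\<forall>i < n. \<exists>!a. a < q \<and> vec_index y (i * q + a) = 1)}"


section \<open>Randomized real RAM\<close>

text \<open>
  A machine with unit-cost exact real arithmetic, including square roots. A program is a fixed
  finite piece of syntax, the same for all inputs; its only numerals are natural numbers, so
  that no real constant can carry advice. There is no rounding of reals and no integer division:
  either one at unit cost would make the machine unreasonably powerful. Integer multiplication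
  and the conversion \<open>ROf\<close> add nothing beyond real multiplication. The only source
  of randomness is a fair coin.

  Memory consists of named arrays; a scalar variable is cell 0 of an array. Division by zero
  gives 0, subtraction of naturals truncates at 0, and \<open>sqrt (- x) = - sqrt x\<close>.
\<close>

type_synonym vname = string

datatype iexp =
    INum nat
  | IArr vname iexp
  | IAdd iexp iexp
  | ISub iexp iexp
  | IMul iexp iexp

datatype rexp =
    ROf iexp
  | RArr vname iexp
  | RAdd rexp rexp
  | RSub rexp rexp
  | RMul rexp rexp
  | RDiv rexp rexp
  | RSqrt rexp

datatype bexp =
    ILess iexp iexp
  | RLess rexp rexp
  | BNot bexp
  | BAnd bexp bexp

datatype com =
    ISet vname iexp iexp
  | RSet vname iexp rexp
  | Flip vname iexp
  | Cond bexp "com list" "com list"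
  | While bexp "com list"

record state =
  ints :: "vname \<Rightarrow> nat \<Rightarrow> nat"
  reals :: "vname \<Rightarrow> nat \<Rightarrow> real"

primrec ival :: "iexp \<Rightarrow> state \<Rightarrow> nat" where
  "ival (INum c) s = c"
| "ival (IArr x e) s = ints s x (ival e s)"
| "ival (IAdd e f) s = ival e s + ival f s"
| "ival (ISub e f) s = ival e s - ival f s"
| "ival (IMul e f) s = ival e s * ival f s"

primrec rval :: "rexp \<Rightarrow> state \<Rightarrow> real" where
  "rval (ROf e) s = real (ival e s)"
| "rval (RArr x e) s = reals s x (ival e s)"
| "rval (RAdd e f) s = rval e s + rval f s"
| "rval (RSub e f) s = rval e s - rval f s"
| "rval (RMul e f) s = rval e s * rval f s"
| "rval (RDiv e f) s = rval e s / rval f s"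
| "rval (RSqrt e) s = sqrt (rval e s)"

primrec bval :: "bexp \<Rightarrow> state \<Rightarrow> bool" where
  "bval (ILess e f) s \<longleftrightarrow> ival e s < ival f s"
| "bval (RLess e f) s \<longleftrightarrow> rval e s < rval f s"
| "bval (BNot b) s \<longleftrightarrow> \<not> bval b s"
| "bval (BAnd b c) s \<longleftrightarrow> bval b s \<and> bval c s"

definition iupd :: "vname \<Rightarrow> nat \<Rightarrow> nat \<Rightarrow> state \<Rightarrow> state" where
  "iupd x i v s = s\<lparr>ints := (ints s)(x := (ints s x)(i := v))\<rparr>"

definition rupd :: "vname \<Rightarrow> nat \<Rightarrow> real \<Rightarrow> state \<Rightarrow> state" where
  "rupd x i v s = s\<lparr>reals := (reals s)(x := (reals s x)(i := v))\<rparr>"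

text \<open>
  A configuration holds the commands still to be executed; it has halted when none are left.
  One step costs one time unit. It evaluates a bounded number of expressions of the program text,
  hence performs a number of arithmetic operations bounded by a constant of the program.
\<close>

type_synonym config = "com list \<times> state"

fun step :: "config \<Rightarrow> config pmf" where
  "step ([], s) = return_pmf ([], s)"
| "step (ISet x e f # K, s) = return_pmf (K, iupd x (ival e s) (ival f s) s)"
| "step (RSet x e f # K, s) = return_pmf (K, rupd x (ival e s) (rval f s) s)"
| "step (Flip x e # K, s) = map_pmf (\<lambda>b. (K, iupd x (ival e s) b s)) (pmf_of_set {0, 1})"
| "step (Cond b c d # K, s) = return_pmf (if bval b s then c @ K else d @ K, s)"
| "step (While b c # K, s) = return_pmf (if bval b s then c @ While b c # K else K, s)"

primrec run :: "nat \<Rightarrow> config \<Rightarrow> config pmf" where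
  "run 0 cfg = return_pmf cfg"
| "run (Suc t) cfg = bind_pmf (run t cfg) step"

definition halts_within :: "nat \<Rightarrow> com list \<Rightarrow> state \<Rightarrow> bool" where
  "halts_within t P s \<longleftrightarrow> (\<forall>cfg \<in> set_pmf (run t (P, s)). fst cfg = [])"

definition input_state :: "real \<Rightarrow> nat \<Rightarrow> nat \<Rightarrow> real mat \<Rightarrow> real mat \<Rightarrow> state" where
  "input_state \<epsilon> n q M D = \<lparr>
     ints = (\<lambda>x i. if x = ''n'' \<and> i = 0 then n else if x = ''q'' \<and> i = 0 then q else 0),
     reals = (\<lambda>x i.
       if x = ''eps'' \<and> i = 0 then \<epsilon>
       else if x = ''D'' \<and> i < n then D $$ (i, i)
       else if x = ''M'' \<and> i < (n * q) * (n * q) then M $$ (i div (n * q), i mod (n * q))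
       else 0)\<rparr>"

definition output_vec :: "nat \<Rightarrow> state \<Rightarrow> real Matrix.vec" where
  "output_vec m s = Matrix.vec m (\<lambda>j. real (ints s ''y'' j))"

definition output_pmf :: "nat \<Rightarrow> com list \<Rightarrow> state \<Rightarrow> nat \<Rightarrow> real Matrix.vec pmf" where
  "output_pmf t P s m = map_pmf (\<lambda>cfg. output_vec m (snd cfg)) (run t (P, s))"

lemma run_halted:
  assumes "halts_within t P s" and "t \<le> t'"
  shows "run t' (P, s) = run t (P, s)"
  using assms(2)
proof (induction t' rule: dec_induct)
  case (step u)
  have "bind_pmf (run t (P, s)) Defs.step = bind_pmf (run t (P, s)) return_pmf"
    using assms(1) by (intro bind_pmf_cong) (auto simp: halts_within_def)
  then show ?case using step.IH by (simp add: bind_return_pmf')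
qed simp

end

theory Submission
  imports Defs
begin

text \<open>
  Put \<open>x = E\<^sup>1\<^sup>/\<^sup>2 y\<close>, so that \<open>\<Phi>(y) = x\<^sup>T M x\<close> and \<open>|x|\<^sup>2 \<le> Tr D\<close> for every \<open>y\<close> in the product
  of simplices. Jacobi rotations bring \<open>M\<close> into an exactly orthonormal basis in which all off-diagonal
  entries are at most \<open>\<epsilon> / m\<close>, where \<open>m = n q\<close>. The diagonal entries above \<open>2\<epsilon>\<close> (at most \<open>k\<close> of them, by
  the min-max principle) define a positive semidefinite part \<open>A\<close> of \<open>M\<close>, and \<open>N = M - A \<le> 3\<epsilon>\<close>.

  Guess the coordinates \<open>\<zeta>\<close> of the optimal \<open>x\<close> on the top eigenvectors from a net of \<open>(1/\<epsilon>)\<^sup>O\<^sup>(\<^sup>k\<^sup>)\<close> points.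
  Replacing \<open>x\<^sup>T A x\<close> by its tangent at \<open>\<zeta>\<close> gives an almost concave lower bound of \<open>\<Phi>\<close>, tight at the optimum up to
  \<open>\<epsilon> Tr D\<close>, which Frank-Wolfe maximizes over the product of simplices. As the diagonal blocks of \<open>M\<close>
  vanish, \<open>\<Phi>\<close> is affine in each block, and moving the blocks one after the other to a best vertex
  rounds the fractional solution without loss.

  For \<open>k = 0\<close> the running time may not depend on \<open>\<epsilon>\<close>. There the trace, which is zero, bounds the whole
  spectrum by \<open>\<epsilon> m\<close> in absolute value, so that relative precision \<open>1 / m\<close> suffices throughout.
\<close>

section \<open>Deterministic programs\<close>

text \<open>In general, exact eigenvectors cannot be computed with arithmetic and square roots. A
  rotation angle needs only square roots, so the basis stays exactly orthonormal and the whole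
  spectral error sits in the off-diagonal entries; \<open>eps / m\<close> per entry costs
  \<open>eps\<close> in the form. This is why the threshold for top directions is
  \<open>2 * eps\<close> although \<open>k\<close> counts eigenvalues from \<open>eps\<close> on.
  The bound \<open>(1 / eps) ^ (8 * k)\<close> shapes the rest: a loose factor
  \<open>1 / eps\<close> may be paid only if \<open>k > 0\<close>, and a constant to the power
  \<open>k\<close> only if \<open>1 / eps\<close> absorbs it. The former explains the two values of
  \<open>pmax\<close> and of \<open>R\<close>, the latter works because a top direction forces
  \<open>2 < 1 / eps\<close>. The program cannot see \<open>k\<close>; it branches on the number of
  top directions found, which is at most \<open>k\<close>. No coin is flipped, so the random output
  is a point mass.\<close>

lemma run_add: "run (t + u) cfg = bind_pmf (run t cfg) (run u)"
  by (induction u) (simp_all add: bind_return_pmf' bind_assoc_pmf)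

definition wp :: "com list \<Rightarrow> nat \<Rightarrow> (state \<Rightarrow> bool) \<Rightarrow> state \<Rightarrow> bool" where
  "wp P T Q s \<longleftrightarrow> (\<exists>t\<le>T. \<exists>s'. Q s' \<and> (\<forall>K. run t (P @ K, s) = return_pmf (K, s')))"

text \<open>Quantifying over the continuation \<open>K\<close> is what makes sequential composition work.\<close>

lemma wpI: "t \<le> T \<Longrightarrow> Q s' \<Longrightarrow> (\<And>K. run t (P @ K, s) = return_pmf (K, s')) \<Longrightarrow> wp P T Q s"
  unfolding wp_def by blast

lemma wpE:
  assumes "wp P T Q s"
  obtains t s' where "t \<le> T" "Q s'" "\<And>K. run t (P @ K, s) = return_pmf (K, s')"
  using assms unfolding wp_def by blast

lemma wp_run:
  assumes "wp P T Q s"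
  obtains t s' where "t \<le> T" "run t (P, s) = return_pmf ([], s')" "Q s'"
proof -
  from assms obtain t s' where "t \<le> T" "Q s'" "\<forall>K. run t (P @ K, s) = return_pmf (K, s')"
    unfolding wp_def by blast
  moreover from this(3) have "run t (P @ [], s) = return_pmf ([], s')" by (rule spec)
  ultimately show thesis using that by simp
qed

lemma wp_mono:
  assumes "wp P T Q s" "T \<le> T'" "\<And>s'. Q s' \<Longrightarrow> Q' s'"
  shows "wp P T' Q' s"
  using assms(1)
proof (rule wpE)
  fix t s' assume "t \<le> T" "Q s'" "\<And>K. run t (P @ K, s) = return_pmf (K, s')"
  then show ?thesis using assms(2,3) by (intro wpI[of t]) auto
qed

lemma wp_Nil: "Q s \<Longrightarrow> wp [] T Q s"
  by (rule wpI[of 0]) auto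

lemma wp_append:
  assumes "wp P T (wp P' T' Q) s" shows "wp (P @ P') (T + T') Q s"
proof -
  obtain t s' where t: "t \<le> T" "wp P' T' Q s'" "\<And>K. run t (P @ K, s) = return_pmf (K, s')"
    using assms by - (erule wpE, blast)
  obtain u s'' where u: "u \<le> T'" "Q s''" "\<And>K. run u (P' @ K, s') = return_pmf (K, s'')"
    using t(2) by (elim wpE) blast
  show ?thesis
  proof (rule wpI[of "t + u"])
    show "run (t + u) ((P @ P') @ K, s) = return_pmf (K, s'')" for K
      by (simp add: run_add t(3) u(3) bind_return_pmf)
  qed (use t u in auto)
qed

lemma wp_step:
  assumes "\<And>K. step (c # K, s) = return_pmf (P @ K, s')" and "wp P T Q s'"
  shows "wp [c] (Suc T) Q s"
proof -
  obtain t s'' where t: "t \<le> T" "Q s''" "\<And>K. run t (P @ K, s') = return_pmf (K, s'')"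
    using assms(2) by (elim wpE) blast
  show ?thesis
  proof (rule wpI[of "1 + t"])
    show "run (1 + t) ([c] @ K, s) = return_pmf (K, s'')" for K
      unfolding run_add by (simp add: bind_return_pmf assms(1) t(3))
  qed (use t in auto)
qed

lemma wp_ISet1: "Q (iupd x (ival e s) (ival f s) s) \<Longrightarrow> wp [ISet x e f] 1 Q s"
  unfolding One_nat_def by (rule wp_step[of _ _ "[]"], simp, rule wp_Nil)

lemma wp_RSet1: "Q (rupd x (ival e s) (rval f s) s) \<Longrightarrow> wp [RSet x e f] 1 Q s"
  unfolding One_nat_def by (rule wp_step[of _ _ "[]"], simp, rule wp_Nil)

lemma wp_Cond1:
  assumes "bval b s \<Longrightarrow> wp c T Q s" and "\<not> bval b s \<Longrightarrow> wp d T Q s"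
  shows "wp [Cond b c d] (T + 1) Q s"
proof (cases "bval b s")
  case True
  then show ?thesis unfolding Suc_eq_plus1[symmetric] by (intro wp_step[of _ _ c s] assms(1)) simp
next
  case False
  then show ?thesis unfolding Suc_eq_plus1[symmetric] by (intro wp_step[of _ _ d s] assms(2)) simp
qed

lemma wp_Cons:
  assumes "wp [c] T (wp P T' Q) s" shows "wp (c # P) (T + T') Q s"
  using wp_append[OF assms] by (simp only: append_Cons append_Nil)

lemma wp_ISet: "wp P T Q (iupd x (ival e s) (ival f s) s) \<Longrightarrow> wp (ISet x e f # P) (T + 1) Q s"
  by (subst add.commute) (rule wp_Cons, rule wp_ISet1)

lemma wp_RSet: "wp P T Q (rupd x (ival e s) (rval f s) s) \<Longrightarrow> wp (RSet x e f # P) (T + 1) Q s"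
  by (subst add.commute) (rule wp_Cons, rule wp_RSet1)

lemma wp_While_unfold:
  assumes t: "bval b s \<Longrightarrow> wp (c @ [While b c]) T Q s" and f: "\<not> bval b s \<Longrightarrow> Q s"
  shows "wp [While b c] (T + 1) Q s"
proof (cases "bval b s")
  case True
  have "wp [While b c] (Suc T) Q s"
    by (rule wp_step[OF _ t[OF True]]) (simp only: step.simps True if_True append_assoc append_Cons append_Nil)
  then show ?thesis by (simp only: Suc_eq_plus1)
next
  case False
  have "wp [While b c] (Suc T) Q s"
    by (rule wp_step[OF _ wp_Nil[of Q s, OF f[OF False]]]) (simp only: step.simps False if_False append_Nil)
  then show ?thesis by (simp only: Suc_eq_plus1)
qed

text \<open>\<open>\<mu>\<close> bounds the number of rounds. A round costs its body and one test;
  the last \<open>+ 1\<close> is the test that fails.\<close>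

lemma wp_While:
  assumes step: "\<And>s. I s \<Longrightarrow> bval b s \<Longrightarrow> wp c T (\<lambda>s'. I s' \<and> \<mu> s' < \<mu> s) s"
    and exit: "\<And>s. I s \<Longrightarrow> \<not> bval b s \<Longrightarrow> Q s"
    and init: "I s" "\<mu> s \<le> N"
  shows "wp [While b c] (N * (T + 1) + 1) Q s"
  using init
proof (induction N arbitrary: s)
  case 0
  have "\<not> bval b s"
  proof
    assume "bval b s"
    then have "wp c T (\<lambda>s'. I s' \<and> \<mu> s' < \<mu> s) s" by (rule step[OF 0(1)])
    then show False using 0(2) by (elim wpE) simp
  qed
  then have "wp [While b c] (0 + 1) Q s" using exit[OF 0(1)] wp_While_unfold[of b s c 0 Q] by blast
  then show ?case by (simp only: mult_0)
next
  case (Suc N)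
  have body: "wp (c @ [While b c]) (T + (N * (T + 1) + 1)) Q s" if "bval b s"
  proof (rule wp_append, rule wp_mono[OF step[OF Suc.prems(1) that] order_refl])
    fix s' assume "I s' \<and> \<mu> s' < \<mu> s"
    then show "wp [While b c] (N * (T + 1) + 1) Q s'" using Suc.prems(2) by (intro Suc.IH) simp_all
  qed
  have "wp [While b c] (T + (N * (T + 1) + 1) + 1) Q s"
    by (rule wp_While_unfold[OF body exit[OF Suc.prems(1)]])
  then show ?case by (rule wp_mono) simp_all
qed

section \<open>Counting loops and frame conditions\<close>

abbreviation IV :: "vname \<Rightarrow> iexp" where "IV x \<equiv> IArr x (INum 0)"
abbreviation RV :: "vname \<Rightarrow> rexp" where "RV x \<equiv> RArr x (INum 0)"

definition For :: "vname \<Rightarrow> iexp \<Rightarrow> com list \<Rightarrow> com list" where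
  "For x b c = [ISet x (INum 0) (INum 0),
     While (ILess (IV x) b) (c @ [ISet x (INum 0) (IAdd (IV x) (INum 1))])]"

lemma ints_iupd [simp]:
  "ints (iupd x i v s) = (ints s)(x := (ints s x)(i := v))" by (simp add: iupd_def)
lemma reals_iupd [simp]: "reals (iupd x i v s) = reals s" by (simp add: iupd_def)
lemma ints_rupd [simp]: "ints (rupd x i v s) = ints s" by (simp add: rupd_def)
lemma reals_rupd [simp]:
  "reals (rupd x i v s) = (reals s)(x := (reals s x)(i := v))" by (simp add: rupd_def)

text \<open>The bound is an expression that is evaluated anew in each round, so \<open>bnd\<close>
  has to fix its value, also at the final \<open>i = N\<close>. A round pays its body, the increment
  and the test; the outer \<open>+ 2\<close> is the initialization and the failing test.\<close>

lemma wp_For: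
  assumes init: "I 0 (iupd x 0 0 s)"
    and bnd: "\<And>i s. I i s \<Longrightarrow> i \<le> N \<Longrightarrow> ints s x 0 = i \<Longrightarrow> ival b s = N"
    and step: "\<And>i s. I i s \<Longrightarrow> i < N \<Longrightarrow> ints s x 0 = i
      \<Longrightarrow> wp c T (\<lambda>s'. ints s' x 0 = i \<and> I (Suc i) (iupd x 0 (Suc i) s')) s"
    and exit: "\<And>s. I N s \<Longrightarrow> ints s x 0 = N \<Longrightarrow> Q s"
  shows "wp (For x b c) (N * (T + 2) + 2) Q s"
proof -
  let ?c = "c @ [ISet x (INum 0) (IAdd (IV x) (INum 1))]"
  let ?J = "\<lambda>s. \<exists>i\<le>N. I i s \<and> ints s x 0 = i"
  have "wp [While (ILess (IV x) b) ?c] (N * ((T + 1) + 1) + 1) Q (iupd x 0 0 s)"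
  proof (rule wp_While[where I = ?J and \<mu> = "\<lambda>s. N - ints s x 0"])
    fix s assume J: "?J s" and b: "bval (ILess (IV x) b) s"
    then obtain i where i: "i \<le> N" "I i s" "ints s x 0 = i" by blast
    then have "i < N" using b bnd by auto
    show "wp ?c (T + 1) (\<lambda>s'. ?J s' \<and> N - ints s' x 0 < N - ints s x 0) s"
      by (intro wp_append wp_mono[OF step[OF i(2) \<open>i < N\<close> i(3)]] wp_ISet1)
        (use i \<open>i < N\<close> in auto)
  next
    fix s assume J: "?J s" and "\<not> bval (ILess (IV x) b) s"
    then obtain i where i: "i \<le> N" "I i s" "ints s x 0 = i" by blast
    with \<open>\<not> _\<close> have "i = N" using bnd by force
    with i show "Q s" using exit by simp
  qed (use init in auto)
  then show ?thesis unfolding For_def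
    by (intro wp_mono[OF wp_ISet[where T = "N * (T + 1 + 1) + 1"]]) simp_all
qed

text \<open>Frame condition: \<open>X\<close> and \<open>Y\<close> name the integer and the real
  arrays that a fragment may write. The two kinds of arrays have separate name spaces.\<close>

definition agree :: "vname set \<Rightarrow> vname set \<Rightarrow> state \<Rightarrow> state \<Rightarrow> bool" where
  "agree X Y s s' \<longleftrightarrow> (\<forall>x. x \<notin> X \<longrightarrow> ints s' x = ints s x) \<and> (\<forall>x. x \<notin> Y \<longrightarrow> reals s' x = reals s x)"

lemma agreeD:
  assumes "agree X Y s s'"
  shows "x \<notin> X \<Longrightarrow> ints s' x = ints s x" and "y \<notin> Y \<Longrightarrow> reals s' y = reals s y"
  using assms by (auto simp: agree_def)

lemma agree_refl: "agree X Y s s" by (simp add: agree_def)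

lemma agree_trans:
  assumes "agree X Y s s'" "agree X' Y' s' s''" "X \<subseteq> Z" "X' \<subseteq> Z" "Y \<subseteq> W" "Y' \<subseteq> W"
  shows "agree Z W s s''"
proof -
  have "ints s'' x = ints s x" if "x \<notin> Z" for x
    using agreeD(1)[OF assms(1), of x] agreeD(1)[OF assms(2), of x] assms(3,4) that by fastforce
  moreover have "reals s'' x = reals s x" if "x \<notin> W" for x
    using agreeD(2)[OF assms(1), of x] agreeD(2)[OF assms(2), of x] assms(5,6) that by fastforce
  ultimately show ?thesis by (simp add: agree_def)
qed

lemma agree_iupd [simp]: "x \<in> X \<Longrightarrow> agree X Y s (iupd x i v s') \<longleftrightarrow> agree X Y s s'"
  by (auto simp: agree_def)
lemma agree_rupd [simp]: "y \<in> Y \<Longrightarrow> agree X Y s (rupd y i v s') \<longleftrightarrow> agree X Y s s'"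
  by (auto simp: agree_def)

definition SumLoop :: "vname \<Rightarrow> vname \<Rightarrow> iexp \<Rightarrow> rexp \<Rightarrow> com list" where
  "SumLoop y x b e = RSet y (INum 0) (ROf (INum 0)) # For x b [RSet y (INum 0) (RAdd (RV y) e)]"

lemma wp_SumLoop:
  assumes bnd: "\<And>s'. agree {x} {y} s s' \<Longrightarrow> ival b s' = N"
    and val: "\<And>i s'. agree {x} {y} s s' \<Longrightarrow> ints s' x 0 = i \<Longrightarrow> i < N \<Longrightarrow> rval e s' = f i"
    and post: "\<And>s'. agree {x} {y} s s' \<Longrightarrow> reals s' y 0 = (\<Sum>i<N. f i) \<Longrightarrow> Q s'"
  shows "wp (SumLoop y x b e) (3 * N + 3) Q s"
proof -
  have "wp (For x b [RSet y (INum 0) (RAdd (RV y) e)]) (N * (1 + 2) + 2) Q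
      (rupd y 0 0 s)"
  proof (rule wp_For[where I = "\<lambda>i s'. agree {x} {y} s s' \<and> reals s' y 0 = (\<Sum>l<i. f l)"])
    fix i s' assume "agree {x} {y} s s' \<and> reals s' y 0 = (\<Sum>l<i. f l)" "i < N" "ints s' x 0 = i"
    then show "wp [RSet y (INum 0) (RAdd (RV y) e)] 1 (\<lambda>s'. ints s' x 0 = i \<and>
        agree {x} {y} s (iupd x 0 (Suc i) s') \<and> reals (iupd x 0 (Suc i) s') y 0 = sum f {..<Suc i}) s'"
      by (intro wp_RSet1) (simp add: val)
  qed (use bnd post in \<open>auto simp: agree_refl\<close>)
  then show ?thesis unfolding SumLoop_def
    by (intro wp_mono[OF wp_RSet[where T = "N * (1 + 2) + 2"]]) simp_all
qed

section \<open>Symmetric real matrices\<close>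

text \<open>Over the complex numbers an eigenvalue exists. The Hermitian form at its eigenvector is
  real, hence so is the eigenvalue. As the matrix is real, real and imaginary part of the
  eigenvector satisfy the same equation, and one of them is nonzero.\<close>

lemma symmetric_real_eigenvector:
  fixes A :: "real mat"
  assumes A: "A \<in> carrier_mat n n" and sym: "A\<^sup>T = A" and n: "0 < n"
  obtains l v where "v \<in> carrier_vec n" "v \<noteq> 0\<^sub>v n" "A *\<^sub>v v = l \<cdot>\<^sub>v v"
proof -
  define Ac where "Ac = map_mat complex_of_real A"
  have Ac: "Ac \<in> carrier_mat n n" using A by (simp add: Ac_def)
  obtain as where as: "char_poly Ac = (\<Prod>a\<leftarrow>as. [:- a, 1:])" "length as = n"
    using char_poly_factorized[OF Ac] by blast
  then obtain \<mu> as' where "as = \<mu> # as'" using n by (cases as) auto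
  then have "eigenvalue Ac \<mu>" unfolding eigenvalue_root_char_poly[OF Ac] as(1) by simp
  then obtain w where w: "w \<in> carrier_vec n" "w \<noteq> 0\<^sub>v n" "Ac *\<^sub>v w = \<mu> \<cdot>\<^sub>v w"
    using Ac by (auto simp: eigenvalue_def eigenvector_def)
  have symij: "A $$ (i, j) = A $$ (j, i)" if "i < n" "j < n" for i j
    using that A sym by (metis carrier_matD index_transpose_mat(1))
  have ev: "(\<Sum>j<n. of_real (A $$ (i, j)) * vec_index w j) = \<mu> * vec_index w i" if "i < n" for i
  proof -
    have "vec_index (Ac *\<^sub>v w) i = (\<Sum>j<n. of_real (A $$ (i, j)) * vec_index w j)"
      using that A w(1) by (simp add: Ac_def scalar_prod_def lessThan_atLeast0)
    then show ?thesis using w that by simp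
  qed
  obtain i0 where i0: "i0 < n" "vec_index w i0 \<noteq> 0"
    using w(1,2) by (metis carrier_vecD eq_vecI index_zero_vec)
  define X where "X = (\<Sum>i<n. \<Sum>j<n. cnj (vec_index w i) * of_real (A $$ (i, j)) * vec_index w j)"
  define N where "N = (\<Sum>i<n. (cmod (vec_index w i))\<^sup>2)"
  have "X = (\<Sum>i<n. cnj (vec_index w i) * (\<mu> * vec_index w i))"
    unfolding X_def by (intro sum.cong refl) (auto simp: ev[symmetric] sum_distrib_left mult.assoc)
  also have "\<dots> = \<mu> * of_real N"
    unfolding N_def of_real_sum sum_distrib_left
    by (intro sum.cong refl) (simp add: complex_norm_square mult_ac del: of_real_power)
  finally have X: "X = \<mu> * of_real N" .
  have "cnj X = (\<Sum>i<n. \<Sum>j<n. vec_index w i * of_real (A $$ (i, j)) * cnj (vec_index w j))"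
    by (simp add: X_def)
  also have "\<dots> = (\<Sum>j<n. \<Sum>i<n. vec_index w i * of_real (A $$ (i, j)) * cnj (vec_index w j))"
    by (rule sum.swap)
  also have "\<dots> = X"
    unfolding X_def by (intro sum.cong refl) (auto simp: symij mult_ac)
  finally have "cnj X = X" .
  moreover have "N \<noteq> 0"
  proof -
    have "0 < (cmod (vec_index w i0))\<^sup>2" using i0 by simp
    also have "\<dots> \<le> N" unfolding N_def by (rule member_le_sum) (use i0 in auto)
    finally show ?thesis by simp
  qed
  ultimately have "cnj \<mu> = \<mu>" unfolding X by simp
  then have \<mu>: "\<mu> = of_real (Re \<mu>)" by (simp add: complex_eq_iff)
  have re: "(\<Sum>j<n. A $$ (i, j) * f (vec_index w j)) = Re \<mu> * f (vec_index w i)"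
    if "i < n" and f: "f = Re \<or> f = Im" for f i
  proof -
    have f_sum: "f (sum g S) = (\<Sum>j\<in>S. f (g j))" for g :: "nat \<Rightarrow> complex" and S
      using f by (auto simp: Re_sum Im_sum)
    have f_mult: "f (of_real r * z) = r * f z" for r z using f by auto
    have "f (\<Sum>j<n. of_real (A $$ (i, j)) * vec_index w j) = f (of_real (Re \<mu>) * vec_index w i)"
      using ev[OF that(1)] \<mu> by simp
    then show ?thesis by (simp only: f_sum f_mult)
  qed
  define f where "f = (if Re (vec_index w i0) \<noteq> 0 then Re else Im)"
  have f: "f = Re \<or> f = Im" "f (vec_index w i0) \<noteq> 0"
    using i0(2) by (auto simp: f_def complex_eq_iff)
  show thesis
  proof (rule that)
    let ?v = "Matrix.vec n (\<lambda>i. f (vec_index w i))"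
    show "?v \<in> carrier_vec n" by simp
    show "?v \<noteq> 0\<^sub>v n" using f(2) i0(1) by (metis index_vec index_zero_vec(1))
    show "A *\<^sub>v ?v = Re \<mu> \<cdot>\<^sub>v ?v"
      by (rule eq_vecI) (use A re[OF _ f(1)] in \<open>auto simp: scalar_prod_def lessThan_atLeast0\<close>)
  qed
qed

text \<open>The reflection that exchanges the unit vector \<open>v\<close> with the first basis
  vector. If the two coincide, the division by zero gives 0 and the matrix is the identity, as it
  should be.\<close>

definition householder :: "real Matrix.vec \<Rightarrow> real mat" where
  "householder v = (let n = dim_vec v; u = v - unit_vec n 0 in
     Matrix.mat n n (\<lambda>(i, j). (if i = j then 1 else 0)
       - 2 * vec_index u i * vec_index u j / scalar_prod u u))"

lemma householder:
  assumes v: "v \<in> carrier_vec n" "scalar_prod v v = 1" and n: "0 < n"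
  defines "H \<equiv> householder v"
  shows "H \<in> carrier_mat n n" "H\<^sup>T = H" "H * H = 1\<^sub>m n" "H *\<^sub>v unit_vec n 0 = v"
proof -
  define u where "u = v - unit_vec n 0"
  define c where "c = scalar_prod u u"
  have u: "u \<in> carrier_vec n" using v by (simp add: u_def)
  have Hdef: "H = Matrix.mat n n (\<lambda>(i, j). (if i = j then 1 else 0) - 2 * vec_index u i * vec_index u j / c)"
    using v by (simp add: H_def householder_def Let_def u_def c_def)
  show H: "H \<in> carrier_mat n n" by (simp add: Hdef)
  show "H\<^sup>T = H" by (rule eq_matI) (auto simp: Hdef)
  have cs: "c = (\<Sum>k<n. vec_index u k * vec_index u k)"
    using u by (simp add: c_def scalar_prod_def lessThan_atLeast0)
  have u0: "vec_index u k = 0" if "c = 0" "k < n" for k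
    using that unfolding cs by (subst (asm) sum_nonneg_eq_0_iff) auto
  show "H * H = 1\<^sub>m n"
  proof (rule eq_matI)
    fix i j assume "i < dim_row (1\<^sub>m n :: real mat)" "j < dim_col (1\<^sub>m n :: real mat)"
    then have ij: "i < n" "j < n" by auto
    \<comment> \<open>The final cancellation needs \<open>d * d * c = d\<close>, which also holds
      for \<open>c = 0\<close>, where \<open>d = 0\<close>. So the degenerate reflection needs no
      case distinction.\<close>
    define d where "d = 1 / c"
    have "(H * H) $$ (i, j) = (\<Sum>k<n. ((if i = k then 1 else 0) - 2 * vec_index u i * vec_index u k * d)
         * ((if k = j then 1 else 0) - 2 * vec_index u k * vec_index u j * d))"
      using ij by (simp add: Hdef scalar_prod_def lessThan_atLeast0 d_def)
    also have "\<dots> = (\<Sum>k<n. (if k = i then (if i = j then 1 else 0) - 2 * vec_index u i * vec_index u j * d else 0)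
        + (if k = j then - 2 * vec_index u i * vec_index u j * d else 0)
        + 4 * vec_index u i * vec_index u j * d * d * (vec_index u k * vec_index u k))"
      by (intro sum.cong refl) (auto simp: algebra_simps)
    also have "\<dots> = (if i = j then 1 else 0) - 4 * vec_index u i * vec_index u j * d
        + 4 * vec_index u i * vec_index u j * d * d * c"
      using ij by (simp add: sum.distrib cs flip: sum_distrib_left)
    also have "\<dots> = (if i = j then 1 else 0)" by (simp add: d_def)
    finally show "(H * H) $$ (i, j) = (1\<^sub>m n) $$ (i, j)" using ij by simp
  qed (use H in auto)
  have "c = scalar_prod v v - 2 * vec_index v 0 + 1"
  proof -
    have "c = scalar_prod v v - scalar_prod v (unit_vec n 0) - (scalar_prod (unit_vec n 0) v - 1)"
      using v(1) n unfolding c_def u_def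
      by (simp add: minus_scalar_prod_distrib[of _ n] scalar_prod_minus_distrib[of _ n])
    then show ?thesis using v(1) n by simp
  qed
  \<comment> \<open>Consequently column 0 of \<open>H\<close> is the first basis vector plus
    \<open>u\<close>, that is, \<open>v\<close>.\<close>
  then have c: "c = - 2 * vec_index u 0" using v n by (simp add: u_def)
  show "H *\<^sub>v unit_vec n 0 = v"
  proof (rule eq_vecI)
    fix i assume "i < dim_vec v"
    then have i: "i < n" using v by simp
    have "vec_index (H *\<^sub>v unit_vec n 0) i = H $$ (i, 0)"
      using H i n by simp
    also have "\<dots> = (if i = 0 then 1 else 0) - 2 * vec_index u i * vec_index u 0 / c"
      using i n by (simp add: Hdef)
    also have "\<dots> = (if i = 0 then 1 else 0) + vec_index u i"
    proof (cases "c = 0")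
      case False
      then show ?thesis using c by (simp add: field_simps)
    qed (simp add: u0 i)
    also have "\<dots> = vec_index v i" using v i n by (simp add: u_def)
    finally show "vec_index (H *\<^sub>v unit_vec n 0) i = vec_index v i" .
  qed (use v H in auto)
qed

text \<open>A reflection moves a unit eigenvector to the first coordinate. There the matrix splits
  into a 1 by 1 block and a symmetric remainder, since symmetry carries the zeros of column 0 over
  to row 0.\<close>

theorem symmetric_real_diagonalization:
  fixes A :: "real mat"
  assumes "A \<in> carrier_mat n n" "A\<^sup>T = A"
  shows "\<exists>P D. similar_mat_wit A D P P\<^sup>T \<and> diagonal_mat D"
  using assms
proof (induction n arbitrary: A)
  case 0
  then show ?case using similar_mat_wit_refl[of A 0]
    by (intro exI[of _ "1\<^sub>m 0"] exI[of _ A]) (auto simp: diagonal_mat_def)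
next
  case (Suc n)
  let ?N = "Suc n"
  note A = Suc.prems(1)
  obtain l w where w: "w \<in> carrier_vec ?N" "w \<noteq> 0\<^sub>v ?N" "A *\<^sub>v w = l \<cdot>\<^sub>v w"
    using symmetric_real_eigenvector[OF Suc.prems] by blast
  define c where "c = 1 / sqrt (scalar_prod w w)"
  define v where "v = c \<cdot>\<^sub>v w"
  have "0 \<le> scalar_prod w w" by (simp add: scalar_prod_def sum_nonneg)
  moreover have "scalar_prod w w \<noteq> 0"
  proof
    assume "scalar_prod w w = 0"
    then have "\<forall>i<?N. vec_index w i = 0"
      using w(1) by (auto simp: scalar_prod_def sum_nonneg_eq_0_iff simp del: sum.op_ivl_Suc)
    then show False using w(1,2) by (metis carrier_vecD eq_vecI index_zero_vec)
  qed
  ultimately have ww: "0 < scalar_prod w w" by simp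
  have v: "v \<in> carrier_vec ?N" using w by (simp add: v_def)
  have vv: "scalar_prod v v = 1"
    using w(1) ww by (simp add: v_def c_def power2_eq_square[symmetric] power_divide)
  have Av: "A *\<^sub>v v = l \<cdot>\<^sub>v v"
    using A w by (simp add: v_def mult_mat_vec smult_smult_assoc mult.commute)
  define H where "H = householder v"
  note H = householder[OF v vv zero_less_Suc, folded H_def]
  define B where "B = H * A * H"
  have B: "B \<in> carrier_mat ?N ?N" using H(1) A by (simp add: B_def)
  have Bsym: "B\<^sup>T = B"
    unfolding B_def using A H(1)
    by (subst transpose_mult[of _ ?N ?N _ ?N], simp, simp, subst transpose_mult[of _ ?N ?N _ ?N], simp, simp)
      (simp add: H(2) Suc.prems(2) assoc_mult_mat[of _ ?N ?N _ ?N _ ?N])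
  have AB: "similar_mat_wit A B H H"
  proof (rule similar_mat_witI[OF H(3) H(3) _ A B H(1) H(1)])
    have "H * B * H = (H * H) * A * (H * H)"
      using A H(1) by (simp add: B_def assoc_mult_mat[of _ ?N ?N _ ?N _ ?N])
    then show "A = H * B * H" using A by (simp add: H(3))
  qed
  have "B *\<^sub>v unit_vec ?N 0 = H *\<^sub>v (A *\<^sub>v (H *\<^sub>v unit_vec ?N 0))"
    using A H(1) by (simp add: B_def assoc_mult_mat_vec[of _ ?N ?N _ ?N])
  also have "\<dots> = l \<cdot>\<^sub>v (H *\<^sub>v (H *\<^sub>v unit_vec ?N 0))"
    using v H(1) by (simp add: H(4) Av mult_mat_vec)
  also have "H *\<^sub>v (H *\<^sub>v unit_vec ?N 0) = unit_vec ?N 0"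
    using H(1,3) by (metis assoc_mult_mat_vec one_mult_mat_vec unit_vec_carrier)
  finally have Be: "B *\<^sub>v unit_vec ?N 0 = l \<cdot>\<^sub>v unit_vec ?N 0" .
  have B0: "B $$ (i, 0) = (if i = 0 then l else 0)" if "i < ?N" for i
  proof -
    have "B $$ (i, 0) = vec_index (B *\<^sub>v unit_vec ?N 0) i" using B that by simp
    then show ?thesis using that by (simp add: Be)
  qed
  have B0': "B $$ (0, i) = (if i = 0 then l else 0)" if "i < ?N" for i
    using B0[OF that] B Bsym that by (metis carrier_matD index_transpose_mat(1) zero_less_Suc)
  define A3 where "A3 = Matrix.mat n n (\<lambda>(i, j). B $$ (Suc i, Suc j))"
  define L where "L = Matrix.mat 1 1 (\<lambda>_. l)"
  have L: "L \<in> carrier_mat 1 1" and A3: "A3 \<in> carrier_mat n n" by (auto simp: L_def A3_def)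
  have blk: "B = four_block_mat L (0\<^sub>m 1 n) (0\<^sub>m n 1) A3"
    by (rule eq_matI) (use B B0 B0' in \<open>auto simp: L_def A3_def less_Suc_eq_0_disj\<close>)
  have "A3\<^sup>T = A3"
    using B Bsym by (intro eq_matI) (auto simp: A3_def, metis Suc_less_eq carrier_matD index_transpose_mat(1))
  then obtain P3 D3 where PD: "similar_mat_wit A3 D3 P3 P3\<^sup>T" "diagonal_mat D3"
    using Suc.IH[OF A3] by blast
  note PDc = similar_mat_witD2[OF A3 PD(1)]
  define F where "F = four_block_mat (1\<^sub>m 1) (0\<^sub>m 1 n) (0\<^sub>m n 1) P3"
  define G where "G = four_block_mat L (0\<^sub>m 1 n) (0\<^sub>m n 1) D3"
  have F: "F \<in> carrier_mat ?N ?N" using four_block_carrier_mat[of "1\<^sub>m 1" 1 1 P3 n n] PDc(6) by (simp add: F_def)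
  have FT: "F\<^sup>T = four_block_mat (1\<^sub>m 1) (0\<^sub>m 1 n) (0\<^sub>m n 1) P3\<^sup>T"
    unfolding F_def using PDc by (subst transpose_four_block_mat[of _ 1 1 _ n _ n]) auto
  have "similar_mat_wit B G F F\<^sup>T"
    unfolding blk G_def FT unfolding F_def
    by (rule similar_mat_wit_four_block[OF similar_mat_wit_refl[OF L] PD(1) _ _ L A3])
      (use PDc in auto)
  then have "similar_mat_wit A G (H * F) (F\<^sup>T * H)"
    by (rule similar_mat_wit_trans[OF AB])
  moreover have "F\<^sup>T * H = (H * F)\<^sup>T"
    using F H by (simp add: transpose_mult[of _ ?N ?N])
  moreover have "diagonal_mat G"
    using PD(2) PDc(5) by (auto simp: G_def diagonal_mat_def L_def less_Suc_eq_0_disj) metis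
  ultimately show ?case by metis
qed

section \<open>Counting eigenvalues above a threshold\<close>

lemma sum_factor_quadratic:
  fixes x y :: "nat \<Rightarrow> real"
  shows "(\<Sum>i\<in>A. \<Sum>j\<in>B. x i * (\<Sum>k\<in>K. p i k * d k * r j k) * y j)
    = (\<Sum>k\<in>K. d k * (\<Sum>i\<in>A. p i k * x i) * (\<Sum>j\<in>B. r j k * y j))"
proof -
  have "(\<Sum>i\<in>A. \<Sum>j\<in>B. x i * (\<Sum>k\<in>K. p i k * d k * r j k) * y j)
     = (\<Sum>i\<in>A. \<Sum>j\<in>B. \<Sum>k\<in>K. d k * ((p i k * x i) * (r j k * y j)))"
    by (intro sum.cong refl) (simp add: sum_distrib_left sum_distrib_right mult_ac)
  also have "\<dots> = (\<Sum>k\<in>K. \<Sum>i\<in>A. \<Sum>j\<in>B. d k * ((p i k * x i) * (r j k * y j)))"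
    by (subst (2) sum.swap, subst sum.swap) (rule refl)
  also have "\<dots> = (\<Sum>k\<in>K. d k * (\<Sum>i\<in>A. p i k * x i) * (\<Sum>j\<in>B. r j k * y j))"
    by (simp only: mult.assoc sum_product) (simp only: sum_distrib_left)
  finally show ?thesis .
qed

lemma prod_linear_nonzero: "(\<Prod>a\<leftarrow>as. [:- a, 1:]) \<noteq> (0 :: real poly)"
  by (induction as) (simp_all del: mult_pCons_left)

lemma poly_prod_linear_eq_0: "poly (\<Prod>a\<leftarrow>as. [:- a, 1:]) x = 0 \<longleftrightarrow> (x :: real) \<in> set as"
  by (induction as) (simp_all del: mult_pCons_left)

lemma order_prod_linear: "order x (\<Prod>a\<leftarrow>as. [:- a, 1:]) = count_list as (x :: real)"
proof (induction as)
  case (Cons a as)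
  have one: "order x [:- a, 1:] = (if a = x then 1 else 0)"
  proof (cases "a = x")
    case True
    then show ?thesis using order_power_n_n[of a 1] by simp
  next
    case False
    then show ?thesis by (simp add: order_0I)
  qed
  have "order x ([:- a, 1:] * (\<Prod>a\<leftarrow>as. [:- a, 1:]))
      = order x [:- a, 1:] + order x (\<Prod>a\<leftarrow>as. [:- a, 1:])"
    using prod_linear_nonzero[of "a # as"] by (intro order_mult) (simp del: mult_pCons_left)
  then show ?case by (simp add: one Cons.IH del: mult_pCons_left)
qed (simp add: order_0I)

text \<open>Similarity preserves the characteristic polynomial, here the product of the linear
  factors of the diagonal of \<open>D\<close>; the order of a root counts its occurrences on that
  diagonal.\<close>

lemma rank_ge_eq_card:
  assumes M: "M \<in> carrier_mat m m" and wit: "similar_mat_wit M D P Q" and diag: "diagonal_mat D"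
  shows "rank_ge \<epsilon> M = card {i. i < m \<and> \<epsilon> \<le> D $$ (i, i)}"
proof -
  have D: "D \<in> carrier_mat m m" using similar_mat_witD2[OF M wit] by simp
  define ds where "ds = diag_mat D"
  have "char_poly M = char_poly D" using wit by (intro char_poly_similar) (auto simp: similar_mat_def)
  also have "\<dots> = (\<Prod>a\<leftarrow>ds. [:- a, 1:])"
    unfolding ds_def using D diag by (intro char_poly_upper_triangular) (auto simp: diagonal_mat_def upper_triangular_def)
  finally have cp: "char_poly M = (\<Prod>a\<leftarrow>ds. [:- a, 1:])" .
  have ev: "eigenvalue M x \<longleftrightarrow> x \<in> set ds" for x
    unfolding eigenvalue_root_char_poly[OF M] cp by (rule poly_prod_linear_eq_0)
  have cnt: "count_list xs x = count_list (filter ((\<le>) \<epsilon>) xs) x" if "\<epsilon> \<le> x" for x and xs :: "real list"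
    using that by (induction xs) auto
  have "rank_ge \<epsilon> M = (\<Sum>x | x \<in> set ds \<and> \<epsilon> \<le> x. count_list (filter ((\<le>) \<epsilon>) ds) x)"
    unfolding rank_ge_def ev cp order_prod_linear by (rule sum.cong[OF refl]) (rule cnt, simp)
  also have "\<dots> = length (filter ((\<le>) \<epsilon>) ds)"
    by (intro sum_count_set) auto
  also have "\<dots> = card {i. i < m \<and> \<epsilon> \<le> D $$ (i, i)}"
    unfolding length_filter_conv_card using D
    by (intro arg_cong[of _ _ card]) (auto simp: ds_def diag_mat_def)
  finally show ?thesis .
qed

text \<open>One half of the min-max principle. If fewer than \<open>d\<close> eigenvalues reach
  \<open>\<epsilon>\<close>, some nontrivial combination of the \<open>d\<close> vectors is
  orthogonal to the corresponding eigenvectors, and its form is at most \<open>\<epsilon>\<close>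
  times its squared norm. The strict inequality in \<open>pos\<close> entails the linear
  independence of the vectors.\<close>

lemma rank_ge_lower:
  assumes M: "M \<in> carrier_mat m m" "M\<^sup>T = M"
    and pos: "\<And>c. \<exists>t<d. c t \<noteq> 0 \<Longrightarrow>
      \<epsilon> * (\<Sum>i<m. (\<Sum>t<d. c t * W t i)\<^sup>2)
        < (\<Sum>i<m. \<Sum>j<m. (\<Sum>t<d. c t * W t i) * M $$ (i, j) * (\<Sum>t<d. c t * W t j))"
  shows "d \<le> rank_ge \<epsilon> M"
proof (rule ccontr)
  assume nd: "\<not> d \<le> rank_ge \<epsilon> M"
  obtain P D where PD: "similar_mat_wit M D P P\<^sup>T" "diagonal_mat D"
    using symmetric_real_diagonalization[OF M] by blast
  note wit = similar_mat_witD2[OF M(1) PD(1)]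
  define I where "I = {i. i < m \<and> \<epsilon> \<le> D $$ (i, i)}"
  have r: "card I < d" using nd rank_ge_eq_card[OF M(1) PD] by (simp add: I_def)
  obtain e where e: "bij_betw e {0..<card I} I" using ex_bij_betw_nat_finite[of I] by (auto simp: I_def)
  \<comment> \<open>Row \<open>r\<close> holds the inner products with the \<open>r\<close>-th of
    these eigenvectors. There are fewer than \<open>d\<close> of them, and the zero rows that fill
    up the square make \<open>Z\<close> singular.\<close>
  define Z where "Z = Matrix.mat d d (\<lambda>(r, t). if r < card I then \<Sum>i<m. P $$ (i, e r) * W t i else 0)"
  have Z: "Z \<in> carrier_mat d d" by (simp add: Z_def)
  have "Z\<^sup>T *\<^sub>v unit_vec d (card I) = 0\<^sub>v d"
    by (rule eq_vecI) (use r in \<open>auto simp: Z_def\<close>)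
  then have "det (Z\<^sup>T) = 0"
    using r Z by (subst det_0_iff_vec_prod_zero_field[of _ d]) (auto intro!: exI[of _ "unit_vec d (card I)"])
  then have "det Z = 0" using det_transpose[OF Z] by simp
  then obtain cv where cv: "cv \<in> carrier_vec d" "cv \<noteq> 0\<^sub>v d" "Z *\<^sub>v cv = 0\<^sub>v d"
    using det_0_iff_vec_prod_zero_field[OF Z] by blast
  define c where "c = vec_index cv"
  define w where "w i = (\<Sum>t<d. c t * W t i)" for i
  define \<eta> where "\<eta> k = (\<Sum>i<m. P $$ (i, k) * w i)" for k
  have cne: "\<exists>t<d. c t \<noteq> 0"
    using cv(1,2) unfolding c_def by (metis carrier_vecD eq_vecI index_zero_vec)
  have \<eta>0: "\<eta> k = 0" if "k \<in> I" for k
  proof -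
    have "k \<in> e ` {0..<card I}" using that bij_betw_imp_surj_on[OF e] by simp
    then obtain r where r': "r < card I" "k = e r" by auto
    then have "0 = (\<Sum>t<d. (\<Sum>i<m. P $$ (i, k) * W t i) * c t)"
      using arg_cong[OF cv(3), of "\<lambda>v. vec_index v r"] cv(1) r
      by (simp add: Z_def scalar_prod_def c_def lessThan_atLeast0)
    also have "\<dots> = \<eta> k"
      unfolding \<eta>_def w_def sum_distrib_left sum_distrib_right by (subst sum.swap) (simp add: mult_ac)
    finally show ?thesis by simp
  qed
  have Mij: "M $$ (i, j) = (\<Sum>k<m. P $$ (i, k) * D $$ (k, k) * P $$ (j, k))" if "i < m" "j < m" for i j
  proof -
    have PDk: "(P * D) $$ (i, k) = P $$ (i, k) * D $$ (k, k)" if "k < m" for k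
    proof -
      have "(P * D) $$ (i, k) = (\<Sum>l<m. P $$ (i, l) * D $$ (l, k))"
        using wit(5,6) \<open>i < m\<close> that by (simp add: scalar_prod_def lessThan_atLeast0)
      also have "\<dots> = (\<Sum>l<m. if l = k then P $$ (i, k) * D $$ (k, k) else 0)"
        using PD(2) wit(5) that by (intro sum.cong) (auto simp: diagonal_mat_def)
      finally show ?thesis using that by simp
    qed
    have "M $$ (i, j) = (P * D * P\<^sup>T) $$ (i, j)" using wit(3) by simp
    also have "\<dots> = (\<Sum>k<m. (P * D) $$ (i, k) * P $$ (j, k))"
    proof -
      define X where "X = P * D"
      have "X \<in> carrier_mat m m" using wit(5,6) by (simp add: X_def)
      then show ?thesis
        using wit(6) that unfolding X_def[symmetric] by (simp add: scalar_prod_def lessThan_atLeast0)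
    qed
    finally show ?thesis by (simp add: PDk)
  qed
  \<comment> \<open>The factor 1 brings orthonormality into the shape of
    \<open>sum_factor_quadratic\<close>, which then treats the squared norm just like the
    form.\<close>
  have one: "(\<Sum>k<m. P $$ (i, k) * 1 * P $$ (j, k)) = (if i = j then 1 else 0)" if "i < m" "j < m" for i j
  proof -
    have "(P * P\<^sup>T) $$ (i, j) = (\<Sum>k<m. P $$ (i, k) * P $$ (j, k))"
      using wit(6) that by (simp add: scalar_prod_def lessThan_atLeast0)
    then show ?thesis using wit(1) that by simp
  qed
  have "(\<Sum>i<m. \<Sum>j<m. w i * M $$ (i, j) * w j)
      = (\<Sum>i<m. \<Sum>j<m. w i * (\<Sum>k<m. P $$ (i, k) * D $$ (k, k) * P $$ (j, k)) * w j)"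
    by (intro sum.cong refl) (simp add: Mij)
  also have "\<dots> = (\<Sum>k<m. D $$ (k, k) * \<eta> k * \<eta> k)"
    unfolding \<eta>_def by (rule sum_factor_quadratic)
  finally have form: "(\<Sum>i<m. \<Sum>j<m. w i * M $$ (i, j) * w j) = (\<Sum>k<m. D $$ (k, k) * \<eta> k * \<eta> k)" .
  have term_le: "D $$ (k, k) * \<eta> k * \<eta> k \<le> \<epsilon> * (1 * \<eta> k * \<eta> k)" if k: "k < m" for k
  proof (cases "k \<in> I")
    case True
    show ?thesis by (simp only: \<eta>0[OF True])
  next
    case False
    then have "D $$ (k, k) \<le> \<epsilon>" using k by (auto simp: I_def)
    from mult_right_mono[OF this, of "\<eta> k * \<eta> k"] show ?thesis by (simp only: mult.assoc mult_1 zero_le_square)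
  qed
  have le: "(\<Sum>i<m. \<Sum>j<m. w i * M $$ (i, j) * w j) \<le> \<epsilon> * (\<Sum>k<m. 1 * \<eta> k * \<eta> k)"
    unfolding form sum_distrib_left using term_le by (intro sum_mono) simp
  have "(\<Sum>k<m. 1 * \<eta> k * \<eta> k)
      = (\<Sum>i<m. \<Sum>j<m. w i * (\<Sum>k<m. P $$ (i, k) * 1 * P $$ (j, k)) * w j)"
    unfolding \<eta>_def by (rule sum_factor_quadratic[symmetric])
  also have "\<dots> = (\<Sum>i<m. \<Sum>j<m. if i = j then w i * w i else 0)"
    by (intro sum.cong refl) (simp add: one del: mult_1_right)
  also have "\<dots> = (\<Sum>i<m. (w i)\<^sup>2)" by (simp add: power2_eq_square)
  finally show False using pos[OF cne] le unfolding w_def[symmetric] by simp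
qed

section \<open>Jacobi rotations\<close>

lemma sum_two_changed:
  fixes f g :: "nat \<Rightarrow> real"
  assumes "p < m" "r < m" "p \<noteq> r" "\<And>j. j < m \<Longrightarrow> j \<noteq> p \<Longrightarrow> j \<noteq> r \<Longrightarrow> f j = g j"
  shows "(\<Sum>j<m. f j) - (\<Sum>j<m. g j) = (f p + f r) - (g p + g r)"
proof -
  have "(\<Sum>j<m. h j) = h p + h r + (\<Sum>j\<in>{..<m} - {p} - {r}. h j)" for h :: "nat \<Rightarrow> real"
    using assms(1-3) by (simp add: sum.remove[of "{..<m}" p] sum.remove[of "{..<m} - {p}" r])
  moreover have "(\<Sum>j\<in>{..<m} - {p} - {r}. f j) = (\<Sum>j\<in>{..<m} - {p} - {r}. g j)"
    using assms(4) by (intro sum.cong) auto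
  ultimately show ?thesis by simp
qed

locale symmetric_form =
  fixes m :: nat and M :: "nat \<Rightarrow> nat \<Rightarrow> real"
  assumes sym: "i < m \<Longrightarrow> j < m \<Longrightarrow> M i j = M j i"
begin

definition bil :: "(nat \<Rightarrow> real) \<Rightarrow> (nat \<Rightarrow> real) \<Rightarrow> real" where
  "bil x y = (\<Sum>i<m. \<Sum>j<m. x i * M i j * y j)"

lemma bil_commute: "bil x y = bil y x"
proof -
  have "bil x y = (\<Sum>i<m. \<Sum>j<m. y j * M j i * x i)"
    unfolding bil_def by (intro sum.cong refl) (simp add: sym)
  also have "\<dots> = bil y x" unfolding bil_def by (rule sum.swap)
  finally show ?thesis .
qed

lemma bil_cong: "(\<And>i. i < m \<Longrightarrow> x i = x' i) \<Longrightarrow> (\<And>i. i < m \<Longrightarrow> y i = y' i) \<Longrightarrow> bil x y = bil x' y'"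
  unfolding bil_def by (intro sum.cong refl) simp

lemma bil_sum_left: "bil (\<lambda>i. \<Sum>j\<in>J. c j * v j i) y = (\<Sum>j\<in>J. c j * bil (v j) y)"
proof -
  have "bil (\<lambda>i. \<Sum>j\<in>J. c j * v j i) y = (\<Sum>i<m. \<Sum>l<m. \<Sum>j\<in>J. c j * (v j i * M i l * y l))"
    unfolding bil_def by (intro sum.cong refl) (simp add: sum_distrib_left sum_distrib_right mult_ac)
  also have "\<dots> = (\<Sum>j\<in>J. \<Sum>i<m. \<Sum>l<m. c j * (v j i * M i l * y l))"
    by (subst (2) sum.swap, subst sum.swap) (rule refl)
  finally show ?thesis unfolding bil_def sum_distrib_left .
qed

lemma bil_sum_right: "bil y (\<lambda>i. \<Sum>j\<in>J. c j * v j i) = (\<Sum>j\<in>J. c j * bil y (v j))"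
  unfolding bil_commute[of y] by (rule bil_sum_left)

lemma bil_lin_left: "bil (\<lambda>i. a * x i + b * x' i) y = a * bil x y + b * bil x' y"
  unfolding bil_def by (simp add: sum_distrib_left sum.distrib algebra_simps)

lemma bil_lin_right: "bil y (\<lambda>i. a * x i + b * x' i) = a * bil y x + b * bil y x'"
  unfolding bil_commute[of y] by (rule bil_lin_left)

text \<open>The basis vectors are the rows. Orthonormality is nevertheless stated for the columns,
  because a rotation of two rows changes just two summands in each of these sums.\<close>

definition orth :: "(nat \<Rightarrow> nat \<Rightarrow> real) \<Rightarrow> bool" where
  "orth Q \<longleftrightarrow> (\<forall>i<m. \<forall>l<m. (\<Sum>j<m. Q j i * Q j l) = (if i = l then 1 else 0))"

text \<open>A one-sided inverse of a square matrix is two-sided.\<close>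

lemma orth_rows:
  assumes "orth Q" "j < m" "l < m"
  shows "(\<Sum>i<m. Q j i * Q l i) = (if j = l then 1 else 0)"
proof -
  define A where "A = Matrix.mat m m (\<lambda>(i, j). Q j i)"
  have A: "A \<in> carrier_mat m m" by (simp add: A_def)
  have "A * A\<^sup>T = 1\<^sub>m m"
    using assms(1) by (intro eq_matI) (auto simp: A_def scalar_prod_def orth_def lessThan_atLeast0)
  then have "A\<^sup>T * A = 1\<^sub>m m"
    using A by (intro mat_mult_left_right_inverse[of A m]) auto
  then have "(A\<^sup>T * A) $$ (j, l) = (if j = l then 1 else 0)" using assms(2,3) by simp
  then show ?thesis using assms(2,3) by (simp add: A_def scalar_prod_def lessThan_atLeast0)
qed

definition rot :: "real \<Rightarrow> real \<Rightarrow> nat \<Rightarrow> nat \<Rightarrow> (nat \<Rightarrow> nat \<Rightarrow> real) \<Rightarrow> nat \<Rightarrow> nat \<Rightarrow> real" where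
  "rot c s p r Q = Q(p := \<lambda>i. c * Q p i + s * Q r i, r := \<lambda>i. c * Q r i + (- s) * Q p i)"

text \<open>Jacobi's potential. The sum of the squares of all entries is invariant under rotations,
  so what an off-diagonal entry loses appears here.\<close>

definition pot :: "(nat \<Rightarrow> nat \<Rightarrow> real) \<Rightarrow> real" where
  "pot Q = (\<Sum>j<m. (bil (Q j) (Q j))\<^sup>2)"

definition tr :: "(nat \<Rightarrow> nat \<Rightarrow> real) \<Rightarrow> real" where
  "tr Q = (\<Sum>j<m. bil (Q j) (Q j))"

lemma orth_rot:
  assumes Q: "orth Q" and pr: "p < m" "r < m" "p \<noteq> r" and cs: "c\<^sup>2 + s\<^sup>2 = 1"
  shows "orth (rot c s p r Q)"
  unfolding orth_def
proof (intro allI impI)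
  fix i l assume il: "i < m" "l < m"
  let ?Q = "rot c s p r Q"
  have "(\<Sum>j<m. ?Q j i * ?Q j l) - (\<Sum>j<m. Q j i * Q j l)
      = (?Q p i * ?Q p l + ?Q r i * ?Q r l) - (Q p i * Q p l + Q r i * Q r l)"
    using pr by (intro sum_two_changed) (auto simp: rot_def)
  also have "\<dots> = (c\<^sup>2 + s\<^sup>2 - 1) * (Q p i * Q p l + Q r i * Q r l)"
    using pr(3) by (simp add: rot_def power2_eq_square algebra_simps)
  finally show "(\<Sum>j<m. ?Q j i * ?Q j l) = (if i = l then 1 else 0)"
    using Q il cs by (simp add: orth_def)
qed

lemma bil_rot:
  assumes "p \<noteq> r"
  shows "bil (rot c s p r Q p) (rot c s p r Q p)
      = c\<^sup>2 * bil (Q p) (Q p) + 2 * c * s * bil (Q p) (Q r) + s\<^sup>2 * bil (Q r) (Q r)"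
    and "bil (rot c s p r Q r) (rot c s p r Q r)
      = c\<^sup>2 * bil (Q r) (Q r) - 2 * c * s * bil (Q p) (Q r) + s\<^sup>2 * bil (Q p) (Q p)"
proof -
  have 1: "rot c s p r Q p = (\<lambda>i. c * Q p i + s * Q r i)" "rot c s p r Q r = (\<lambda>i. c * Q r i + (- s) * Q p i)"
    using assms by (auto simp: rot_def)
  show "bil (rot c s p r Q p) (rot c s p r Q p)
      = c\<^sup>2 * bil (Q p) (Q p) + 2 * c * s * bil (Q p) (Q r) + s\<^sup>2 * bil (Q r) (Q r)"
    unfolding 1 bil_lin_left bil_lin_right
    by (simp add: bil_commute[of "Q r" "Q p"] power2_eq_square algebra_simps)
  show "bil (rot c s p r Q r) (rot c s p r Q r)
      = c\<^sup>2 * bil (Q r) (Q r) - 2 * c * s * bil (Q p) (Q r) + s\<^sup>2 * bil (Q p) (Q p)"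
    unfolding 1 bil_lin_left bil_lin_right
    by (simp add: bil_commute[of "Q r" "Q p"] power2_eq_square algebra_simps)
qed

text \<open>The initial trace is zero and stays so; later this turns upper bounds on the diagonal
  into lower bounds.\<close>

lemma tr_rot:
  assumes pr: "p < m" "r < m" "p \<noteq> r" and cs: "c\<^sup>2 + s\<^sup>2 = 1"
  shows "tr (rot c s p r Q) = tr Q"
proof -
  let ?Q = "rot c s p r Q"
  have "tr ?Q - tr Q = (bil (?Q p) (?Q p) + bil (?Q r) (?Q r)) - (bil (Q p) (Q p) + bil (Q r) (Q r))"
    unfolding tr_def using pr by (intro sum_two_changed) (auto simp: rot_def)
  also have "\<dots> = (c\<^sup>2 + s\<^sup>2 - 1) * (bil (Q p) (Q p) + bil (Q r) (Q r))"
    unfolding bil_rot[OF pr(3)] by (simp add: algebra_simps)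
  finally show ?thesis using cs by simp
qed

text \<open>The hypothesis \<open>z\<close> says that the rotation annihilates the entry \<open>(p, r)\<close>.\<close>

lemma pot_rot:
  assumes pr: "p < m" "r < m" "p \<noteq> r" and cs: "c\<^sup>2 + s\<^sup>2 = 1"
    and z: "(c\<^sup>2 - s\<^sup>2) * bil (Q p) (Q r) = c * s * (bil (Q p) (Q p) - bil (Q r) (Q r))"
  shows "pot (rot c s p r Q) = pot Q + 2 * (bil (Q p) (Q r))\<^sup>2"
proof -
  let ?Q = "rot c s p r Q"
  define a b h where "a = bil (Q p) (Q p)" and "b = bil (Q r) (Q r)" and "h = bil (Q p) (Q r)"
  define a' b' where "a' = bil (?Q p) (?Q p)" and "b' = bil (?Q r) (?Q r)"
  have ab: "a' = c\<^sup>2 * a + 2 * c * s * h + s\<^sup>2 * b" "b' = c\<^sup>2 * b - 2 * c * s * h + s\<^sup>2 * a"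
    unfolding a'_def b'_def a_def b_def h_def by (rule bil_rot[OF pr(3)])+
  have z': "(c\<^sup>2 - s\<^sup>2) * h = c * s * (a - b)" using z by (simp add: a_def b_def h_def)
  have s1: "a' + b' = a + b"
  proof -
    have "a' + b' = (c\<^sup>2 + s\<^sup>2) * (a + b)" unfolding ab by (simp add: algebra_simps)
    then show ?thesis using cs by simp
  qed
  \<comment> \<open>The second square is that of the new entry at \<open>(p, r)\<close>, which
    vanishes by \<open>z'\<close>. For a symmetric 2 by 2 block, \<open>(a - b)^2 + 4 * h^2\<close>
    is invariant under rotations.\<close>
  have "(a' - b')\<^sup>2 + 4 * ((c\<^sup>2 - s\<^sup>2) * h - c * s * (a - b))\<^sup>2 = (c\<^sup>2 + s\<^sup>2)\<^sup>2 * ((a - b)\<^sup>2 + 4 * h\<^sup>2)"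
    unfolding ab by (simp add: power2_eq_square algebra_simps)
  then have s2: "(a' - b')\<^sup>2 = (a - b)\<^sup>2 + 4 * h\<^sup>2" using cs z' by simp
  have "2 * (a'\<^sup>2 + b'\<^sup>2) = (a' + b')\<^sup>2 + (a' - b')\<^sup>2" by (simp add: power2_eq_square algebra_simps)
  also have "\<dots> = 2 * (a\<^sup>2 + b\<^sup>2) + 4 * h\<^sup>2" unfolding s1 s2 by (simp add: power2_eq_square algebra_simps)
  finally have "a'\<^sup>2 + b'\<^sup>2 = a\<^sup>2 + b\<^sup>2 + 2 * h\<^sup>2" by simp
  moreover have "pot ?Q - pot Q = (a'\<^sup>2 + b'\<^sup>2) - (a\<^sup>2 + b\<^sup>2)"
    unfolding pot_def a_def b_def a'_def b'_def using pr by (intro sum_two_changed) (auto simp: rot_def)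
  ultimately show ?thesis by (simp add: h_def)
qed

text \<open>The tangent \<open>t\<close> solves \<open>h t\<^sup>2 + (a - b) t - h = 0\<close>.\<close>

lemma rot_angle:
  fixes a b h :: real
  assumes "h \<noteq> 0"
  defines "t \<equiv> (b - a + sqrt ((a - b) * (a - b) + 4 * (h * h))) / (2 * h)"
  defines "c \<equiv> 1 / sqrt (1 + t * t)"
  shows "c\<^sup>2 + (t * c)\<^sup>2 = 1" "(c\<^sup>2 - (t * c)\<^sup>2) * h = c * (t * c) * (a - b)"
proof -
  have pos: "0 < 1 + t * t" by (simp add: add_pos_nonneg)
  then have c2: "c\<^sup>2 * (1 + t * t) = 1" by (simp add: c_def power_divide)
  then show "c\<^sup>2 + (t * c)\<^sup>2 = 1" by (simp add: power2_eq_square algebra_simps)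
  define w where "w = sqrt ((a - b) * (a - b) + 4 * (h * h))"
  have w: "w * w = (a - b) * (a - b) + 4 * (h * h)" by (simp add: w_def)
  have "2 * h * t = b - a + w" using assms(1) by (simp add: t_def w_def)
  then have "(2 * h * t - (b - a)) * (2 * h * t - (b - a)) = (a - b) * (a - b) + 4 * (h * h)"
    using w by simp
  then have "4 * h * (h * t * t + (a - b) * t - h) = 0" by (simp add: algebra_simps)
  then have "h * t * t + (a - b) * t - h = 0" using assms(1) by simp
  then have "c\<^sup>2 * (h * t * t + (a - b) * t - h) = 0" by simp
  then show "(c\<^sup>2 - (t * c)\<^sup>2) * h = c * (t * c) * (a - b)"
    by (simp add: power2_eq_square algebra_simps)
qed

end

lemma sum_blocks: "(\<Sum>j<n * q. f j) = (\<Sum>i<n. \<Sum>a<q. f (i * q + a))" for f :: "nat \<Rightarrow> real"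
  unfolding sum.nat_group[symmetric]
  by (rule sum.cong[OF refl], subst sum.atLeastLessThan_shift_0) (simp add: lessThan_atLeast0)

section \<open>Frank--Wolfe steps and block rounding\<close>

context symmetric_form
begin

definition lq :: "(nat \<Rightarrow> real) \<Rightarrow> (nat \<Rightarrow> real) \<Rightarrow> real" where
  "lq b y = 2 * (\<Sum>j<m. b j * y j) + bil y y"

text \<open>Half the gradient of \<open>lq b\<close>; the 2 in front of the linear part of
  \<open>lq\<close> keeps both terms free of factors.\<close>

definition grad :: "(nat \<Rightarrow> real) \<Rightarrow> (nat \<Rightarrow> real) \<Rightarrow> nat \<Rightarrow> real" where
  "grad b y j = (\<Sum>l<m. M j l * y l) + b j"

lemma sum_grad: "(\<Sum>j<m. grad b y j * x j) = bil x y + (\<Sum>j<m. b j * x j)"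
  unfolding grad_def bil_def
  by (simp add: algebra_simps sum.distrib sum_distrib_left)

lemma lq_move:
  "lq b (\<lambda>j. y j + c * x j) = lq b y + 2 * c * (\<Sum>j<m. grad b y j * x j) + c\<^sup>2 * bil x x"
proof -
  have "bil (\<lambda>j. y j + c * x j) (\<lambda>j. y j + c * x j) = bil y y + 2 * c * bil x y + c\<^sup>2 * bil x x"
    using bil_lin_left[of 1 y c x] bil_lin_right[of _ 1 y c x]
    by (simp add: bil_commute[of y x] power2_eq_square algebra_simps)
  then show ?thesis
    unfolding lq_def sum_grad by (simp add: algebra_simps sum.distrib sum_distrib_left)
qed

text \<open>The objective need not be concave. \<open>E\<close> bounds the failure of concavity
  towards the comparison point \<open>z\<close>, and \<open>C\<close> the loss of a step through
  negative curvature; both enter through the exact second-order expansion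
  \<open>lq_move\<close>.\<close>

lemma frank_wolfe_step:
  assumes best: "(\<Sum>j<m. grad b y j * z j) \<le> (\<Sum>j<m. grad b y j * s j)" and c: "0 \<le> c"
    and E: "bil (\<lambda>j. z j - y j) (\<lambda>j. z j - y j) \<le> E"
    and C: "- C \<le> bil (\<lambda>j. s j - y j) (\<lambda>j. s j - y j)"
  shows "lq b z - lq b (\<lambda>j. (1 - c) * y j + c * s j) \<le> (1 - c) * (lq b z - lq b y) + c * E + c\<^sup>2 * C"
proof -
  let ?g = "\<lambda>x. \<Sum>j<m. grad b y j * x j"
  have eq: "(\<lambda>j. (1 - c) * y j + c * s j) = (\<lambda>j. y j + c * (s j - y j))" by (auto simp: algebra_simps)
  have diff: "?g (\<lambda>j. x j - y j) = ?g x - ?g y" for x by (simp add: algebra_simps sum_subtractf)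
  have "lq b z = lq b (\<lambda>j. y j + 1 * (z j - y j))" by simp
  also have "\<dots> = lq b y + 2 * (?g z - ?g y) + bil (\<lambda>j. z j - y j) (\<lambda>j. z j - y j)"
    unfolding lq_move diff by simp
  finally have "lq b z - lq b y - E \<le> 2 * (?g s - ?g y)" using best E by simp
  then have "c * (lq b z - lq b y - E) \<le> c * (2 * (?g s - ?g y))" using c by (rule mult_left_mono)
  moreover have "lq b (\<lambda>j. (1 - c) * y j + c * s j)
      = lq b y + c * (2 * (?g s - ?g y)) + c\<^sup>2 * bil (\<lambda>j. s j - y j) (\<lambda>j. s j - y j)"
    unfolding eq lq_move diff by simp
  moreover have "c\<^sup>2 * (- C) \<le> c\<^sup>2 * bil (\<lambda>j. s j - y j) (\<lambda>j. s j - y j)"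
    using C by (intro mult_left_mono) auto
  ultimately show ?thesis by (simp add: algebra_simps)
qed

end

text \<open>Each step averages the old gap with \<open>E\<close>, so the summand \<open>E\<close>
  reproduces itself and only the curvature term has to decay.\<close>

lemma frank_wolfe_rate:
  fixes h h' E C :: real
  assumes step: "h' \<le> (1 - 2 / (real t + 2)) * h + 2 / (real t + 2) * E + (2 / (real t + 2))\<^sup>2 * C"
    and IH: "0 < t \<Longrightarrow> h \<le> E + 4 * C / (real t + 2)" and C: "0 \<le> C"
  shows "h' \<le> E + 4 * C / (real (Suc t) + 2)"
proof (cases "t = 0")
  case True
  then show ?thesis using step C by (simp add: field_simps)
next
  case False
  define u where "u = real t + 2"
  have u: "u \<ge> 3" using False by (simp add: u_def)
  have "(1 - 2 / u) * h \<le> (1 - 2 / u) * (E + 4 * C / u)"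
    using IH False u by (intro mult_left_mono) (auto simp: u_def[symmetric])
  then have "h' \<le> (1 - 2 / u) * (E + 4 * C / u) + 2 / u * E + (2 / u)\<^sup>2 * C"
    using step by (simp add: u_def[symmetric])
  also have "\<dots> = E + 4 * C * ((u - 1) / u\<^sup>2)"
    using u by (simp add: field_simps power2_eq_square)
  \<comment> \<open>This is \<open>(u - 1) * (u + 1) \<le> u^2\<close>.\<close>
  also have "(u - 1) / u\<^sup>2 \<le> 1 / (u + 1)"
    using u by (simp add: field_simps power2_eq_square)
  then have "E + 4 * C * ((u - 1) / u\<^sup>2) \<le> E + 4 * C * (1 / (u + 1))"
    using C by (intro add_left_mono mult_left_mono) auto
  finally show ?thesis by (simp add: u_def add.commute add.left_commute)
qed

section \<open>Products of simplices and their vertices\<close>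

definition block_vertex :: "nat \<Rightarrow> (nat \<Rightarrow> nat) \<Rightarrow> nat \<Rightarrow> real" where
  "block_vertex q sel j = (if j mod q = sel (j div q) then 1 else 0)"

definition feas :: "nat \<Rightarrow> nat \<Rightarrow> (nat \<Rightarrow> real) \<Rightarrow> bool" where
  "feas n q y \<longleftrightarrow> (\<forall>j<n * q. 0 \<le> y j) \<and> (\<forall>i<n. (\<Sum>a<q. y (i * q + a)) = 1)"

definition maximizes :: "nat \<Rightarrow> nat \<Rightarrow> (nat \<Rightarrow> real) \<Rightarrow> nat \<Rightarrow> bool" where
  "maximizes q i g a \<longleftrightarrow> a < q \<and> (\<forall>a'<q. g (i * q + a') \<le> g (i * q + a))"

lemma block_index:
  assumes "(a :: nat) < q" shows "(i * q + a) div q = i" "(i * q + a) mod q = a"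
  using assms by auto

lemma block_index_less: "i < n \<Longrightarrow> a < q \<Longrightarrow> i * q + a < n * (q :: nat)"
proof -
  assume "i < n" "a < q"
  then have "i * q + a < Suc i * q" by simp
  also have "\<dots> \<le> n * q" using \<open>i < n\<close> by (intro mult_le_mono1) simp
  finally show ?thesis .
qed

lemma feas_le_1:
  assumes "feas n q y" "j < n * q" shows "y j \<le> 1"
proof -
  have q: "0 < q" using assms(2) by (cases q) auto
  have i: "j div q < n" using assms(2) by (simp add: less_mult_imp_div_less)
  have j: "j = (j div q) * q + j mod q" by simp
  have "y ((j div q) * q + j mod q) \<le> (\<Sum>a<q. y ((j div q) * q + a))"
    by (rule member_le_sum) (use assms i q block_index_less in \<open>auto simp: feas_def\<close>)
  then show ?thesis using assms(1) i j by (simp add: feas_def)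
qed

lemma sum_block_vertex:
  assumes "sel i < q"
  shows "(\<Sum>a<q. f (i * q + a) * block_vertex q sel (i * q + a)) = f (i * q + sel i)"
proof -
  have "(\<Sum>a<q. f (i * q + a) * block_vertex q sel (i * q + a)) = (\<Sum>a<q. if a = sel i then f (i * q + sel i) else 0)"
    by (intro sum.cong refl) (auto simp: block_vertex_def block_index)
  then show ?thesis using assms by simp
qed

lemma feas_block_vertex: "(\<And>i. i < n \<Longrightarrow> sel i < q) \<Longrightarrow> feas n q (block_vertex q sel)"
  using sum_block_vertex[of sel _ q "\<lambda>_. 1"] by (auto simp: feas_def block_vertex_def)

lemma block_le_max:
  assumes "maximizes q i g a" "feas n q z" "i < n"
  shows "(\<Sum>a'<q. g (i * q + a') * z (i * q + a')) \<le> g (i * q + a)"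
proof -
  have "(\<Sum>a'<q. g (i * q + a') * z (i * q + a')) \<le> (\<Sum>a'<q. g (i * q + a) * z (i * q + a'))"
    using assms block_index_less by (intro sum_mono mult_right_mono) (auto simp: maximizes_def feas_def)
  also have "\<dots> = g (i * q + a) * (\<Sum>a'<q. z (i * q + a'))" by (simp add: sum_distrib_left)
  also have "\<dots> = g (i * q + a)" using assms by (simp add: feas_def)
  finally show ?thesis .
qed

lemma vertex_maximizes_linear:
  assumes "\<And>i. i < n \<Longrightarrow> maximizes q i g (sel i)" "feas n q z"
  shows "(\<Sum>j<n * q. g j * z j) \<le> (\<Sum>j<n * q. g j * block_vertex q sel j)"
  unfolding sum_blocks
proof (rule sum_mono)
  fix i assume "i \<in> {..<n}"
  then have i: "i < n" by simp
  then have "sel i < q" using assms(1) by (simp add: maximizes_def)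
  then show "(\<Sum>a<q. g (i * q + a) * z (i * q + a)) \<le> (\<Sum>a<q. g (i * q + a) * block_vertex q sel (i * q + a))"
    using block_le_max[OF assms(1)[OF i] assms(2) i] by (simp add: sum_block_vertex)
qed

lemma feas_convex:
  assumes "feas n q y" "feas n q s" "0 \<le> c" "c \<le> 1"
  shows "feas n q (\<lambda>j. (1 - c) * y j + c * s j)"
  using assms by (auto simp: feas_def sum.distrib sum_distrib_left[symmetric])

text \<open>A step of length \<open>c\<close> from \<open>y\<close> towards vertex \<open>a\<close>
  in block \<open>i\<close> alone. Frank-Wolfe uses it with its step size, rounding with
  \<open>c = 1\<close>.\<close>

definition block_update :: "nat \<Rightarrow> nat \<Rightarrow> real \<Rightarrow> nat \<Rightarrow> (nat \<Rightarrow> real) \<Rightarrow> nat \<Rightarrow> real" where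
  "block_update q i c a y j = (if j div q = i then (1 - c) * y j + c * (if j mod q = a then 1 else 0) else y j)"

lemma feas_block_update:
  assumes y: "feas n q y" and a: "a < q" and c: "0 \<le> c" "c \<le> 1"
  shows "feas n q (block_update q i c a y)"
  unfolding feas_def
proof (intro conjI allI impI)
  fix j assume "j < n * q"
  then show "0 \<le> block_update q i c a y j" using y c by (auto simp: block_update_def feas_def)
next
  fix i' assume i': "i' < n"
  have "(\<Sum>a'<q. block_update q i c a y (i' * q + a'))
      = (\<Sum>a'<q. if i' = i then (1 - c) * y (i' * q + a') + c * (if a' = a then 1 else 0) else y (i' * q + a'))"
    by (intro sum.cong refl) (simp add: block_update_def block_index)
  also have "\<dots> = 1"
    using y i' a by (cases "i' = i") (simp_all add: feas_def sum.distrib flip: sum_distrib_left)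
  finally show "(\<Sum>a'<q. block_update q i c a y (i' * q + a')) = 1" .
qed

context symmetric_form
begin

text \<open>The vanishing diagonal blocks kill the second-order term of a change within one block.\<close>

lemma block_rounding:
  assumes m: "m = n * q" and blk: "\<And>i j. i < m \<Longrightarrow> j < m \<Longrightarrow> i div q = j div q \<Longrightarrow> M i j = 0"
    and y: "feas n q y" and i: "i < n" and a: "maximizes q i (grad (\<lambda>_. 0) y) a"
  shows "bil y y \<le> bil (block_update q i 1 a y) (block_update q i 1 a y)"
proof -
  let ?g = "grad (\<lambda>_. 0) y"
  define x where "x j = block_update q i 1 a y j - y j" for j
  have lq0: "lq (\<lambda>_. 0) z = bil z z" for z by (simp add: lq_def)
  have x0: "x j = 0" if "j div q \<noteq> i" for j using that by (simp add: x_def block_update_def)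
  have "bil x x = 0"
    unfolding bil_def
  proof (intro sum.neutral ballI)
    fix j l assume "j \<in> {..<m}" "l \<in> {..<m}"
    then show "x j * M j l * x l = 0" using blk[of j l] x0[of j] x0[of l] by force
  qed
  moreover have "0 \<le> (\<Sum>j<m. ?g j * x j)"
    unfolding sum_blocks[of _ n q, folded m]
  proof (rule sum_nonneg)
    fix i' assume i': "i' \<in> {..<n}"
    show "0 \<le> (\<Sum>a'<q. ?g (i' * q + a') * x (i' * q + a'))"
    proof (cases "i' = i")
      case False
      then show ?thesis by (simp add: x0 block_index)
    next
      case True
      \<comment> \<open>In block \<open>i\<close>, \<open>x\<close> is the chosen vertex minus
        \<open>y\<close>: the largest entry of the gradient is compared with an average of its
        entries.\<close>
      have "(\<Sum>a'<q. ?g (i * q + a') * x (i * q + a'))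
          = (\<Sum>a'<q. (if a' = a then ?g (i * q + a) else 0) - ?g (i * q + a') * y (i * q + a'))"
        by (intro sum.cong refl) (simp add: x_def block_update_def block_index algebra_simps)
      also have "\<dots> = ?g (i * q + a) - (\<Sum>a'<q. ?g (i * q + a') * y (i * q + a'))"
        using a by (simp add: sum_subtractf maximizes_def)
      finally show ?thesis using block_le_max[OF a y i] True by simp
    qed
  qed
  moreover have "block_update q i 1 a y = (\<lambda>j. y j + 1 * x j)" by (simp add: x_def)
  ultimately show ?thesis using lq_move[of "\<lambda>_. 0" y 1 x] by (simp add: lq0)
qed

end

section \<open>Splitting off the top of the spectrum\<close>

text \<open>\<open>norm\<close> and \<open>rank\<close> are the spectral facts about
  \<open>M\<close> used from here on, stated without eigenvalues: \<open>k\<close> bounds the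
  dimension of every space on which the form exceeds \<open>eps\<close> times the squared norm.
  \<open>d\<close> is the diagonal of the weight matrix.\<close>

locale block_form = symmetric_form m M for m :: nat and M :: "nat \<Rightarrow> nat \<Rightarrow> real" +
  fixes n q :: nat and d :: "nat \<Rightarrow> real" and eps :: real and k :: nat
  assumes m: "m = n * q" and n: "0 < n" and q: "0 < q" and eps: "0 < eps" "eps < 1"
    and norm: "\<bar>bil x x\<bar> \<le> (\<Sum>i<m. (x i)\<^sup>2)"
    and blk: "i < m \<Longrightarrow> j < m \<Longrightarrow> i div q = j div q \<Longrightarrow> M i j = 0"
    and d: "i < n \<Longrightarrow> 0 \<le> d i"
    and rank: "(\<And>c. \<exists>t<e. c t \<noteq> 0 \<Longrightarrow> eps * (\<Sum>i<m. (\<Sum>t<e. c t * W t i)\<^sup>2)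
        < bil (\<lambda>i. \<Sum>t<e. c t * W t i) (\<lambda>i. \<Sum>t<e. c t * W t i)) \<Longrightarrow> e \<le> k"
begin

lemma m_pos: "0 < m" using m n q by simp

definition xi :: "(nat \<Rightarrow> nat \<Rightarrow> real) \<Rightarrow> (nat \<Rightarrow> real) \<Rightarrow> nat \<Rightarrow> real" where
  "xi Q x j = (\<Sum>i<m. Q j i * x i)"

text \<open>For an orthonormal \<open>Q\<close> these are the Rayleigh quotients of the basis
  vectors, which are eigenvalues only up to the effect of the off-diagonal entries.\<close>

abbreviation eig :: "(nat \<Rightarrow> nat \<Rightarrow> real) \<Rightarrow> nat \<Rightarrow> real" where
  "eig Q j \<equiv> bil (Q j) (Q j)"

lemma orth_expand:
  assumes "orth Q" "i < m" shows "x i = (\<Sum>j<m. xi Q x j * Q j i)"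
proof -
  have "(\<Sum>j<m. xi Q x j * Q j i) = (\<Sum>j<m. \<Sum>l<m. x l * (Q j l * Q j i))"
    unfolding xi_def sum_distrib_right by (intro sum.cong refl) simp
  also have "\<dots> = (\<Sum>l<m. \<Sum>j<m. x l * (Q j l * Q j i))" by (rule sum.swap)
  also have "\<dots> = (\<Sum>l<m. if l = i then x i else 0)"
    using assms by (intro sum.cong refl) (auto simp: orth_def simp flip: sum_distrib_left)
  finally show ?thesis using assms(2) by simp
qed

lemma orth_parseval: "orth Q \<Longrightarrow> (\<Sum>i<m. (x i)\<^sup>2) = (\<Sum>j<m. (xi Q x j)\<^sup>2)"
proof -
  assume Q: "orth Q"
  have "x i * x i = x i * (\<Sum>j<m. xi Q x j * Q j i)" if "i < m" for i
    using orth_expand[OF Q that, of x] by (rule arg_cong)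
  then have "(\<Sum>i<m. (x i)\<^sup>2) = (\<Sum>i<m. \<Sum>j<m. x i * (xi Q x j * Q j i))"
    unfolding sum_distrib_left[symmetric] power2_eq_square by (intro sum.cong refl) auto
  also have "\<dots> = (\<Sum>j<m. \<Sum>i<m. x i * (xi Q x j * Q j i))" by (rule sum.swap)
  also have "\<dots> = (\<Sum>j<m. xi Q x j * (\<Sum>i<m. Q j i * x i))"
    unfolding sum_distrib_left by (intro sum.cong refl) simp
  finally show ?thesis by (simp add: xi_def power2_eq_square)
qed

definition good :: "(nat \<Rightarrow> nat \<Rightarrow> real) \<Rightarrow> bool" where
  "good Q \<longleftrightarrow> orth Q \<and> tr Q = 0 \<and> (\<forall>p<m. \<forall>r<p. \<bar>bil (Q p) (Q r)\<bar> \<le> eps / m)"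

text \<open>The off-diagonal entries contribute at most \<open>eps / m\<close> times the square of
  the sum of all \<open>\<bar>xi Q x j\<bar>\<close>, and Cauchy-Schwarz bounds that square by
  \<open>m\<close> times the squared norm.\<close>

lemma good_near_diagonal:
  assumes Q: "good Q"
  shows "\<bar>bil x x - (\<Sum>j<m. eig Q j * (xi Q x j)\<^sup>2)\<bar> \<le> eps * (\<Sum>i<m. (x i)\<^sup>2)"
proof -
  have orth: "orth Q" using Q by (simp add: good_def)
  let ?x = "xi Q x"
  define \<delta> where "\<delta> = eps / m"
  have \<delta>: "0 \<le> \<delta>" using eps by (simp add: \<delta>_def)
  have off: "\<bar>bil (Q j) (Q l)\<bar> \<le> eps / m" if "j < m" "l < m" "j \<noteq> l" for j l
  proof (cases "l < j")
    case True
    then show ?thesis using Q that by (auto simp: good_def)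
  next
    case False
    then have "\<bar>bil (Q l) (Q j)\<bar> \<le> eps / m" using Q that by (auto simp: good_def)
    then show ?thesis by (simp add: bil_commute[of "Q j" "Q l"])
  qed
  have "bil x x = bil (\<lambda>i. \<Sum>j<m. ?x j * Q j i) (\<lambda>i. \<Sum>l<m. ?x l * Q l i)"
    by (rule bil_cong) (rule orth_expand[OF orth], assumption)+
  also have "\<dots> = (\<Sum>j<m. \<Sum>l<m. ?x j * (?x l * bil (Q j) (Q l)))"
    unfolding bil_sum_left bil_sum_right by (simp add: sum_distrib_left)
  finally have e1: "bil x x = (\<Sum>j<m. \<Sum>l<m. ?x j * (?x l * bil (Q j) (Q l)))" .
  have e2: "(\<Sum>j<m. eig Q j * (?x j)\<^sup>2) = (\<Sum>j<m. \<Sum>l<m. if l = j then eig Q j * (?x j)\<^sup>2 else 0)"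
    by simp
  have e3: "bil x x - (\<Sum>j<m. eig Q j * (?x j)\<^sup>2)
      = (\<Sum>j<m. \<Sum>l<m. if l = j then 0 else ?x j * (?x l * bil (Q j) (Q l)))"
    unfolding e1 e2 sum_subtractf[symmetric]
    by (intro sum.cong refl) (simp add: power2_eq_square)
  have "\<bar>bil x x - (\<Sum>j<m. eig Q j * (?x j)\<^sup>2)\<bar> \<le> (\<Sum>j<m. \<bar>\<Sum>l<m. if l = j then 0 else ?x j * (?x l * bil (Q j) (Q l))\<bar>)"
    unfolding e3 by (rule sum_abs)
  also have "\<dots> \<le> (\<Sum>j<m. \<Sum>l<m. \<bar>if l = j then 0 else ?x j * (?x l * bil (Q j) (Q l))\<bar>)"
    by (intro sum_mono sum_abs)
  also have "\<dots> \<le> (\<Sum>j<m. \<Sum>l<m. \<delta> * (\<bar>?x j\<bar> * \<bar>?x l\<bar>))"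
  proof (intro sum_mono)
    fix j l assume jl: "j \<in> {..<m}" "l \<in> {..<m}"
    show "\<bar>if l = j then 0 else ?x j * (?x l * bil (Q j) (Q l))\<bar> \<le> \<delta> * (\<bar>?x j\<bar> * \<bar>?x l\<bar>)"
    proof (cases "l = j")
      case True
      then show ?thesis using \<delta> by simp
    next
      case False
      then have "\<bar>bil (Q j) (Q l)\<bar> * (\<bar>?x j\<bar> * \<bar>?x l\<bar>) \<le> \<delta> * (\<bar>?x j\<bar> * \<bar>?x l\<bar>)"
        using off[of j l] jl by (intro mult_right_mono) (auto simp: \<delta>_def)
      then show ?thesis using False by (simp add: abs_mult mult_ac)
    qed
  qed
  also have "\<dots> = \<delta> * (\<Sum>j<m. \<bar>?x j\<bar>)\<^sup>2"
    unfolding power2_eq_square sum_product by (simp only: sum_distrib_left)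
  also have "\<dots> \<le> \<delta> * ((\<Sum>j<m. \<bar>?x j\<bar>\<^sup>2) * card {..<m})"
    using \<delta> by (intro mult_left_mono sum_squared_le_sum_of_squares) auto
  also have "\<dots> = eps * (\<Sum>i<m. (x i)\<^sup>2)"
    using m_pos by (simp add: orth_parseval[OF orth, of x] \<delta>_def)
  finally show ?thesis .
qed

lemma eig_bound: "orth Q \<Longrightarrow> j < m \<Longrightarrow> \<bar>eig Q j\<bar> \<le> 1"
  using norm[of "Q j"] orth_rows[of Q j j] by (simp add: power2_eq_square)

lemma pot_le: "orth Q \<Longrightarrow> pot Q \<le> m"
proof -
  assume Q: "orth Q"
  have "pot Q \<le> (\<Sum>j<m. 1)"
    unfolding pot_def using eig_bound[OF Q] by (intro sum_mono) (auto simp: abs_square_le_1)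
  then show ?thesis by simp
qed

text \<open>The remaining entries sum to minus this one and to at most \<open>b * m\<close>. So a
  vanishing trace makes a one-sided bound two-sided, at the price of a factor
  \<open>m\<close>.\<close>

lemma tr_zero_eig_ge:
  assumes "tr Q = 0" "\<And>j. j < m \<Longrightarrow> eig Q j \<le> b" "j < m" "0 \<le> b"
  shows "- (b * m) \<le> eig Q j"
proof -
  have "0 = eig Q j + (\<Sum>l\<in>{..<m} - {j}. eig Q l)"
    using assms(1,3) by (simp add: tr_def sum.remove[of "{..<m}" j])
  also have "(\<Sum>l\<in>{..<m} - {j}. eig Q l) \<le> (\<Sum>l\<in>{..<m} - {j}. b)"
    using assms(2) by (intro sum_mono) auto
  also have "\<dots> \<le> (\<Sum>l<m. b)" using assms(4) by (intro sum_mono2) auto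
  also have "\<dots> = b * m" by simp
  finally show ?thesis by simp
qed

text \<open>A single basis vector is a witness with an exact Rayleigh quotient. Hence the bound is
  \<open>eps\<close>, not \<open>2 * eps\<close>, and it is available throughout the Jacobi phase,
  before \<open>Q\<close> is good.\<close>

lemma eig_le_if_rank_0: "orth Q \<Longrightarrow> k = 0 \<Longrightarrow> j < m \<Longrightarrow> eig Q j \<le> eps"
proof (rule ccontr)
  assume Q: "orth Q" and k: "k = 0" and j: "j < m" and "\<not> eig Q j \<le> eps"
  then have gt: "eps < eig Q j" by simp
  have "1 \<le> k"
  proof (rule rank[where W = "\<lambda>_. Q j"])
    fix c :: "nat \<Rightarrow> real" assume "\<exists>t<1. c t \<noteq> 0"
    then have c: "c 0 \<noteq> 0" by simp
    have "(\<Sum>i<m. (c 0 * Q j i)\<^sup>2) = (c 0)\<^sup>2 * (\<Sum>i<m. Q j i * Q j i)"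
      unfolding sum_distrib_left power_mult_distrib by (simp add: power2_eq_square)
    then have "(\<Sum>i<m. (c 0 * Q j i)\<^sup>2) = (c 0)\<^sup>2" using orth_rows[OF Q j j] by simp
    moreover have "bil (\<lambda>i. c 0 * Q j i) (\<lambda>i. c 0 * Q j i) = (c 0)\<^sup>2 * eig Q j"
      using bil_lin_left[of "c 0" "Q j" 0 "Q j"] bil_lin_right[of _ "c 0" "Q j" 0 "Q j"]
      by (simp add: power2_eq_square)
    ultimately show "eps * (\<Sum>i<m. (\<Sum>t<1. c t * Q j i)\<^sup>2)
        < bil (\<lambda>i. \<Sum>t<1. c t * Q j i) (\<lambda>i. \<Sum>t<1. c t * Q j i)"
      using gt c by (simp add: mult.commute[of eps])
  qed
  then show False using k by simp
qed

text \<open>This budget scales with the square of \<open>eps\<close>, like the guaranteed gain of a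
  rotation, so that their quotient is polynomial in \<open>m\<close> alone.\<close>

lemma pot_le_if_rank_0: "orth Q \<Longrightarrow> tr Q = 0 \<Longrightarrow> k = 0 \<Longrightarrow> pot Q \<le> m * (eps * m)\<^sup>2"
proof -
  assume Q: "orth Q" "tr Q = 0" "k = 0"
  have "(eig Q j)\<^sup>2 \<le> (eps * m)\<^sup>2" if j: "j < m" for j
  proof -
    have "- (eps * m) \<le> eig Q j"
      by (rule tr_zero_eig_ge[OF Q(2) eig_le_if_rank_0[OF Q(1,3)] j]) (use eps in auto)
    moreover have "eig Q j \<le> eps * m"
    proof -
      have "eig Q j \<le> eps * 1" using eig_le_if_rank_0[OF Q(1,3) j] by simp
      also have "\<dots> \<le> eps * m" using eps m_pos by (intro mult_left_mono) auto
      finally show ?thesis .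
    qed
    ultimately show ?thesis by (intro abs_le_square_iff[THEN iffD1]) auto
  qed
  then have "pot Q \<le> (\<Sum>j<m. (eps * m)\<^sup>2)" unfolding pot_def by (intro sum_mono) auto
  then show ?thesis by simp
qed

text \<open>On the span of these basis vectors the diagonal part exceeds \<open>2 * eps\<close> and
  the off-diagonal error is at most \<open>eps\<close>. The form therefore stays above
  \<open>eps\<close>, and \<open>rank\<close> limits their number.\<close>

definition tops :: "(nat \<Rightarrow> nat \<Rightarrow> real) \<Rightarrow> nat set" where
  "tops Q = {j. j < m \<and> 2 * eps < eig Q j}"

lemma finite_tops: "finite (tops Q)" by (simp add: tops_def)

lemma xi_combination:
  assumes "orth Q" "j < m" shows "xi Q (\<lambda>i. \<Sum>l<m. c l * Q l i) j = c j"
proof -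
  have "xi Q (\<lambda>i. \<Sum>l<m. c l * Q l i) j = (\<Sum>i<m. \<Sum>l<m. c l * (Q j i * Q l i))"
    unfolding xi_def sum_distrib_left by (intro sum.cong refl) (simp add: mult_ac)
  also have "\<dots> = (\<Sum>l<m. \<Sum>i<m. c l * (Q j i * Q l i))" by (rule sum.swap)
  also have "\<dots> = (\<Sum>l<m. if l = j then c j else 0)"
    using orth_rows[OF assms] by (intro sum.cong refl) (auto simp flip: sum_distrib_left)
  finally show ?thesis using assms(2) by simp
qed

lemma card_tops_le:
  assumes Q: "good Q" shows "card (tops Q) \<le> k"
proof -
  have orth: "orth Q" using Q by (simp add: good_def)
  obtain idx where idx: "bij_betw idx {..<card (tops Q)} (tops Q)"
    using ex_bij_betw_nat_finite[OF finite_tops] by (auto simp: lessThan_atLeast0)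
  let ?e = "card (tops Q)"
  show ?thesis
  proof (rule rank[where W = "\<lambda>t. Q (idx t)"])
    fix c :: "nat \<Rightarrow> real" assume c: "\<exists>t<?e. c t \<noteq> 0"
    \<comment> \<open>The coefficients are extended by zero to the whole basis, so that
      \<open>good_near_diagonal\<close> and Parseval's identity apply to the combination.\<close>
    define c' where "c' j = (if j \<in> tops Q then c (inv_into {..<?e} idx j) else 0)" for j
    define x where "x = (\<lambda>i. \<Sum>l<m. c' l * Q l i)"
    have inv: "c' (idx t) = c t" if "t < ?e" for t
      using idx that by (auto simp: c'_def bij_betw_def)
    have x: "(\<lambda>i. \<Sum>t<?e. c t * Q (idx t) i) = x"
    proof
      fix i
      have "(\<Sum>t<?e. c t * Q (idx t) i) = (\<Sum>t<?e. c' (idx t) * Q (idx t) i)"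
        by (intro sum.cong refl) (simp add: inv)
      also have "\<dots> = (\<Sum>j\<in>tops Q. c' j * Q j i)"
        by (rule sum.reindex_bij_betw[OF idx])
      also have "\<dots> = x i" unfolding x_def
        by (intro sum.mono_neutral_left) (auto simp: tops_def c'_def)
      finally show "(\<Sum>t<?e. c t * Q (idx t) i) = x i" .
    qed
    have xi: "xi Q x j = c' j" if "j < m" for j using xi_combination[OF orth that] by (simp add: x_def)
    have pars: "(\<Sum>i<m. (x i)\<^sup>2) = (\<Sum>j<m. (c' j)\<^sup>2)"
      using orth_parseval[OF orth, of x] by (simp add: xi)
    obtain t where t: "t < ?e" "c t \<noteq> 0" using c by blast
    have idxt: "idx t \<in> tops Q" using idx t by (auto simp: bij_betw_def)
    have "2 * eps * (\<Sum>j<m. (c' j)\<^sup>2) < (\<Sum>j<m. eig Q j * (c' j)\<^sup>2)"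
      unfolding sum_distrib_left
    proof (rule sum_strict_mono_ex1)
      show "\<forall>j\<in>{..<m}. 2 * eps * (c' j)\<^sup>2 \<le> eig Q j * (c' j)\<^sup>2"
        by (auto simp: c'_def tops_def intro!: mult_right_mono)
      show "\<exists>j\<in>{..<m}. 2 * eps * (c' j)\<^sup>2 < eig Q j * (c' j)\<^sup>2"
        using idxt t by (intro bexI[of _ "idx t"]) (auto simp: inv tops_def)
    qed simp
    then show "eps * (\<Sum>i<m. (\<Sum>t<?e. c t * Q (idx t) i)\<^sup>2)
        < bil (\<lambda>i. \<Sum>t<?e. c t * Q (idx t) i) (\<lambda>i. \<Sum>t<?e. c t * Q (idx t) i)"
      using good_near_diagonal[OF Q, of x] fun_cong[OF x] unfolding x by (simp add: xi pars)
  qed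
qed

lemma quadratic_diff:
  fixes A B :: "nat \<Rightarrow> nat \<Rightarrow> real"
  shows "(\<Sum>i<m. \<Sum>l<m. x i * (A i l - B i l) * x l)
    = (\<Sum>i<m. \<Sum>l<m. x i * A i l * x l) - (\<Sum>i<m. \<Sum>l<m. x i * B i l * x l)"
  by (simp add: algebra_simps sum_subtractf)

text \<open>The subtracted part is built from the basis found and its Rayleigh quotients instead of
  true eigenpairs, so the program can compute it exactly.\<close>

definition N :: "(nat \<Rightarrow> nat \<Rightarrow> real) \<Rightarrow> nat \<Rightarrow> nat \<Rightarrow> real" where
  "N Q i l = M i l - (\<Sum>j\<in>tops Q. Q j i * eig Q j * Q j l)"

lemma N_quadratic:
  "(\<Sum>i<m. \<Sum>l<m. x i * N Q i l * x l) = bil x x - (\<Sum>j\<in>tops Q. eig Q j * (xi Q x j)\<^sup>2)"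
proof -
  have "(\<Sum>i<m. \<Sum>l<m. x i * (\<Sum>j\<in>tops Q. Q j i * eig Q j * Q j l) * x l)
      = (\<Sum>j\<in>tops Q. eig Q j * (xi Q x j)\<^sup>2)"
    unfolding sum_factor_quadratic by (simp add: xi_def power2_eq_square mult.assoc)
  then show ?thesis unfolding N_def quadratic_diff bil_def[of x x] by simp
qed

text \<open>Outside \<open>tops\<close> the diagonal is at most \<open>2 * eps\<close>; the third
  \<open>eps\<close> is the off-diagonal error.\<close>

lemma N_upper:
  assumes Q: "good Q"
  shows "(\<Sum>i<m. \<Sum>l<m. x i * N Q i l * x l) \<le> 3 * eps * (\<Sum>i<m. (x i)\<^sup>2)"
proof -
  have orth: "orth Q" using Q by (simp add: good_def)
  have split: "(\<Sum>j<m. eig Q j * (xi Q x j)\<^sup>2) = (\<Sum>j\<in>{..<m} - tops Q. eig Q j * (xi Q x j)\<^sup>2)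
      + (\<Sum>j\<in>tops Q. eig Q j * (xi Q x j)\<^sup>2)"
    by (rule sum.subset_diff) (auto simp: tops_def)
  have "(\<Sum>j\<in>{..<m} - tops Q. eig Q j * (xi Q x j)\<^sup>2) \<le> (\<Sum>j\<in>{..<m} - tops Q. 2 * eps * (xi Q x j)\<^sup>2)"
    by (intro sum_mono mult_right_mono) (auto simp: tops_def)
  also have "\<dots> \<le> (\<Sum>j<m. 2 * eps * (xi Q x j)\<^sup>2)"
    using eps by (intro sum_mono2) auto
  also have "\<dots> = 2 * eps * (\<Sum>i<m. (x i)\<^sup>2)"
    by (simp only: orth_parseval[OF orth, of x] sum_distrib_left)
  finally show ?thesis
    unfolding N_quadratic using good_near_diagonal[OF Q, of x] split by (simp add: abs_le_iff)
qed

text \<open>One unit comes from the norm of \<open>M\<close>, the other from the subtracted part,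
  whose diagonal entries are at most 1.\<close>

lemma N_lower:
  assumes Q: "good Q"
  shows "- 2 * (\<Sum>i<m. (x i)\<^sup>2) \<le> (\<Sum>i<m. \<Sum>l<m. x i * N Q i l * x l)"
proof -
  have orth: "orth Q" using Q by (simp add: good_def)
  have "(\<Sum>j\<in>tops Q. eig Q j * (xi Q x j)\<^sup>2) \<le> (\<Sum>j\<in>tops Q. 1 * (xi Q x j)\<^sup>2)"
    using eig_bound[OF orth] by (intro sum_mono mult_right_mono) (auto simp: tops_def abs_le_iff)
  also have "\<dots> \<le> (\<Sum>j<m. 1 * (xi Q x j)\<^sup>2)" by (intro sum_mono2) (auto simp: tops_def)
  also have "\<dots> = (\<Sum>i<m. (x i)\<^sup>2)" by (simp add: orth_parseval[OF orth, of x])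
  finally show ?thesis unfolding N_quadratic using norm[of x] by (simp add: abs_le_iff)
qed

text \<open>All diagonal entries are at most \<open>2 * eps\<close>, hence at least
  \<open>- (2 * eps * m)\<close> by the trace; the off-diagonal error \<open>eps\<close> is at most
  \<open>eps * m\<close>.\<close>

lemma N_lower_tops_empty:
  assumes Q: "good Q" and e: "tops Q = {}"
  shows "- (3 * eps * m) * (\<Sum>i<m. (x i)\<^sup>2) \<le> (\<Sum>i<m. \<Sum>l<m. x i * N Q i l * x l)"
proof -
  have orth: "orth Q" "tr Q = 0" using Q by (auto simp: good_def)
  have "- (2 * eps * m) \<le> eig Q j" if "j < m" for j
  proof (rule tr_zero_eig_ge[OF orth(2) _ that])
    fix j assume "j < m"
    moreover have "j \<notin> tops Q" using e by simp
    ultimately show "eig Q j \<le> 2 * eps" by (simp add: tops_def)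
  qed (use eps in simp)
  then have "(\<Sum>j<m. - (2 * eps * m) * (xi Q x j)\<^sup>2) \<le> (\<Sum>j<m. eig Q j * (xi Q x j)\<^sup>2)"
    by (intro sum_mono mult_right_mono) auto
  then have "- (2 * eps * m) * (\<Sum>i<m. (x i)\<^sup>2) \<le> (\<Sum>j<m. eig Q j * (xi Q x j)\<^sup>2)"
    by (simp only: orth_parseval[OF orth(1), of x] sum_distrib_left)
  moreover have "eps * 1 * (\<Sum>i<m. (x i)\<^sup>2) \<le> eps * m * (\<Sum>i<m. (x i)\<^sup>2)"
    using eps m_pos by (intro mult_right_mono mult_left_mono sum_nonneg) auto
  ultimately show ?thesis
    unfolding N_quadratic e using good_near_diagonal[OF Q, of x] by (simp add: abs_le_iff algebra_simps)
qed

end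

section \<open>The relaxed problem for a guessed projection\<close>

lemma sum_lessThan_add: "(\<Sum>i<a + b. f i) = (\<Sum>i<a. f i) + (\<Sum>i<b. f (a + i))" for a b :: nat and f :: "nat \<Rightarrow> 'a::comm_monoid_add"
  by (induction b) (simp_all add: add.assoc)

context block_form
begin

text \<open>The diagonal of the square root of the weight matrix, constant on each block.\<close>

definition S :: "nat \<Rightarrow> real" where "S j = sqrt (d (j div q))"
definition tau :: real where "tau = (\<Sum>i<n. d i)"

lemma div_q_less: "j < m \<Longrightarrow> j div q < n"
  using m by (simp add: less_mult_imp_div_less)

lemma S_sq: "j < m \<Longrightarrow> (S j)\<^sup>2 = d (j div q)"
  using d div_q_less by (simp add: S_def)

lemma tau_nonneg: "0 \<le> tau"
  unfolding tau_def using d by (intro sum_nonneg) auto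

lemma sum_weighted_feas: "feas n q y \<Longrightarrow> (\<Sum>j<m. d (j div q) * y j) = tau"
proof -
  assume y: "feas n q y"
  have "(\<Sum>j<m. d (j div q) * y j) = (\<Sum>i<n. \<Sum>a<q. d i * y (i * q + a))"
    unfolding sum_blocks[of _ n q, folded m] by (intro sum.cong refl) (simp add: block_index)
  also have "\<dots> = (\<Sum>i<n. d i)"
    using y by (intro sum.cong refl) (simp add: feas_def flip: sum_distrib_left)
  finally show ?thesis by (simp add: tau_def)
qed

text \<open>Entries of a feasible point lie in the unit interval, so that squares are bounded by the
  entries themselves, whose sum over each block is 1.\<close>

lemma scaled_norm_le:
  assumes y: "feas n q y" shows "(\<Sum>j<m. (S j * y j)\<^sup>2) \<le> tau"
proof -
  have "(S j * y j)\<^sup>2 \<le> d (j div q) * y j" if j: "j < m" for j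
  proof -
    have y01: "0 \<le> y j" "y j \<le> 1" using y j feas_le_1[OF y] m by (auto simp: feas_def)
    have "(S j * y j)\<^sup>2 = d (j div q) * (y j * y j)" using j by (simp add: power_mult_distrib S_sq power2_eq_square[of "y j"])
    also have "\<dots> \<le> d (j div q) * (y j * 1)"
      using y01 d div_q_less[OF j] by (intro mult_left_mono) auto
    finally show ?thesis by simp
  qed
  then have "(\<Sum>j<m. (S j * y j)\<^sup>2) \<le> (\<Sum>j<m. d (j div q) * y j)" by (intro sum_mono) auto
  then show ?thesis using sum_weighted_feas[OF y] by simp
qed

lemma scaled_diff_le:
  assumes y: "feas n q y" and s: "feas n q s"
  shows "(\<Sum>j<m. (S j * (s j - y j))\<^sup>2) \<le> 2 * tau"
proof -
  have "(S j * (s j - y j))\<^sup>2 \<le> d (j div q) * s j + d (j div q) * y j" if j: "j < m" for j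
  proof -
    have 01: "0 \<le> y j" "y j \<le> 1" "0 \<le> s j" "s j \<le> 1"
      using y s j feas_le_1[OF y] feas_le_1[OF s] m by (auto simp: feas_def)
    \<comment> \<open>One factor is at most 1 and the other at most \<open>s j + y j\<close>. This
      gives \<open>2 * tau\<close>, where the triangle inequality for norms would give
      \<open>4 * tau\<close>.\<close>
    have "\<bar>s j - y j\<bar> * \<bar>s j - y j\<bar> \<le> (s j + y j) * 1"
      using 01 by (intro mult_mono) auto
    then have "d (j div q) * ((s j - y j) * (s j - y j)) \<le> d (j div q) * (s j + y j)"
      using d div_q_less[OF j] by (intro mult_left_mono) auto
    then show ?thesis unfolding power_mult_distrib S_sq[OF j] power2_eq_square[of "s j - y j"]
      by (simp add: distrib_left)
  qed
  then have "(\<Sum>j<m. (S j * (s j - y j))\<^sup>2) \<le> (\<Sum>j<m. d (j div q) * s j + d (j div q) * y j)"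
    by (intro sum_mono) auto
  then show ?thesis using sum_weighted_feas[OF y] sum_weighted_feas[OF s] by (simp add: sum.distrib)
qed

text \<open>The matrix of the objective in the variable \<open>y\<close>; \<open>B\<close> is what
  remains of it without the top directions.\<close>

definition H :: "nat \<Rightarrow> nat \<Rightarrow> real" where "H i l = S i * S l * M i l"
definition B :: "(nat \<Rightarrow> nat \<Rightarrow> real) \<Rightarrow> nat \<Rightarrow> nat \<Rightarrow> real" where "B Q i l = S i * S l * N Q i l"

sublocale H: symmetric_form m H
  by unfold_locales (simp add: H_def sym)

sublocale B: symmetric_form m "B Q" for Q
  by unfold_locales (simp add: B_def N_def sym mult_ac)

lemma H_bil: "H.bil y y = bil (\<lambda>j. S j * y j) (\<lambda>j. S j * y j)"
  unfolding H.bil_def bil_def by (intro sum.cong refl) (simp add: H_def)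

lemma B_bil: "B.bil Q y y = (\<Sum>i<m. \<Sum>l<m. (S i * y i) * N Q i l * (S l * y l))"
  unfolding B.bil_def by (intro sum.cong refl) (simp add: B_def)

text \<open>
  \<open>R\<close> Frank-Wolfe steps have to push the curvature of the relaxation, which is \<open>O(1)\<close> in general but
  \<open>O(\<epsilon> m)\<close> if there is no top eigenvector, below \<open>O(\<epsilon>)\<close>.
\<close>
definition scale_ok :: "nat \<Rightarrow> (nat \<Rightarrow> nat \<Rightarrow> real) \<Rightarrow> bool" where
  "scale_ok R Q \<longleftrightarrow> 1 \<le> R \<and> (if tops Q = {} then R = m else 1 \<le> eps * R)"

lemma B_diff_upper:
  assumes "good Q" "feas n q y" "feas n q z"
  shows "B.bil Q (\<lambda>j. z j - y j) (\<lambda>j. z j - y j) \<le> 6 * eps * tau"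
proof -
  have "B.bil Q (\<lambda>j. z j - y j) (\<lambda>j. z j - y j) \<le> 3 * eps * (\<Sum>j<m. (S j * (z j - y j))\<^sup>2)"
    unfolding B_bil by (rule N_upper[OF assms(1)])
  also have "\<dots> \<le> 3 * eps * (2 * tau)"
    using eps by (intro mult_left_mono scaled_diff_le assms) auto
  finally show ?thesis by simp
qed

text \<open>One constant fits both cases: with a top direction, \<open>eps * R \<ge> 1\<close>
  absorbs the lower bound -2; without one, \<open>R = m\<close> is the factor that the trace
  argument costs.\<close>

lemma B_diff_lower:
  assumes "good Q" "feas n q y" "feas n q s" "scale_ok R Q"
  shows "- (6 * eps * R * tau) \<le> B.bil Q (\<lambda>j. s j - y j) (\<lambda>j. s j - y j)"
proof -
  let ?x = "\<Sum>j<m. (S j * (s j - y j))\<^sup>2"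
  have x: "0 \<le> ?x" by (intro sum_nonneg) auto
  have "- (3 * eps * R) * ?x \<le> B.bil Q (\<lambda>j. s j - y j) (\<lambda>j. s j - y j)"
  proof (cases "tops Q = {}")
    case True
    then show ?thesis unfolding B_bil
      using N_lower_tops_empty[OF assms(1) True] assms(4) by (simp add: scale_ok_def)
  next
    case False
    then have "2 * ?x \<le> (3 * eps * R) * ?x"
      using assms(4) x by (intro mult_right_mono) (auto simp: scale_ok_def)
    then show ?thesis unfolding B_bil
      using N_lower[OF assms(1), of "\<lambda>j. S j * (s j - y j)"] by simp
  qed
  moreover have "3 * eps * R * ?x \<le> 3 * eps * R * (2 * tau)"
    using eps by (intro mult_left_mono scaled_diff_le assms) auto
  ultimately show ?thesis by simp
qed

text \<open>No bound at \<open>t = 0\<close>: the first step has size 1 and forgets the starting point.\<close>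

definition fw_inv :: "(nat \<Rightarrow> nat \<Rightarrow> real) \<Rightarrow> (nat \<Rightarrow> real) \<Rightarrow> (nat \<Rightarrow> real) \<Rightarrow> nat \<Rightarrow> nat \<Rightarrow> (nat \<Rightarrow> real) \<Rightarrow> bool" where
  "fw_inv Q b z R t y \<longleftrightarrow> (0 < t \<longrightarrow> B.lq Q b z - B.lq Q b y \<le> 6 * eps * tau + 4 * (6 * eps * R * tau) / (real t + 2))"

lemma fw_inv_step:
  assumes Q: "good Q" and z: "feas n q z" and R: "scale_ok R Q" and y: "feas n q y"
    and inv: "fw_inv Q b z R t y"
    and sel: "\<And>i. i < n \<Longrightarrow> maximizes q i (B.grad Q b y) (sel i)"
  shows "fw_inv Q b z R (Suc t) (\<lambda>j. (1 - 2 / (real t + 2)) * y j + 2 / (real t + 2) * block_vertex q sel j)"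
proof -
  let ?s = "block_vertex q sel"
  have s: "feas n q ?s" using sel by (intro feas_block_vertex) (auto simp: maximizes_def)
  have best: "(\<Sum>j<m. B.grad Q b y j * z j) \<le> (\<Sum>j<m. B.grad Q b y j * ?s j)"
    using vertex_maximizes_linear[of n q "B.grad Q b y" sel z, folded m] sel z by blast
  have C: "0 \<le> 6 * eps * R * tau" using eps tau_nonneg by simp
  show ?thesis unfolding fw_inv_def
    using frank_wolfe_rate[OF B.frank_wolfe_step[OF best _ B_diff_upper[OF Q y z] B_diff_lower[OF Q y s R],
          of "2 / (real t + 2)"] _ C] inv
    by (simp add: fw_inv_def)
qed

text \<open>\<open>R\<close> steps cancel the factor \<open>R\<close> of the curvature. Of the 30, 6
  is the failure of concavity, and 24 is the rate's factor 4 times the curvature constant 6.\<close>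

lemma fw_inv_final:
  assumes "fw_inv Q b z R R y" "scale_ok R Q"
  shows "B.lq Q b z - B.lq Q b y \<le> 30 * (eps * tau)"
proof -
  have R: "1 \<le> R" using assms(2) by (simp add: scale_ok_def)
  have "4 * (6 * eps * R * tau) / (real R + 2) = 24 * (eps * tau) * (R / (real R + 2))" by simp
  also have "\<dots> \<le> 24 * (eps * tau) * 1"
    using eps tau_nonneg by (intro mult_left_mono) auto
  finally show ?thesis using assms(1) R by (simp add: fw_inv_def)
qed

text \<open>Half the slope of the tangent at \<open>\<zeta>\<close> to the form of the top
  directions, transported to the variable \<open>y\<close>.\<close>

definition lin :: "(nat \<Rightarrow> nat \<Rightarrow> real) \<Rightarrow> (nat \<Rightarrow> nat) \<Rightarrow> nat \<Rightarrow> (nat \<Rightarrow> real) \<Rightarrow> nat \<Rightarrow> real" where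
  "lin Q idx kk \<zeta> j = S j * (\<Sum>t<kk. eig Q (idx t) * \<zeta> t * Q (idx t) j)"

text \<open>Completing the square,
  \<open>x^2 = 2 * \<zeta> * x - \<zeta>^2 + (x - \<zeta>)^2\<close>, in each top
  coordinate.\<close>

lemma relaxation_gap:
  assumes idx: "bij_betw idx {..<kk} (tops Q)"
  shows "H.bil y y = B.lq Q (lin Q idx kk \<zeta>) y - (\<Sum>t<kk. eig Q (idx t) * (\<zeta> t)\<^sup>2)
    + (\<Sum>t<kk. eig Q (idx t) * (xi Q (\<lambda>j. S j * y j) (idx t) - \<zeta> t)\<^sup>2)"
proof -
  let ?x = "\<lambda>t. xi Q (\<lambda>j. S j * y j) (idx t)"
  have "(\<Sum>j\<in>tops Q. eig Q j * (xi Q (\<lambda>j. S j * y j) j)\<^sup>2) = (\<Sum>t<kk. eig Q (idx t) * (?x t)\<^sup>2)"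
    by (rule sum.reindex_bij_betw[OF idx, symmetric])
  then have 1: "B.bil Q y y = H.bil y y - (\<Sum>t<kk. eig Q (idx t) * (?x t)\<^sup>2)"
    unfolding B_bil N_quadratic H_bil by simp
  have "(\<Sum>j<m. lin Q idx kk \<zeta> j * y j) = (\<Sum>j<m. \<Sum>t<kk. eig Q (idx t) * \<zeta> t * (Q (idx t) j * (S j * y j)))"
    unfolding lin_def sum_distrib_left sum_distrib_right by (intro sum.cong refl) simp
  also have "\<dots> = (\<Sum>t<kk. \<Sum>j<m. eig Q (idx t) * \<zeta> t * (Q (idx t) j * (S j * y j)))" by (rule sum.swap)
  also have "\<dots> = (\<Sum>t<kk. eig Q (idx t) * \<zeta> t * ?x t)"
    unfolding xi_def sum_distrib_left ..
  finally have 2: "(\<Sum>j<m. lin Q idx kk \<zeta> j * y j) = (\<Sum>t<kk. eig Q (idx t) * \<zeta> t * ?x t)" .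
  have 3: "(\<Sum>t<kk. eig Q (idx t) * (?x t - \<zeta> t)\<^sup>2) = (\<Sum>t<kk. eig Q (idx t) * (?x t)\<^sup>2)
      - 2 * (\<Sum>t<kk. eig Q (idx t) * \<zeta> t * ?x t) + (\<Sum>t<kk. eig Q (idx t) * (\<zeta> t)\<^sup>2)"
    unfolding sum_distrib_left sum_subtractf[symmetric] sum.distrib[symmetric]
    by (intro sum.cong refl) (simp add: power2_eq_square algebra_simps)
  show ?thesis unfolding B.lq_def 2 1 3 by simp
qed

text \<open>The squares dropped by linearizing at \<open>\<zeta>\<close> are nonnegative for \<open>y\<close> and small for \<open>z\<close>.\<close>

lemma relaxation_near_opt:
  assumes idx: "bij_betw idx {..<kk} (tops Q)"
    and near: "(\<Sum>t<kk. eig Q (idx t) * (xi Q (\<lambda>j. S j * z j) (idx t) - \<zeta> t)\<^sup>2) \<le> eps * tau"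
    and gap: "B.lq Q (lin Q idx kk \<zeta>) z - B.lq Q (lin Q idx kk \<zeta>) y \<le> 30 * (eps * tau)"
  shows "H.bil z z - 31 * (eps * tau) \<le> H.bil y y"
proof -
  have "0 \<le> eig Q (idx t)" if "t < kk" for t
  proof -
    have "idx t \<in> tops Q" using idx that by (auto simp: bij_betw_def)
    then show ?thesis using eps by (simp add: tops_def)
  qed
  then have "0 \<le> (\<Sum>t<kk. eig Q (idx t) * (xi Q (\<lambda>j. S j * y j) (idx t) - \<zeta> t)\<^sup>2)"
    by (intro sum_nonneg) auto
  then show ?thesis
    using relaxation_gap[OF idx, of z \<zeta>] relaxation_gap[OF idx, of y \<zeta>] near gap by linarith
qed

lemma scaled_floor:
  fixes x h :: real
  assumes "0 < h"
  shows "h * real (nat \<lfloor>\<bar>x\<bar> / h\<rfloor>) \<le> \<bar>x\<bar>" "\<bar>x\<bar> \<le> h * real (nat \<lfloor>\<bar>x\<bar> / h\<rfloor>) + h"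
proof -
  define w where "w = real (nat \<lfloor>\<bar>x\<bar> / h\<rfloor>)"
  have "w = of_int \<lfloor>\<bar>x\<bar> / h\<rfloor>" using assms by (simp add: w_def)
  then have "w \<le> \<bar>x\<bar> / h" "\<bar>x\<bar> / h < w + 1" by linarith+
  then have "w * h \<le> \<bar>x\<bar>" "\<bar>x\<bar> < (w + 1) * h"
    unfolding pos_le_divide_eq[OF assms] pos_divide_less_eq[OF assms] .
  then show "h * real (nat \<lfloor>\<bar>x\<bar> / h\<rfloor>) \<le> \<bar>x\<bar>" "\<bar>x\<bar> \<le> h * real (nat \<lfloor>\<bar>x\<bar> / h\<rfloor>) + h"
    unfolding w_def[symmetric] by (simp_all add: algebra_simps)
qed

text \<open>
  Coordinate \<open>t\<close> of the guess is \<open>\<eta> (v\<^sub>t - v\<^sub>k\<^sub>k\<^sub>+\<^sub>t)\<close> with natural numbers \<open>v\<close>. Bounding the sum of \<open>v\<close> instead of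
  its entries keeps the net free of a factor \<open>kk\<^sup>k\<^sup>k\<close>.
\<close>
lemma net_point_exists:
  assumes Q: "good Q" and idx: "bij_betw idx {..<kk} (tops Q)" and R: "scale_ok R Q" and z: "feas n q z"
  defines "\<eta> \<equiv> sqrt (eps * tau / kk)"
  shows "\<exists>v :: nat \<Rightarrow> nat. (\<forall>i\<ge>2 * kk. v i = 0) \<and> (\<Sum>i<2 * kk. v i) \<le> kk * R \<and>
    (\<Sum>t<kk. eig Q (idx t) * (xi Q (\<lambda>j. S j * z j) (idx t) - \<eta> * (real (v t) - real (v (kk + t))))\<^sup>2) \<le> eps * tau"
proof (cases "kk = 0")
  case True
  then show ?thesis using eps tau_nonneg by (intro exI[of _ "\<lambda>_. 0"]) simp
next
  case False
  have orth: "orth Q" using Q by (simp add: good_def)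
  let ?x = "\<lambda>t. xi Q (\<lambda>j. S j * z j) (idx t)"
  \<comment> \<open>\<open>w t\<close> counts whole mesh widths in the absolute value. The two
    halves of \<open>v\<close> hold the positive and the negative parts, because the integer memory
    stores naturals. For mesh width 0 the quotient, hence \<open>w\<close>, is 0.\<close>
  define w where "w t = nat \<lfloor>\<bar>?x t\<bar> / \<eta>\<rfloor>" for t
  define v where "v i = (if i < kk then (if 0 \<le> ?x i then w i else 0)
      else if i < 2 * kk then (if 0 \<le> ?x (i - kk) then 0 else w (i - kk)) else 0)" for i
  have \<eta>0: "0 \<le> \<eta>" unfolding \<eta>_def using eps tau_nonneg by simp
  have \<eta>2: "\<eta>\<^sup>2 = eps * tau / kk" unfolding \<eta>_def using eps tau_nonneg by simp
  have tops: "idx t \<in> tops Q" if "t < kk" for t using idx that by (auto simp: bij_betw_def)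
  have ne: "tops Q \<noteq> {}" using tops[of 0] False by auto
  have "(\<Sum>t<kk. (?x t)\<^sup>2) = (\<Sum>j\<in>tops Q. (xi Q (\<lambda>j. S j * z j) j)\<^sup>2)"
    by (rule sum.reindex_bij_betw[OF idx])
  also have "\<dots> \<le> (\<Sum>j<m. (xi Q (\<lambda>j. S j * z j) j)\<^sup>2)"
    by (intro sum_mono2) (auto simp: tops_def)
  also have "\<dots> = (\<Sum>j<m. (S j * z j)\<^sup>2)" by (rule orth_parseval[OF orth, symmetric])
  also have "\<dots> \<le> tau" by (rule scaled_norm_le[OF z])
  finally have xtau: "(\<Sum>t<kk. (?x t)\<^sup>2) \<le> tau" .
  have close: "\<eta> * w t \<le> \<bar>?x t\<bar>" "\<bar>?x t\<bar> \<le> \<eta> * w t + \<eta>" if t: "t < kk" for t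
  proof -
    consider "0 < \<eta>" | "\<eta> = 0" using \<eta>0 by linarith
    then have "\<eta> * w t \<le> \<bar>?x t\<bar> \<and> \<bar>?x t\<bar> \<le> \<eta> * w t + \<eta>"
    proof cases
      case 1
      then show ?thesis unfolding w_def using scaled_floor[OF 1] by blast
    next
      case 2
      \<comment> \<open>The mesh width is 0 only if the trace is 0, and then all coordinates
        vanish.\<close>
      then have "tau = 0" using \<eta>2 eps False by simp
      then have "(\<Sum>t<kk. (?x t)\<^sup>2) = 0" using xtau by (intro antisym sum_nonneg) auto
      then have "?x t = 0" using t by (subst (asm) sum_nonneg_eq_0_iff) auto
      then show ?thesis using 2 by simp
    qed
    then show "\<eta> * w t \<le> \<bar>?x t\<bar>" "\<bar>?x t\<bar> \<le> \<eta> * w t + \<eta>" by auto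
  qed
  have err: "(?x t - \<eta> * (real (v t) - real (v (kk + t))))\<^sup>2 \<le> \<eta>\<^sup>2" if t: "t < kk" for t
  proof -
    have "\<bar>?x t - \<eta> * (real (v t) - real (v (kk + t)))\<bar> = \<bar>\<bar>?x t\<bar> - \<eta> * w t\<bar>"
      using t by (auto simp: v_def)
    also have "\<dots> \<le> \<bar>\<eta>\<bar>" using close[OF t] \<eta>0 by simp
    finally show ?thesis by (simp only: abs_le_square_iff)
  qed
  \<comment> \<open>These are \<open>kk\<close> errors of at most one squared mesh width each, with
    weights at most 1.\<close>
  have "(\<Sum>t<kk. eig Q (idx t) * (?x t - \<eta> * (real (v t) - real (v (kk + t))))\<^sup>2) \<le> (\<Sum>t<kk. 1 * \<eta>\<^sup>2)"
  proof (rule sum_mono)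
    fix t assume t: "t \<in> {..<kk}"
    have "idx t < m" "0 \<le> eig Q (idx t)" using tops[of t] t eps by (auto simp: tops_def)
    then show "eig Q (idx t) * (?x t - \<eta> * (real (v t) - real (v (kk + t))))\<^sup>2 \<le> 1 * \<eta>\<^sup>2"
      using eig_bound[OF orth, of "idx t"] err[of t] t by (intro mult_mono) auto
  qed
  also have "\<dots> = eps * tau" using False by (simp add: \<eta>2)
  finally have c3: "(\<Sum>t<kk. eig Q (idx t) * (?x t - \<eta> * (real (v t) - real (v (kk + t))))\<^sup>2) \<le> eps * tau" .
  have vw: "(\<Sum>i<2 * kk. v i) = (\<Sum>t<kk. w t)"
  proof -
    have "(\<Sum>i<kk + kk. v i) = (\<Sum>t<kk. v t) + (\<Sum>t<kk. v (kk + t))" by (rule sum_lessThan_add)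
    also have "\<dots> = (\<Sum>t<kk. v t + v (kk + t))" by (rule sum.distrib[symmetric])
    also have "\<dots> = (\<Sum>t<kk. w t)" by (intro sum.cong refl) (auto simp: v_def)
    finally show ?thesis by (simp add: mult_2)
  qed
  have "real (\<Sum>t<kk. w t) \<le> real (kk * R)"
  proof (cases "\<eta> = 0")
    case True
    then show ?thesis by (simp add: w_def)
  next
    case pos: False
    have "\<eta> * real (\<Sum>t<kk. w t) = (\<Sum>t<kk. \<eta> * w t)" by (simp add: sum_distrib_left)
    also have "\<dots> \<le> (\<Sum>t<kk. \<bar>?x t\<bar>)" using close by (intro sum_mono) auto
    \<comment> \<open>After squaring, Cauchy-Schwarz leaves \<open>tau * kk\<close> on the left, and
      the right side is \<open>tau * kk * (eps * R * R)\<close>. As there is a top direction,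
      \<open>scale_ok\<close> supplies \<open>eps * R \<ge> 1\<close>.\<close>
    also have "\<dots> \<le> \<eta> * (kk * R)"
    proof (rule power2_le_imp_le)
      have "(\<Sum>t<kk. \<bar>?x t\<bar>)\<^sup>2 \<le> (\<Sum>t<kk. \<bar>?x t\<bar>\<^sup>2) * card {..<kk}"
        by (rule sum_squared_le_sum_of_squares)
      also have "\<dots> \<le> tau * kk" using xtau by (simp add: mult_right_mono)
      also have "\<dots> \<le> tau * kk * (eps * R * R)"
      proof -
        have "1 * 1 \<le> (eps * R) * real R"
          using R ne by (intro mult_mono) (auto simp: scale_ok_def)
        then have "tau * kk * 1 \<le> tau * kk * (eps * R * R)" using tau_nonneg by (intro mult_left_mono) auto
        then show ?thesis by simp
      qed
      also have "\<dots> = (\<eta> * (kk * R))\<^sup>2"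
        unfolding power_mult_distrib \<eta>2 using False by (simp add: power2_eq_square field_simps)
      finally show "(\<Sum>t<kk. \<bar>?x t\<bar>)\<^sup>2 \<le> (\<eta> * (kk * R))\<^sup>2" .
    qed (use \<eta>0 in simp)
    finally have "\<eta> * real (\<Sum>t<kk. w t) \<le> \<eta> * (kk * R)" .
    then show ?thesis using pos \<eta>0 by simp
  qed
  then have "(\<Sum>i<2 * kk. v i) \<le> kk * R" unfolding vw of_nat_le_iff .
  then show ?thesis using c3 by (intro exI[of _ v]) (auto simp: v_def)
qed

end

section \<open>Enumerating the net in colexicographic order\<close>

definition colex :: "nat \<Rightarrow> (nat \<Rightarrow> nat) \<Rightarrow> (nat \<Rightarrow> nat) \<Rightarrow> bool" where
  "colex K v w \<longleftrightarrow> (\<exists>p<K. v p < w p \<and> (\<forall>i. p < i \<longrightarrow> i < K \<longrightarrow> v i = w i))"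

definition simplex_points :: "nat \<Rightarrow> nat \<Rightarrow> (nat \<Rightarrow> nat) set" where
  "simplex_points K b = {v. (\<forall>i\<ge>K. v i = 0) \<and> (\<Sum>i<K. v i) \<le> b}"

lemma simplex_points_Suc:
  "simplex_points (Suc K) b = (\<Union>u\<le>b. (\<lambda>v. v(K := u)) ` simplex_points K (b - u))"
proof (intro equalityI subsetI)
  fix v assume v: "v \<in> simplex_points (Suc K) b"
  have "v = (v(K := 0))(K := v K)" by simp
  moreover have "v(K := 0) \<in> simplex_points K (b - v K)"
    using v by (auto simp: simplex_points_def le_less_Suc_eq Suc_le_eq)
  moreover have "v K \<le> b" using v by (auto simp: simplex_points_def)
  ultimately show "v \<in> (\<Union>u\<le>b. (\<lambda>v. v(K := u)) ` simplex_points K (b - u))" by blast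
qed (auto simp: simplex_points_def)

lemma simplex_points_0: "simplex_points 0 b = {\<lambda>_. 0}"
  by (auto simp: simplex_points_def)

lemma finite_simplex_points: "finite (simplex_points K b)"
  by (induction K arbitrary: b) (simp_all add: simplex_points_0 simplex_points_Suc)

text \<open>Weighting a point of coordinate sum \<open>c\<close> by \<open>x\<^sup>c \<ge> x\<^sup>b\<close> turns the count into a product of geometric series.\<close>

lemma card_simplex_points:
  fixes x :: real
  assumes x: "0 < x" "x < 1"
  shows "real (card (simplex_points K b)) \<le> (1 / x) ^ b * (1 / (1 - x)) ^ K"
proof (induction K arbitrary: b)
  case 0
  then show ?case using x by (simp add: simplex_points_0)
next
  case (Suc K)
  let ?c = "(1 / (1 - x)) ^ K"
  have c: "0 \<le> ?c" using x by simp
  have "card (simplex_points (Suc K) b) \<le> (\<Sum>u\<le>b. card ((\<lambda>v. v(K := u)) ` simplex_points K (b - u)))"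
    unfolding simplex_points_Suc by (rule card_UN_le) simp
  also have "\<dots> \<le> (\<Sum>u\<le>b. card (simplex_points K (b - u)))"
    by (intro sum_mono card_image_le finite_simplex_points)
  finally have "real (card (simplex_points (Suc K) b)) \<le> (\<Sum>u\<le>b. real (card (simplex_points K (b - u))))"
    by (metis of_nat_le_iff of_nat_sum)
  also have "\<dots> \<le> (\<Sum>u\<le>b. (1 / x) ^ (b - u) * ?c)"
    by (intro sum_mono Suc.IH)
  also have "\<dots> = (\<Sum>u\<le>b. ((1 / x) ^ b * ?c) * x ^ u)"
    using x by (intro sum.cong refl) (auto simp: power_diff power_divide)
  also have "\<dots> = ((1 / x) ^ b * ?c) * (\<Sum>u\<le>b. x ^ u)" by (simp only: sum_distrib_left)
  also have "\<dots> \<le> ((1 / x) ^ b * ?c) * (1 / (1 - x))"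
  proof (rule mult_left_mono)
    have "(\<Sum>u\<le>b. x ^ u) = (1 - x ^ Suc b) / (1 - x)"
      using x by (simp add: sum_gp0 )
    also have "\<dots> \<le> 1 / (1 - x)" using x by (intro divide_right_mono) auto
    finally show "(\<Sum>u\<le>b. x ^ u) \<le> 1 / (1 - x)" .
    show "0 \<le> (1 / x) ^ b * ?c" using x c by simp
  qed
  finally show ?case by (simp add: mult_ac)
qed

definition odo_next :: "nat \<Rightarrow> (nat \<Rightarrow> nat) \<Rightarrow> nat \<Rightarrow> nat" where
  "odo_next j v i = (if i < j then 0 else if i = j then Suc (v j) else v i)"

lemma sum_split_at: "j \<le> K \<Longrightarrow> (\<Sum>i<K. v i) = (\<Sum>i<j. v i) + (\<Sum>i=j..<K. v i)" for v :: "nat \<Rightarrow> nat"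
  by (simp add: lessThan_atLeast0 sum.atLeastLessThan_concat)

text \<open>The index \<open>j\<close> is the first one at which the budget is not used up by the coordinates above.\<close>
lemma odo_next:
  assumes v: "v \<in> simplex_points K b" and j: "j < K" "(\<Sum>i=j..<K. v i) < b"
    and full: "\<And>i. i < j \<Longrightarrow> (\<Sum>l=i..<K. v l) = b"
  shows "odo_next j v \<in> simplex_points K b" "colex K v (odo_next j v)"
    "\<And>w. w \<in> simplex_points K b \<Longrightarrow> colex K w (odo_next j v) \<Longrightarrow> w = v \<or> colex K w v"
proof -
  have "(\<Sum>i<K. odo_next j v i) = (\<Sum>i<j. odo_next j v i) + (\<Sum>i=j..<K. odo_next j v i)"
    using j by (intro sum_split_at) simp
  also have "(\<Sum>i<j. odo_next j v i) = 0" by (simp add: odo_next_def)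
  also have "(\<Sum>i=j..<K. odo_next j v i) = Suc (\<Sum>i=j..<K. v i)"
    using j(1) by (simp add: sum.atLeast_Suc_lessThan odo_next_def)
  finally show "odo_next j v \<in> simplex_points K b"
    using v j by (auto simp: simplex_points_def odo_next_def)
  show "colex K v (odo_next j v)"
    using j by (auto simp: colex_def odo_next_def)
  fix w assume w: "w \<in> simplex_points K b" and "colex K w (odo_next j v)"
  then obtain p where p: "p < K" "w p < odo_next j v p" "\<And>i. p < i \<Longrightarrow> i < K \<Longrightarrow> w i = odo_next j v i"
    by (auto simp: colex_def)
  have "j \<le> p" using p(2) by (rule contrapos_pp) (simp add: odo_next_def)
  show "w = v \<or> colex K w v"
  proof (cases "w p < v p")
    case True
    then have "colex K w v"
      unfolding colex_def using p \<open>j \<le> p\<close> by (intro exI[of _ p]) (auto simp: odo_next_def)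
    then show ?thesis ..
  next
    case False
    \<comment> \<open>Here \<open>w\<close> agrees with \<open>v\<close> from \<open>j\<close> on.
      It remains to see that the coordinates of \<open>v\<close> below \<open>j\<close> are the
      greatest possible ones.\<close>
    then have pj: "p = j" and wj: "w j = v j" using p(2) \<open>j \<le> p\<close> by (auto simp: odo_next_def split: if_splits)
    have above: "w i = v i" if "j \<le> i" for i
    proof (cases "i < K")
      case True
      then show ?thesis using that wj p(3)[of i] pj by (cases "i = j") (auto simp: odo_next_def)
    next
      case False
      then show ?thesis using v w by (simp add: simplex_points_def)
    qed
    show ?thesis
    proof (cases j)
      case 0
      then show ?thesis using above by auto
    next
      case (Suc i)
      have sv: "(\<Sum>l=i..<K. v l) = v i + (\<Sum>l=j..<K. v l)" "(\<Sum>l=i..<K. w l) = w i + (\<Sum>l=j..<K. v l)"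
        using above j(1) Suc by (simp_all add: sum.atLeast_Suc_lessThan)
      \<comment> \<open>The budget is used up from \<open>i\<close> on, so \<open>v\<close> is zero
        below \<open>i\<close>, and \<open>v i\<close> is as large as the coordinates above it
        allow.\<close>
      have vb: "v i + (\<Sum>l=j..<K. v l) = b" using full[of i] Suc sv by simp
      have tot: "(\<Sum>l<i. w l) + (w i + (\<Sum>l=j..<K. v l)) \<le> b" "(\<Sum>l<i. v l) + b \<le> b"
        using w v sum_split_at[of i K w] sum_split_at[of i K v] j(1) Suc sv vb by (auto simp: simplex_points_def)
      show ?thesis
      proof (cases "w i = v i")
        case True
        have "w l = v l" if "l < i" for l using tot vb True that by auto
        then have "w = v" using above True Suc by (metis ext less_Suc_eq not_less)
        then show ?thesis ..
      next
        case False
        then have "w i < v i" using tot vb by auto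
        then have "colex K w v"
          unfolding colex_def using above j(1) Suc by (intro exI[of _ i]) auto
        then show ?thesis ..
      qed
    qed
  qed
qed

text \<open>If all suffix sums are full, the whole budget sits in the last coordinate, which makes
  \<open>v\<close> the greatest point.\<close>

lemma odo_last:
  assumes v: "v \<in> simplex_points K b" and full: "\<And>i. i < K \<Longrightarrow> (\<Sum>l=i..<K. v l) = b"
    and w: "w \<in> simplex_points K b"
  shows "w = v \<or> colex K w v"
proof (cases K)
  case 0
  then show ?thesis using v w by (auto simp: simplex_points_def)
next
  case (Suc i)
  have vi: "v i = b" using full[of i] Suc by simp
  have wi: "(\<Sum>l<i. w l) + w i \<le> b" "(\<Sum>l<i. v l) + v i \<le> b" using v w Suc by (auto simp: simplex_points_def)
  show ?thesis
  proof (cases "w i = b")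
    case True
    have "w l = v l" for l
    proof (cases "l < i")
      case True': True
      then show ?thesis using wi vi True by auto
    next
      case False
      then show ?thesis using v w Suc vi True by (cases "l = i") (auto simp: simplex_points_def)
    qed
    then show ?thesis by auto
  next
    case False
    then show ?thesis using wi vi Suc unfolding colex_def by (intro disjI2 exI[of _ i]) auto
  qed
qed

lemma colex_trans: "colex K u v \<Longrightarrow> colex K v w \<Longrightarrow> colex K u w"
  unfolding colex_def
proof (elim exE conjE)
  fix p r assume p: "p < K" "u p < v p" "\<forall>i. p < i \<longrightarrow> i < K \<longrightarrow> u i = v i"
    and r: "r < K" "v r < w r" "\<forall>i. r < i \<longrightarrow> i < K \<longrightarrow> v i = w i"
  show "\<exists>p<K. u p < w p \<and> (\<forall>i. p < i \<longrightarrow> i < K \<longrightarrow> u i = w i)"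
    using p r by (intro exI[of _ "max p r"]) (cases p r rule: linorder_cases, auto)
qed

lemma colex_irrefl: "\<not> colex K v v" by (auto simp: colex_def)

section \<open>The program\<close>

lemma agree_extend: "agree X Y s s' \<Longrightarrow> agree X' Y' s' s'' \<Longrightarrow> X' \<subseteq> X \<Longrightarrow> Y' \<subseteq> Y \<Longrightarrow> agree X Y s s''"
  using agree_trans[of X Y s s' X' Y' s'' X Y] by simp

section \<open>Loops for bilinear forms, gradients and block updates\<close>

abbreviation at2 :: "vname \<Rightarrow> iexp \<Rightarrow> iexp \<Rightarrow> rexp" where
  "at2 A e f \<equiv> RArr A (IAdd (IMul e (IV ''m'')) f)"

text \<open>Evaluates \<open>bil\<close> at two rows of the current basis. \<open>x\<close> and
  \<open>y\<close> name the variables that hold the row numbers.\<close>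

definition Quad :: "vname \<Rightarrow> vname \<Rightarrow> vname \<Rightarrow> com list" where
  "Quad x y h = RSet h (INum 0) (ROf (INum 0)) #
     For ''i'' (IV ''m'') (SumLoop ''u'' ''j'' (IV ''m'') (RMul (at2 ''M'' (IV ''i'') (IV ''j'')) (at2 ''Q'' (IV y) (IV ''j'')))
       @ [RSet h (INum 0) (RAdd (RV h) (RMul (at2 ''Q'' (IV x) (IV ''i'')) (RV ''u'')))])"

lemma wp_Quad:
  assumes m: "ints s ''m'' 0 = m" "0 < m" and xy: "x \<notin> {''i'', ''j''}" "y \<notin> {''i'', ''j''}"
    and h: "''M'' \<noteq> h" "''Q'' \<noteq> h" "''u'' \<noteq> h"
    and post: "\<And>s'. agree {''i'', ''j''} {''u'', h} s s' \<Longrightarrow>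
      reals s' h 0 = (\<Sum>i<m. \<Sum>j<m. reals s ''Q'' (ints s x 0 * m + i) * reals s ''M'' (i * m + j)
        * reals s ''Q'' (ints s y 0 * m + j)) \<Longrightarrow> P s'"
  shows "wp (Quad x y h) (12 * m\<^sup>2) P s"
proof -
  let ?f = "\<lambda>i. \<Sum>j<m. reals s ''M'' (i * m + j) * reals s ''Q'' (ints s y 0 * m + j)"
  let ?g = "\<lambda>i. reals s ''Q'' (ints s x 0 * m + i) * ?f i"
  let ?I = "\<lambda>i s'. agree {''i'', ''j''} {''u'', h} s s' \<and> reals s' h 0 = (\<Sum>l<i. ?g l)"
  have "wp (For ''i'' (IV ''m'') (SumLoop ''u'' ''j'' (IV ''m'') (RMul (at2 ''M'' (IV ''i'') (IV ''j'')) (at2 ''Q'' (IV y) (IV ''j'')))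
       @ [RSet h (INum 0) (RAdd (RV h) (RMul (at2 ''Q'' (IV x) (IV ''i'')) (RV ''u'')))]))
       (m * ((3 * m + 3 + 1) + 2) + 2) P (rupd h 0 0 s)"
  proof (rule wp_For[where I = ?I])
    show "?I 0 (iupd ''i'' 0 0 (rupd h 0 0 s))" by (simp add: agree_refl)
  next
    fix i s' assume I: "?I i s'" show "ival (IV ''m'') s' = m" using m by (simp add: agreeD[OF conjunct1[OF I]])
  next
    fix i s1 assume I: "?I i s1" and i: "i < m" "ints s1 ''i'' 0 = i"
    have E: "ints s1 ''m'' 0 = m" "ints s1 y = ints s y" "ints s1 x = ints s x" "reals s1 ''M'' = reals s ''M''" "reals s1 ''Q'' = reals s ''Q''"
      using xy h h[symmetric] m by (simp_all add: agreeD[OF conjunct1[OF I]])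
    show "wp (SumLoop ''u'' ''j'' (IV ''m'') (RMul (at2 ''M'' (IV ''i'') (IV ''j'')) (at2 ''Q'' (IV y) (IV ''j'')))
       @ [RSet h (INum 0) (RAdd (RV h) (RMul (at2 ''Q'' (IV x) (IV ''i'')) (RV ''u'')))]) (3 * m + 3 + 1)
       (\<lambda>s'. ints s' ''i'' 0 = i \<and> ?I (Suc i) (iupd ''i'' 0 (Suc i) s')) s1"
    proof (rule wp_append, rule wp_SumLoop[where f = "\<lambda>j. reals s ''M'' (i * m + j) * reals s ''Q'' (ints s y 0 * m + j)"])
      fix s2 assume a: "agree {''j''} {''u''} s1 s2" and u: "reals s2 ''u'' 0 = ?f i"
      have "agree {''i'', ''j''} {''u'', h} s s2" by (rule agree_extend[OF conjunct1[OF I] a]) simp_all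
      then show "wp [RSet h (INum 0) (RAdd (RV h) (RMul (at2 ''Q'' (IV x) (IV ''i'')) (RV ''u'')))] 1
          (\<lambda>s'. ints s' ''i'' 0 = i \<and> ?I (Suc i) (iupd ''i'' 0 (Suc i) s')) s2"
        using I i E xy h h[symmetric] u by (intro wp_RSet1) (simp add: agreeD[OF a])
    next
      fix j s2 assume a: "agree {''j''} {''u''} s1 s2" and "ints s2 ''j'' 0 = j" "j < m"
      then show "rval (RMul (at2 ''M'' (IV ''i'') (IV ''j'')) (at2 ''Q'' (IV y) (IV ''j''))) s2
          = reals s ''M'' (i * m + j) * reals s ''Q'' (ints s y 0 * m + j)"
        using E i xy by (simp add: agreeD[OF a])
    next
      fix s2 assume a: "agree {''j''} {''u''} s1 s2"
      show "ival (IV ''m'') s2 = m" using E by (simp add: agreeD[OF a])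
    qed
  next
    fix s' assume "?I m s'"
    then show "P s'" by (intro post) (simp_all add: sum_distrib_left mult.assoc)
  qed
  moreover have "m * ((3 * m + 3 + 1) + 2) + 2 + 1 \<le> 12 * m\<^sup>2"
  proof -
    have "m * ((3 * m + 3 + 1) + 2) + 2 + 1 = 3 * m\<^sup>2 + 6 * m + 3"
      by (simp add: power2_eq_square algebra_simps)
    moreover have "m \<le> m\<^sup>2" "1 \<le> m\<^sup>2" using m by (simp_all add: power2_eq_square)
    ultimately show ?thesis by linarith
  qed
  ultimately show ?thesis unfolding Quad_def
    by (intro wp_mono[OF wp_RSet[where T = "m * ((3 * m + 3 + 1) + 2) + 2"]]) simp_all
qed

text \<open>Common shape of the gradient and of the linear coefficients of the relaxation: a vector
  each entry of which comes from one sum.\<close>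

definition VecLoop :: "vname \<Rightarrow> vname \<Rightarrow> iexp \<Rightarrow> rexp \<Rightarrow> rexp \<Rightarrow> com list" where
  "VecLoop A y N e f = For ''j'' (IV ''m'') (SumLoop ''u'' y N e @ [RSet A (IV ''j'') f])"

lemma wp_VecLoop:
  assumes m: "ints s ''m'' 0 = m" "0 < m" and K: "K \<le> m" and y: "''j'' \<noteq> y" "''m'' \<noteq> y" and Au: "A \<noteq> ''u''"
    and N: "\<And>s'. agree {''j'', y} {''u'', A} s s' \<Longrightarrow> ival N s' = K"
    and e: "\<And>j l s'. agree {''j'', y} {''u'', A} s s' \<Longrightarrow> ints s' ''j'' 0 = j \<Longrightarrow> ints s' y 0 = l \<Longrightarrow> j < m
        \<Longrightarrow> l < K \<Longrightarrow> rval e s' = F j l"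
    and f: "\<And>j s'. agree {''j'', y} {''u'', A} s s' \<Longrightarrow> ints s' ''j'' 0 = j \<Longrightarrow> j < m
        \<Longrightarrow> reals s' ''u'' 0 = (\<Sum>l<K. F j l) \<Longrightarrow> rval f s' = h j"
    and post: "\<And>s'. agree {''j'', y} {''u'', A} s s' \<Longrightarrow> (\<And>j. j < m \<Longrightarrow> reals s' A j = h j) \<Longrightarrow> P s'"
  shows "wp (VecLoop A y N e f) (12 * m\<^sup>2) P s"
proof -
  let ?I = "\<lambda>i s'. agree {''j'', y} {''u'', A} s s' \<and> (\<forall>j<i. reals s' A j = h j)"
  have "wp (VecLoop A y N e f) (m * ((3 * K + 3 + 1) + 2) + 2) P s"
    unfolding VecLoop_def
  proof (rule wp_For[where I = ?I])
    fix i s' assume I: "?I i s'" show "ival (IV ''m'') s' = m" using m y by (simp add: agreeD[OF conjunct1[OF I]])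
  next
    fix i s1 assume I: "?I i s1" and i: "i < m" "ints s1 ''j'' 0 = i"
    have tr: "agree {''j'', y} {''u'', A} s s2 \<and> ints s2 ''j'' 0 = i" if "agree {y} {''u''} s1 s2" for s2
      using agree_extend[OF conjunct1[OF I] that] agreeD(1)[OF that, of "''j''"] y y[symmetric] i by auto
    show "wp (SumLoop ''u'' y N e @ [RSet A (IV ''j'') f]) (3 * K + 3 + 1)
       (\<lambda>s'. ints s' ''j'' 0 = i \<and> ?I (Suc i) (iupd ''j'' 0 (Suc i) s')) s1"
    proof (rule wp_append, rule wp_SumLoop[where f = "F i"])
      fix s2 assume a: "agree {y} {''u''} s1 s2" and u: "reals s2 ''u'' 0 = sum (F i) {..<K}"
      have "rval f s2 = h i" using f[of s2 i] tr[OF a] i u by blast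
      then show "wp [RSet A (IV ''j'') f] 1
          (\<lambda>s'. ints s' ''j'' 0 = i \<and> ?I (Suc i) (iupd ''j'' 0 (Suc i) s')) s2"
        using I tr[OF a] agreeD(2)[OF a, of A] Au by (intro wp_RSet1) (auto simp: less_Suc_eq)
    next
      fix l s2 assume a: "agree {y} {''u''} s1 s2" and l: "ints s2 y 0 = l" "l < K"
      show "rval e s2 = F i l" using tr[OF a] i l e by blast
    next
      fix s2 assume a: "agree {y} {''u''} s1 s2"
      show "ival N s2 = K" using tr[OF a] N by blast
    qed
  next
    fix s' assume "?I m s'" then show "P s'" using post by blast
  qed (simp add: agree_refl)
  moreover have "m \<le> m\<^sup>2" "1 \<le> m\<^sup>2" "m * K \<le> m\<^sup>2" using m K by (simp_all add: power2_eq_square)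
  then have "m * ((3 * K + 3 + 1) + 2) + 2 \<le> 12 * m\<^sup>2" by (simp add: algebra_simps)
  ultimately show ?thesis by (rule wp_mono)
qed

definition Grad :: "vname \<Rightarrow> rexp \<Rightarrow> com list" where
  "Grad A e = VecLoop ''g'' ''l'' (IV ''m'') (RMul (at2 A (IV ''j'') (IV ''l'')) (RArr ''Y'' (IV ''l''))) (RAdd (RV ''u'') e)"

lemma wp_Grad:
  assumes m: "ints s ''m'' 0 = m" "0 < m" and A: "A \<notin> {''u'', ''g''}"
    and e: "\<And>j s'. agree {''j'', ''l''} {''u'', ''g''} s s' \<Longrightarrow> ints s' ''j'' 0 = j \<Longrightarrow> j < m \<Longrightarrow> rval e s' = b j"
    and post: "\<And>s'. agree {''j'', ''l''} {''u'', ''g''} s s' \<Longrightarrow>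
      (\<And>j. j < m \<Longrightarrow> reals s' ''g'' j = (\<Sum>l<m. reals s A (j * m + l) * reals s ''Y'' l) + b j) \<Longrightarrow> P s'"
  shows "wp (Grad A e) (12 * m\<^sup>2) P s"
  unfolding Grad_def
proof (rule wp_VecLoop[OF m order_refl, where F = "\<lambda>j l. reals s A (j * m + l) * reals s ''Y'' l"])
  fix j l s' assume a: "agree {''j'', ''l''} {''u'', ''g''} s s'" "ints s' ''j'' 0 = j" "ints s' ''l'' 0 = l"
  show "rval (RMul (at2 A (IV ''j'') (IV ''l'')) (RArr ''Y'' (IV ''l''))) s' = reals s A (j * m + l) * reals s ''Y'' l"
    using a(2,3) A m by (simp add: agreeD[OF a(1)])
next
  fix j s' assume a: "agree {''j'', ''l''} {''u'', ''g''} s s'" "ints s' ''j'' 0 = j" "j < m"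
    "reals s' ''u'' 0 = (\<Sum>l<m. reals s A (j * m + l) * reals s ''Y'' l)"
  then show "rval (RAdd (RV ''u'') e) s' = (\<Sum>l<m. reals s A (j * m + l) * reals s ''Y'' l) + b j"
    using e[of s' j] by simp
next
  fix s' assume a: "agree {''j'', ''l''} {''u'', ''g''} s s'"
  show "ival (IV ''m'') s' = m" using m by (simp add: agreeD[OF a])
qed (use post in auto)

abbreviation Bump :: "com list" where
  "Bump \<equiv> [RSet ''Y'' (IAdd (IMul (IV ''i'') (IV ''q'')) (IV ''sel''))
     (RAdd (RArr ''Y'' (IAdd (IMul (IV ''i'') (IV ''q'')) (IV ''sel''))) (RV ''c''))]"

abbreviation ShrinkEntry :: "com list" where
  "ShrinkEntry \<equiv> [RSet ''Y'' (IAdd (IMul (IV ''i'') (IV ''q'')) (IV ''a''))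
     (RMul (RSub (ROf (INum 1)) (RV ''c'')) (RArr ''Y'' (IAdd (IMul (IV ''i'') (IV ''q'')) (IV ''a''))))]"

abbreviation MaxEntry :: "com list" where
  "MaxEntry \<equiv> [Cond (RLess (RArr ''g'' (IAdd (IMul (IV ''i'') (IV ''q'')) (IV ''sel'')))
       (RArr ''g'' (IAdd (IMul (IV ''i'') (IV ''q'')) (IV ''a'')))) [ISet ''sel'' (INum 0) (IV ''a'')] []]"

text \<open>The maximum is read off \<open>g\<close>, while \<open>Y\<close> is the only real array
  written; hence one gradient can serve all blocks.\<close>

definition Update :: "com list" where
  "Update = [ISet ''sel'' (INum 0) (INum 0)]
     @ For ''a'' (IV ''q'') MaxEntry
     @ For ''a'' (IV ''q'') ShrinkEntry
     @ Bump"

lemma wp_Update: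
  assumes iq: "ints s ''i'' 0 = i" "ints s ''q'' 0 = q" and q: "0 < q"
    and post: "\<And>s' a. agree {''a'', ''sel''} {''Y''} s s' \<Longrightarrow> maximizes q i (reals s ''g'') a \<Longrightarrow>
      reals s' ''Y'' = block_update q i (reals s ''c'' 0) a (reals s ''Y'') \<Longrightarrow> P s'"
  shows "wp Update (13 * q) P s"
proof -
  let ?g = "reals s ''g''" and ?c = "reals s ''c'' 0" and ?Y = "reals s ''Y''"
  \<comment> \<open>The contents of \<open>Y\<close> when the first \<open>b\<close> entries of
    block \<open>i\<close> have been scaled.\<close>
  let ?W = "\<lambda>b j. if j div q = i \<and> j mod q < b then (1 - ?c) * ?Y j else ?Y j"
  have last: "wp Bump 1 P s3"
    if a: "agree {''a'', ''sel''} {''Y''} s s3" and mx: "maximizes q i ?g (ints s3 ''sel'' 0)"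
      and Y: "reals s3 ''Y'' = ?W q" for s3
  proof (rule wp_RSet1, rule post[of _ "ints s3 ''sel'' 0"])
    have sel: "ints s3 ''sel'' 0 < q" using mx by (simp add: maximizes_def)
    have E: "ints s3 ''i'' 0 = i" "ints s3 ''q'' 0 = q" "reals s3 ''c'' 0 = ?c" using iq by (simp_all add: agreeD[OF a])
    have "(?W q)(i * q + ints s3 ''sel'' 0 := ?W q (i * q + ints s3 ''sel'' 0) + ?c)
      = block_update q i ?c (ints s3 ''sel'' 0) ?Y"
    proof
      fix j
      show "((?W q)(i * q + ints s3 ''sel'' 0 := ?W q (i * q + ints s3 ''sel'' 0) + ?c)) j
          = block_update q i ?c (ints s3 ''sel'' 0) ?Y j"
      proof (cases "j = i * q + ints s3 ''sel'' 0")
        case True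
        then have "j div q = i" "j mod q = ints s3 ''sel'' 0" using block_index[OF sel] by simp_all
        then show ?thesis unfolding True[symmetric] using q sel by (simp add: block_update_def)
      next
        case False
        then have "\<not> (j div q = i \<and> j mod q = ints s3 ''sel'' 0)" by (metis div_mult_mod_eq)
        then show ?thesis using False q by (auto simp: block_update_def)
      qed
    qed
    then show "reals (rupd ''Y'' (ival (IAdd (IMul (IV ''i'') (IV ''q'')) (IV ''sel'')) s3)
        (rval (RAdd (RArr ''Y'' (IAdd (IMul (IV ''i'') (IV ''q'')) (IV ''sel''))) (RV ''c'')) s3) s3) ''Y''
      = block_update q i ?c (ints s3 ''sel'' 0) ?Y"
      by (simp add: E Y)
  qed (use a mx in auto)
  have second: "wp (For ''a'' (IV ''q'') ShrinkEntry
     @ Bump)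
      ((q * (1 + 2) + 2) + 1) P s2"
    if a: "agree {''a'', ''sel''} {''Y''} s s2" and mx: "maximizes q i ?g (ints s2 ''sel'' 0)" and Y: "reals s2 ''Y'' = ?Y" for s2
  proof (rule wp_append, rule wp_For[where I = "\<lambda>b s3. agree {''a'', ''sel''} {''Y''} s s3 \<and>
      ints s3 ''sel'' 0 = ints s2 ''sel'' 0 \<and> reals s3 ''Y'' = ?W b"])
    fix b s3 assume I: "agree {''a'', ''sel''} {''Y''} s s3 \<and> ints s3 ''sel'' 0 = ints s2 ''sel'' 0 \<and> reals s3 ''Y'' = ?W b"
      and b: "b < q" "ints s3 ''a'' 0 = b"
    have E: "ints s3 ''i'' 0 = i" "ints s3 ''q'' 0 = q" "reals s3 ''c'' 0 = ?c" using iq by (simp_all add: agreeD[OF conjunct1[OF I]])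
    have "(?W b)(i * q + b := (1 - ?c) * ?W b (i * q + b)) = ?W (Suc b)"
    proof
      fix j
      show "((?W b)(i * q + b := (1 - ?c) * ?W b (i * q + b))) j = ?W (Suc b) j"
      proof (cases "j = i * q + b")
        case True
        then have "j div q = i" "j mod q = b" using block_index[OF b(1)] by simp_all
        then show ?thesis unfolding True[symmetric] by simp
      next
        case False
        then have "\<not> (j div q = i \<and> j mod q = b)" using div_mult_mod_eq[of j q] by auto
        then show ?thesis using False by (auto simp: less_Suc_eq)
      qed
    qed
    then show "wp ShrinkEntry 1
        (\<lambda>s'. ints s' ''a'' 0 = b \<and> agree {''a'', ''sel''} {''Y''} s (iupd ''a'' 0 (Suc b) s') \<and>
          ints (iupd ''a'' 0 (Suc b) s') ''sel'' 0 = ints s2 ''sel'' 0 \<and>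
          reals (iupd ''a'' 0 (Suc b) s') ''Y'' = ?W (Suc b)) s3"
      using I b E by (intro wp_RSet1) simp
  next
    fix b s3 assume I: "agree {''a'', ''sel''} {''Y''} s s3 \<and> ints s3 ''sel'' 0 = ints s2 ''sel'' 0 \<and> reals s3 ''Y'' = ?W b"
    show "ival (IV ''q'') s3 = q" using iq by (simp_all add: agreeD[OF conjunct1[OF I]])
  qed (use a mx Y last in auto)
  have first: "wp (For ''a'' (IV ''q'') MaxEntry)
      (q * ((1 + 1) + 2) + 2) (wp (For ''a'' (IV ''q'') ShrinkEntry
     @ Bump)
      ((q * (1 + 2) + 2) + 1) P) (iupd ''sel'' 0 0 s)"
  proof (rule wp_For[where I = "\<lambda>b s2. agree {''a'', ''sel''} {''Y''} s s2 \<and> reals s2 ''Y'' = ?Y \<and>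
      ints s2 ''sel'' 0 < q \<and> (\<forall>a'<b. ?g (i * q + a') \<le> ?g (i * q + ints s2 ''sel'' 0))"])
    fix b s2 assume I: "agree {''a'', ''sel''} {''Y''} s s2 \<and> reals s2 ''Y'' = ?Y \<and>
      ints s2 ''sel'' 0 < q \<and> (\<forall>a'<b. ?g (i * q + a') \<le> ?g (i * q + ints s2 ''sel'' 0))"
      and b: "b < q" "ints s2 ''a'' 0 = b"
    have E: "ints s2 ''i'' 0 = i" "ints s2 ''q'' 0 = q" "reals s2 ''g'' = ?g" using iq by (simp_all add: agreeD[OF conjunct1[OF I]])
    show "wp MaxEntry (1 + 1)
       (\<lambda>s'. ints s' ''a'' 0 = b \<and> agree {''a'', ''sel''} {''Y''} s (iupd ''a'' 0 (Suc b) s') \<and>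
         reals (iupd ''a'' 0 (Suc b) s') ''Y'' = ?Y \<and> ints (iupd ''a'' 0 (Suc b) s') ''sel'' 0 < q \<and>
         (\<forall>a'<Suc b. ?g (i * q + a') \<le> ?g (i * q + ints (iupd ''a'' 0 (Suc b) s') ''sel'' 0))) s2"
      by (rule wp_Cond1, rule wp_ISet1, goal_cases, use I b E in \<open>force simp: less_Suc_eq\<close>,
          rule wp_Nil, use I b E in \<open>force simp: less_Suc_eq not_less\<close>)
  next
    fix b s3 assume I: "agree {''a'', ''sel''} {''Y''} s s3 \<and> reals s3 ''Y'' = ?Y \<and>
      ints s3 ''sel'' 0 < q \<and> (\<forall>a'<b. ?g (i * q + a') \<le> ?g (i * q + ints s3 ''sel'' 0))"
    show "ival (IV ''q'') s3 = q" using iq by (simp_all add: agreeD[OF conjunct1[OF I]])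
  next
    fix s2 assume I: "agree {''a'', ''sel''} {''Y''} s s2 \<and> reals s2 ''Y'' = ?Y \<and>
      ints s2 ''sel'' 0 < q \<and> (\<forall>a'<q. ?g (i * q + a') \<le> ?g (i * q + ints s2 ''sel'' 0))"
    then show "wp (For ''a'' (IV ''q'') ShrinkEntry
     @ Bump)
      ((q * (1 + 2) + 2) + 1) P s2" by (intro second) (auto simp: maximizes_def)
  qed (use q in \<open>auto simp: agree_refl\<close>)
  have "wp Update (1 + ((q * ((1 + 1) + 2) + 2) + ((q * (1 + 2) + 2) + 1))) P s"
    unfolding Update_def by (rule wp_append, rule wp_ISet1, rule wp_append) (use first in simp)
  then show ?thesis by (rule wp_mono) (use q in auto)
qed

section \<open>Jacobi diagonalization\<close>

definition Init :: "com list" where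
  "Init = [ISet ''m'' (INum 0) (IMul (IV ''n'') (IV ''q''))]
     @ For ''i'' (IV ''m'') [RSet ''Q'' (IAdd (IMul (IV ''i'') (IV ''m'')) (IV ''i'')) (ROf (INum 1))]"

abbreviation RotateEntry :: "com list" where
  "RotateEntry \<equiv> [RSet ''u'' (INum 0) (at2 ''Q'' (IV ''p'') (IV ''i'')),
     RSet ''Q'' (IAdd (IMul (IV ''p'') (IV ''m'')) (IV ''i''))
       (RAdd (RMul (RV ''c'') (RV ''u'')) (RMul (RV ''s'') (at2 ''Q'' (IV ''r'') (IV ''i'')))),
     RSet ''Q'' (IAdd (IMul (IV ''r'') (IV ''m'')) (IV ''i''))
       (RSub (RMul (RV ''c'') (at2 ''Q'' (IV ''r'') (IV ''i''))) (RMul (RV ''s'') (RV ''u'')))]"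

definition Rotate :: "com list" where
  "Rotate =
     [RSet ''th'' (INum 0) (RDiv (RAdd (RSub (RV ''A2'') (RV ''A1''))
          (RSqrt (RAdd (RMul (RSub (RV ''A1'') (RV ''A2'')) (RSub (RV ''A1'') (RV ''A2'')))
            (RMul (ROf (INum 4)) (RMul (RV ''A3'') (RV ''A3''))))))
        (RMul (ROf (INum 2)) (RV ''A3''))),
      RSet ''c'' (INum 0) (RDiv (ROf (INum 1)) (RSqrt (RAdd (ROf (INum 1)) (RMul (RV ''th'') (RV ''th''))))),
      RSet ''s'' (INum 0) (RMul (RV ''th'') (RV ''c''))]
     @ For ''i'' (IV ''m'')
        RotateEntry"

text \<open>The test \<open>eps / m < \<bar>h\<bar>\<close> in squared form, as the language has no
  absolute value.\<close>

abbreviation JacobiBig :: "bexp" where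
  "JacobiBig \<equiv> RLess (RMul (RV ''eps'') (RV ''eps''))
    (RMul (RMul (ROf (IV ''m'')) (RV ''A3'')) (RMul (ROf (IV ''m'')) (RV ''A3'')))"

abbreviation JacobiTest :: "com list" where
  "JacobiTest \<equiv> [Cond (JacobiBig)
      (Rotate @ [ISet ''p'' (INum 0) (INum 0), ISet ''r'' (INum 0) (INum 0)])
      [ISet ''r'' (INum 0) (IAdd (IV ''r'') (INum 1))]]"

text \<open>A rotation may spoil entries already checked, so the scan of the pairs
  \<open>r < p\<close> starts over after each one.\<close>

definition JacobiBody :: "com list" where
  "JacobiBody = [Cond (ILess (IV ''r'') (IV ''p''))
     (Quad ''p'' ''p'' ''A1'' @ Quad ''r'' ''r'' ''A2'' @ Quad ''p'' ''r'' ''A3'' @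
       JacobiTest)
     [ISet ''p'' (INum 0) (IAdd (IV ''p'') (INum 1)), ISet ''r'' (INum 0) (INum 0)]]"

definition Jacobi :: "com list" where
  "Jacobi = [ISet ''p'' (INum 0) (INum 0), ISet ''r'' (INum 0) (INum 0)]
     @ [While (ILess (IV ''p'') (IV ''m'')) JacobiBody]"

lemma flat_index_eq:
  assumes "(j::nat) < m" "j' < m" shows "i * m + j = i' * m + j' \<longleftrightarrow> i = i' \<and> j = j'"
  using block_index[OF assms(1), of i] block_index[OF assms(2), of i'] by metis

definition rowf :: "nat \<Rightarrow> (nat \<Rightarrow> real) \<Rightarrow> nat \<Rightarrow> nat \<Rightarrow> real" where
  "rowf m A j i = A (j * m + i)"

lemma wp_Init:
  assumes nq: "ints s ''n'' 0 = n" "ints s ''q'' 0 = q" and m: "m = n * q" "0 < m"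
    and Q: "reals s ''Q'' = (\<lambda>_. 0)"
    and post: "\<And>s'. agree {''m'', ''i''} {''Q''} s s' \<Longrightarrow> ints s' ''m'' 0 = m \<Longrightarrow>
      (\<And>j i. j < m \<Longrightarrow> i < m \<Longrightarrow> rowf m (reals s' ''Q'') j i = (if i = j then 1 else 0)) \<Longrightarrow> P s'"
  shows "wp Init (6 * m) P s"
proof -
  let ?I = "\<lambda>k s'. agree {''m'', ''i''} {''Q''} s s' \<and> ints s' ''m'' 0 = m \<and>
    (\<forall>j<m. \<forall>i<m. rowf m (reals s' ''Q'') j i = (if i = j \<and> i < k then 1 else 0))"
  have "wp Init (1 + (m * (1 + 2) + 2)) P s"
    unfolding Init_def
  proof (rule wp_append, rule wp_ISet1, rule wp_For[where I = ?I])
    fix k s' assume I: "?I k s'" and k: "k < m" "ints s' ''i'' 0 = k"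
    show "wp [RSet ''Q'' (IAdd (IMul (IV ''i'') (IV ''m'')) (IV ''i'')) (ROf (INum 1))] 1
        (\<lambda>s'. ints s' ''i'' 0 = k \<and> ?I (Suc k) (iupd ''i'' 0 (Suc k) s')) s'"
      using I k by (intro wp_RSet1) (auto simp: rowf_def flat_index_eq)
  next
    fix s' assume "?I m s'" then show "P s'" by (intro post) auto
  qed (use nq m Q in \<open>auto simp: agree_refl rowf_def\<close>)
  then show ?thesis by (rule wp_mono) (use m in auto)
qed

context symmetric_form
begin

text \<open>The memory determines the basis only at indices below \<open>m\<close>, so facts about
  \<open>rot\<close> reach the stored matrix through such congruences.\<close>

lemma orth_cong: "(\<And>j i. j < m \<Longrightarrow> i < m \<Longrightarrow> Q j i = Q' j i) \<Longrightarrow> orth Q = orth Q'"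
  unfolding orth_def by simp

lemma tr_cong: "(\<And>j i. j < m \<Longrightarrow> i < m \<Longrightarrow> Q j i = Q' j i) \<Longrightarrow> tr Q = tr Q'"
  unfolding tr_def by (intro sum.cong refl bil_cong) auto

lemma pot_cong: "(\<And>j i. j < m \<Longrightarrow> i < m \<Longrightarrow> Q j i = Q' j i) \<Longrightarrow> pot Q = pot Q'"
  unfolding pot_def by (intro sum.cong refl arg_cong[of _ _ "\<lambda>x. x\<^sup>2"] bil_cong) auto

lemma wp_Rotate:
  assumes E: "ints s ''m'' 0 = m" "ints s ''p'' 0 = p" "ints s ''r'' 0 = r" and pr: "p < m" "r < m" "p \<noteq> r"
    and h: "reals s ''A3'' 0 \<noteq> 0"
    and post: "\<And>s' c t. agree {''i''} {''th'', ''c'', ''s'', ''u'', ''Q''} s s' \<Longrightarrow> c\<^sup>2 + t\<^sup>2 = 1 \<Longrightarrow>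
      (c\<^sup>2 - t\<^sup>2) * reals s ''A3'' 0 = c * t * (reals s ''A1'' 0 - reals s ''A2'' 0) \<Longrightarrow>
      (\<And>j i. j < m \<Longrightarrow> i < m \<Longrightarrow> rowf m (reals s' ''Q'') j i = rot c t p r (rowf m (reals s ''Q'')) j i) \<Longrightarrow> P s'"
  shows "wp Rotate (10 * m) P s"
proof -
  let ?Q = "rowf m (reals s ''Q'')"
  define a b hh where "a = reals s ''A1'' 0" and "b = reals s ''A2'' 0" and "hh = reals s ''A3'' 0"
  define th where "th = (b - a + sqrt ((a - b) * (a - b) + 4 * (hh * hh))) / (2 * hh)"
  define c where "c = 1 / sqrt (1 + th * th)"
  note ang = rot_angle[of hh b a, folded th_def, folded c_def]
  have hh: "hh \<noteq> 0" using h by (simp add: hh_def)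
  let ?V = "{''th'', ''c'', ''s'', ''u'', ''Q''}"
  let ?I = "\<lambda>k s'. agree {''i''} ?V s s' \<and> reals s' ''c'' 0 = c \<and> reals s' ''s'' 0 = th * c \<and>
    (\<forall>j<m. \<forall>i<m. rowf m (reals s' ''Q'') j i = (if i < k then rot c (th * c) p r ?Q j i else ?Q j i))"
  have loop: "wp (For ''i'' (IV ''m'')
        RotateEntry)
      (m * ((1 + 1 + 1) + 2) + 2) P s1" if s1: "?I 0 s1" for s1
  proof (rule wp_For[where I = ?I])
    show "?I 0 (iupd ''i'' 0 0 s1)" using s1 by auto
  next
    fix k s' assume I: "?I k s'" show "ival (IV ''m'') s' = m" using E by (simp add: agreeD[OF conjunct1[OF I]])
  next
    fix k s' assume I: "?I k s'" and k: "k < m" "ints s' ''i'' 0 = k"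
    have E': "ints s' ''m'' 0 = m" "ints s' ''p'' 0 = p" "ints s' ''r'' 0 = r"
      using E by (simp_all add: agreeD[OF conjunct1[OF I]])
    have Qp: "reals s' ''Q'' (p * m + k) = ?Q p k" "reals s' ''Q'' (r * m + k) = ?Q r k"
      using I pr k by (auto simp: rowf_def)
    show "wp RotateEntry (1 + 1 + 1)
        (\<lambda>s'. ints s' ''i'' 0 = k \<and> ?I (Suc k) (iupd ''i'' 0 (Suc k) s')) s'"
      by (rule wp_RSet, rule wp_RSet, rule wp_RSet1)
        (use I k E' Qp pr in \<open>auto simp: flat_index_eq rowf_def rot_def less_Suc_eq\<close>)
  next
    fix s' assume I: "?I m s'"
    show "P s'"
      by (rule post[of s' c "th * c"]) (use I ang[OF hh] in \<open>auto simp: a_def b_def hh_def\<close>)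
  qed
  have "wp Rotate ((1 + 1 + 1) + (m * ((1 + 1 + 1) + 2) + 2)) P s"
    unfolding Rotate_def
    by (rule wp_append, rule wp_RSet, rule wp_RSet, rule wp_RSet1, rule loop)
      (simp add: agree_refl th_def c_def a_def b_def hh_def)
  then show ?thesis by (rule wp_mono) (use pr in auto)
qed

end

context block_form
begin

text \<open>The budget has to hold along the entire run, hence for all bases that rotations could
  reach.\<close>

definition pmax_ok :: "real \<Rightarrow> bool" where
  "pmax_ok pm \<longleftrightarrow> (\<forall>Q. orth Q \<longrightarrow> tr Q = 0 \<longrightarrow> pot Q \<le> pm)"

text \<open>The number of rotations that the budget \<open>pm\<close> still allows: each one raises
  \<open>pot\<close> by \<open>2 * h^2\<close>, which exceeds
  \<open>2 * eps^2 / m^2\<close>.\<close>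

definition rots :: "real \<Rightarrow> (nat \<Rightarrow> nat \<Rightarrow> real) \<Rightarrow> nat" where
  "rots pm Q = nat \<lfloor>(pm - pot Q) * ((real m)\<^sup>2 / (2 * eps\<^sup>2))\<rfloor>"

lemma rots_decrease:
  fixes h :: real
  assumes pm: "pot Q' \<le> pm" and inc: "pot Q' = pot Q + 2 * h\<^sup>2" and h: "eps * eps < (m * h) * (m * h)"
  shows "rots pm Q' < rots pm Q"
proof -
  define f where "f = (real m)\<^sup>2 / (2 * eps\<^sup>2)"
  have f: "0 < f" using m_pos eps by (simp add: f_def)
  have "1 \<le> 2 * h\<^sup>2 * f" using h eps by (simp add: f_def field_simps power2_eq_square)
  then have le: "(pm - pot Q') * f + 1 \<le> (pm - pot Q) * f" unfolding inc by (simp add: algebra_simps)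
  have "0 \<le> (pm - pot Q') * f" using pm f by (intro mult_nonneg_nonneg) auto
  then have "0 \<le> \<lfloor>(pm - pot Q') * f\<rfloor>" by simp
  moreover have "\<lfloor>(pm - pot Q') * f\<rfloor> + 1 \<le> \<lfloor>(pm - pot Q) * f\<rfloor>" using le by linarith
  ultimately show ?thesis unfolding rots_def f_def[symmetric] by linarith
qed

text \<open>There is at most one scan per rotation and a last one. A scan makes O(m^2) tests, and a
  test evaluates three forms in time O(m^2).\<close>

lemma wp_Jacobi:
  assumes mm: "ints s ''m'' 0 = m" and e: "reals s ''eps'' 0 = eps"
    and Mr: "\<And>i j. i < m \<Longrightarrow> j < m \<Longrightarrow> rowf m (reals s ''M'') i j = M i j"
    and Q0: "orth (rowf m (reals s ''Q''))" "tr (rowf m (reals s ''Q'')) = 0" and pm: "pmax_ok pm"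
    and post: "\<And>s'. agree {''p'', ''r'', ''i'', ''j''} {''A1'', ''A2'', ''A3'', ''u'', ''th'', ''c'', ''s'', ''Q''} s s' \<Longrightarrow>
      good (rowf m (reals s' ''Q'')) \<Longrightarrow> P s'"
  shows "wp Jacobi ((rots pm (rowf m (reals s ''Q'')) + 1) * (200 * m ^ 4)) P s"
proof -
  let ?X = "{''p'', ''r'', ''i'', ''j''}" and ?Y = "{''A1'', ''A2'', ''A3'', ''u'', ''th'', ''c'', ''s'', ''Q''}"
  let ?Q = "\<lambda>s. rowf m (reals s ''Q'')" and ?p = "\<lambda>s. ints s ''p'' 0" and ?r = "\<lambda>s. ints s ''r'' 0"
  let ?I = "\<lambda>s'. agree ?X ?Y s s' \<and> orth (?Q s') \<and> tr (?Q s') = 0 \<and> ?p s' \<le> m \<and> ?r s' \<le> ?p s' \<and>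
    (\<forall>p<m. \<forall>r<p. p < ?p s' \<or> (p = ?p s' \<and> r < ?r s') \<longrightarrow> \<bar>bil (?Q s' p) (?Q s' r)\<bar> \<le> eps / m)"
  \<comment> \<open>A lexicographic measure: a scan has at most \<open>m * (m + 1)\<close>
    positions, so one rotation less outweighs the restart.\<close>
  let ?\<mu> = "\<lambda>s'. rots pm (?Q s') * (m * (m + 1) + 1) + ((m - ?p s') * (m + 1) - ?r s')"
  let ?Tb = "(12 * m\<^sup>2 + (12 * m\<^sup>2 + (12 * m\<^sup>2 + ((10 * m + (1 + 1)) + 1)))) + 1"
  have body: "wp JacobiBody ?Tb (\<lambda>s2. ?I s2 \<and> ?\<mu> s2 < ?\<mu> s1) s1" if I: "?I s1" and lt: "?p s1 < m" for s1
    unfolding JacobiBody_def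
  proof (rule wp_Cond1)
    assume "bval (ILess (IV ''r'') (IV ''p'')) s1"
    then have rp: "?r s1 < ?p s1" by simp
    have agr: "agree ?X ?Y s s1" using I by blast
    have E: "ints s1 ''m'' 0 = m" "reals s1 ''eps'' 0 = eps" "reals s1 ''M'' = reals s ''M''"
      using mm e by (simp_all add: agreeD[OF agr])
    define p r where "p = ?p s1" and "r = ?r s1"
    have pr: "p < m" "r < m" "p \<noteq> r" using rp lt by (auto simp: p_def r_def)
    have quad: "(\<Sum>i<m. \<Sum>j<m. reals s1 ''Q'' (x * m + i) * reals s1 ''M'' (i * m + j) * reals s1 ''Q'' (y * m + j))
        = bil (?Q s1 x) (?Q s1 y)" for x y
      unfolding bil_def E(3) using Mr by (intro sum.cong refl) (simp add: rowf_def)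
    show "wp (Quad ''p'' ''p'' ''A1'' @ Quad ''r'' ''r'' ''A2'' @ Quad ''p'' ''r'' ''A3'' @
       JacobiTest)
      (12 * m\<^sup>2 + (12 * m\<^sup>2 + (12 * m\<^sup>2 + ((10 * m + (1 + 1)) + 1)))) (\<lambda>s2. ?I s2 \<and> ?\<mu> s2 < ?\<mu> s1) s1"
    proof (rule wp_append, rule wp_Quad[OF E(1) m_pos])
      fix s2 assume a2: "agree {''i'', ''j''} {''u'', ''A1''} s1 s2"
        and A1: "reals s2 ''A1'' 0 = (\<Sum>i<m. \<Sum>j<m. reals s1 ''Q'' (ints s1 ''p'' 0 * m + i) * reals s1 ''M'' (i * m + j)
          * reals s1 ''Q'' (ints s1 ''p'' 0 * m + j))"
      show "wp (Quad ''r'' ''r'' ''A2'' @ Quad ''p'' ''r'' ''A3'' @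
       JacobiTest)
       (12 * m\<^sup>2 + (12 * m\<^sup>2 + ((10 * m + (1 + 1)) + 1))) (\<lambda>s2. ?I s2 \<and> ?\<mu> s2 < ?\<mu> s1) s2"
      proof (rule wp_append, rule wp_Quad[OF _ m_pos])
        fix s3 assume a3: "agree {''i'', ''j''} {''u'', ''A2''} s2 s3"
          and A2: "reals s3 ''A2'' 0 = (\<Sum>i<m. \<Sum>j<m. reals s2 ''Q'' (ints s2 ''r'' 0 * m + i) * reals s2 ''M'' (i * m + j)
            * reals s2 ''Q'' (ints s2 ''r'' 0 * m + j))"
        show "wp (Quad ''p'' ''r'' ''A3'' @
         JacobiTest)
         (12 * m\<^sup>2 + ((10 * m + (1 + 1)) + 1)) (\<lambda>s2. ?I s2 \<and> ?\<mu> s2 < ?\<mu> s1) s3"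
        proof (rule wp_append, rule wp_Quad[OF _ m_pos])
          fix s4 assume a4: "agree {''i'', ''j''} {''u'', ''A3''} s3 s4"
            and A3: "reals s4 ''A3'' 0 = (\<Sum>i<m. \<Sum>j<m. reals s3 ''Q'' (ints s3 ''p'' 0 * m + i) * reals s3 ''M'' (i * m + j)
              * reals s3 ''Q'' (ints s3 ''r'' 0 * m + j))"
          note AD = agreeD[OF a4] agreeD[OF a3] agreeD[OF a2]
          have agr4: "agree ?X ?Y s s4"
            by (rule agree_extend[OF agree_extend[OF agree_extend[OF agr a2] a3] a4]) simp_all
          have V: "reals s4 ''A1'' 0 = bil (?Q s1 p) (?Q s1 p)" "reals s4 ''A2'' 0 = bil (?Q s1 r) (?Q s1 r)"
              "reals s4 ''A3'' 0 = bil (?Q s1 p) (?Q s1 r)" "reals s4 ''Q'' = reals s1 ''Q''"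
              "ints s4 ''p'' 0 = p" "ints s4 ''r'' 0 = r" "ints s4 ''m'' 0 = m" "reals s4 ''eps'' 0 = eps"
            using A1 A2 A3 E by (simp_all add: AD p_def r_def flip: quad)
          show "wp JacobiTest ((10 * m + (1 + 1)) + 1)
             (\<lambda>s2. ?I s2 \<and> ?\<mu> s2 < ?\<mu> s1) s4"
          proof (rule wp_Cond1)
            assume "bval (JacobiBig) s4"
            then have big: "eps * eps < (m * bil (?Q s1 p) (?Q s1 r)) * (m * bil (?Q s1 p) (?Q s1 r))"
              using V by simp
            then have ne: "reals s4 ''A3'' 0 \<noteq> 0" using V eps by auto
            show "wp (Rotate @ [ISet ''p'' (INum 0) (INum 0), ISet ''r'' (INum 0) (INum 0)]) (10 * m + (1 + 1))
              (\<lambda>s2. ?I s2 \<and> ?\<mu> s2 < ?\<mu> s1) s4"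
            proof (rule wp_append, rule wp_Rotate[OF V(7,5,6) pr ne])
              fix s5 c t assume a5: "agree {''i''} {''th'', ''c'', ''s'', ''u'', ''Q''} s4 s5" and ct: "c\<^sup>2 + t\<^sup>2 = 1"
                and ct2: "(c\<^sup>2 - t\<^sup>2) * reals s4 ''A3'' 0 = c * t * (reals s4 ''A1'' 0 - reals s4 ''A2'' 0)"
                and Q5: "\<And>j i. j < m \<Longrightarrow> i < m \<Longrightarrow> ?Q s5 j i = rot c t p r (?Q s4) j i"
              have agr5: "agree ?X ?Y s s5" by (rule agree_extend[OF agr4 a5]) simp_all
              let ?R = "rot c t p r (?Q s1)"
              have Q5': "?Q s5 j i = ?R j i" if "j < m" "i < m" for j i using Q5[OF that] V(4) by simp
              have o: "orth (?Q s5)" "tr (?Q s5) = 0" "pot (?Q s5) = pot (?Q s1) + 2 * (bil (?Q s1 p) (?Q s1 r))\<^sup>2"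
                using orth_rot[OF _ pr ct, of "?Q s1"] tr_rot[OF pr ct, of "?Q s1"] pot_rot[OF pr ct, of "?Q s1"] I ct2 V
                  orth_cong[OF Q5'] tr_cong[OF Q5'] pot_cong[OF Q5'] by auto
              have "rots pm (?Q s5) < rots pm (?Q s1)"
                by (rule rots_decrease[OF _ o(3) big]) (use pm o in \<open>auto simp: pmax_ok_def\<close>)
              then have "rots pm (?Q s5) * (m * (m + 1) + 1) + (m * (m + 1) + 1) \<le> rots pm (?Q s1) * (m * (m + 1) + 1)"
                using mult_le_mono1[of "Suc (rots pm (?Q s5))" "rots pm (?Q s1)" "m * (m + 1) + 1"] by simp
              then show "wp [ISet ''p'' (INum 0) (INum 0), ISet ''r'' (INum 0) (INum 0)] (1 + 1)
                  (\<lambda>s2. ?I s2 \<and> ?\<mu> s2 < ?\<mu> s1) s5"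
                by (intro wp_ISet wp_ISet1) (use agr5 o in auto)
            qed
          next
            assume "\<not> bval (JacobiBig) s4"
            then have "(m * bil (?Q s1 p) (?Q s1 r))\<^sup>2 \<le> eps\<^sup>2" using V by (simp add: power2_eq_square)
            then have "\<bar>m * bil (?Q s1 p) (?Q s1 r)\<bar> \<le> \<bar>eps\<bar>" by (simp only: abs_le_square_iff)
            then have small: "\<bar>bil (?Q s1 p) (?Q s1 r)\<bar> \<le> eps / m"
              using eps m_pos by (simp add: abs_mult field_simps)
            \<comment> \<open>Subtraction of naturals truncates at 0; the measure drops because the
              minuend is still larger than \<open>r\<close>.\<close>
            have "1 * (m + 1) \<le> (m - p) * (m + 1)" by (rule mult_le_mono1) (use pr(1) in simp)
            then have "m + 1 \<le> (m - p) * (m + 1)" by (simp only: mult_1)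
            then have dec: "(m - p) * (m + 1) - Suc r < (m - p) * (m + 1) - r" using pr(2) by linarith
            show "wp [ISet ''r'' (INum 0) (IAdd (IV ''r'') (INum 1))] (10 * m + (1 + 1)) (\<lambda>s2. ?I s2 \<and> ?\<mu> s2 < ?\<mu> s1) s4"
              by (rule wp_mono[OF wp_ISet1[where Q = "\<lambda>s2. ?I s2 \<and> ?\<mu> s2 < ?\<mu> s1"]])
                (use I agr4 V small dec rp in \<open>auto simp: p_def r_def less_Suc_eq\<close>)
          qed
        qed (use E in \<open>simp_all add: agreeD[OF a3] agreeD[OF a2]\<close>)
      qed (use E in \<open>simp_all add: agreeD[OF a2]\<close>)
    qed simp_all
  next
    assume "\<not> bval (ILess (IV ''r'') (IV ''p'')) s1"
    then have rp: "?r s1 = ?p s1" using I by simp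
    \<comment> \<open>The next row lowers the product by \<open>m + 1\<close>, which is more than
      the \<open>r = p\<close> that is no longer subtracted.\<close>
    have "(m - ?p s1) * (m + 1) = (m - Suc (?p s1)) * (m + 1) + (m + 1)"
      using lt by (metis Suc_diff_Suc add.commute mult_Suc)
    then have dec: "(m - Suc (?p s1)) * (m + 1) < (m - ?p s1) * (m + 1) - ?r s1" using lt rp by linarith
    show "wp [ISet ''p'' (INum 0) (IAdd (IV ''p'') (INum 1)), ISet ''r'' (INum 0) (INum 0)]
       (12 * m\<^sup>2 + (12 * m\<^sup>2 + (12 * m\<^sup>2 + ((10 * m + (1 + 1)) + 1)))) (\<lambda>s2. ?I s2 \<and> ?\<mu> s2 < ?\<mu> s1) s1"
      by (rule wp_mono[OF wp_ISet[OF wp_ISet1[where Q = "\<lambda>s2. ?I s2 \<and> ?\<mu> s2 < ?\<mu> s1"]]])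
        (use I lt rp dec in \<open>auto simp: less_Suc_eq\<close>)
  qed
  let ?N = "rots pm (?Q s) * (m * (m + 1) + 1) + m * (m + 1)"
  have "wp Jacobi ((1 + 1) + (?N * (?Tb + 1) + 1)) P s"
    unfolding Jacobi_def
  proof (rule wp_append, rule wp_ISet, rule wp_ISet1, rule wp_While[where I = ?I and \<mu> = ?\<mu>])
    fix s1 assume "?I s1" "bval (ILess (IV ''p'') (IV ''m'')) s1"
    moreover have "ints s1 ''m'' 0 = m" using \<open>?I s1\<close> mm agreeD(1)[of ?X ?Y s s1 "''m''"] by simp
    ultimately show "wp JacobiBody ?Tb (\<lambda>s2. ?I s2 \<and> ?\<mu> s2 < ?\<mu> s1) s1" by (intro body) auto
  next
    fix s1 assume I: "?I s1" and "\<not> bval (ILess (IV ''p'') (IV ''m'')) s1"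
    moreover have "ints s1 ''m'' 0 = m" using I mm agreeD(1)[of ?X ?Y s s1 "''m''"] by simp
    ultimately have "m \<le> ?p s1" by simp
    then show "P s1" using I by (intro post) (auto simp: good_def)
  qed (use Q0 in \<open>auto simp: agree_refl\<close>)
  moreover have "(1 + 1) + (?N * (?Tb + 1) + 1) \<le> (rots pm (?Q s) + 1) * (200 * m ^ 4)"
  proof -
    have sq: "m \<le> m\<^sup>2" "1 \<le> m\<^sup>2" using m_pos by (simp_all add: power2_eq_square)
    have a: "m * (m + 1) + 1 \<le> 3 * m\<^sup>2"
    proof -
      have "m * (m + 1) + 1 = m\<^sup>2 + m + 1" by (simp add: power2_eq_square)
      then show ?thesis using sq by linarith
    qed
    have "?N \<le> (rots pm (?Q s) + 1) * (m * (m + 1) + 1)" by simp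
    also have "\<dots> \<le> (rots pm (?Q s) + 1) * (3 * m\<^sup>2)" using a by (rule mult_le_mono2)
    finally have N: "?N \<le> (rots pm (?Q s) + 1) * (3 * m\<^sup>2)" .
    have T: "?Tb + 1 \<le> 52 * m\<^sup>2" using sq by linarith
    have "?N * (?Tb + 1) \<le> (rots pm (?Q s) + 1) * (3 * m\<^sup>2) * (52 * m\<^sup>2)" by (rule mult_le_mono[OF N T])
    also have "\<dots> = (rots pm (?Q s) + 1) * (156 * m ^ 4)" by (simp add: power2_eq_square power4_eq_xxxx algebra_simps)
    finally have 1: "?N * (?Tb + 1) \<le> (rots pm (?Q s) + 1) * (156 * m ^ 4)" .
    have "1 * 1 \<le> (rots pm (?Q s) + 1) * m ^ 4" using m_pos by (intro mult_le_mono) auto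
    then show ?thesis using 1 by (simp add: algebra_simps)
  qed
  ultimately show ?thesis by (rule wp_mono)
qed

end

section \<open>Top directions, scale, mesh width and relaxed matrices\<close>

abbreviation SelectTest :: "com list" where
  "SelectTest \<equiv> [Cond (RLess (RMul (ROf (INum 2)) (RV ''eps'')) (RV ''A1''))
    [ISet ''idx'' (IV ''k'') (IV ''l''), RSet ''lam'' (IV ''k'') (RV ''A1''),
     ISet ''k'' (INum 0) (IAdd (IV ''k'') (INum 1))] []]"

definition Select :: "com list" where
  "Select = [ISet ''k'' (INum 0) (INum 0)]
     @ For ''l'' (IV ''m'') (Quad ''l'' ''l'' ''A1''
         @ SelectTest)"

text \<open>Reals cannot be rounded at unit cost, so the least \<open>R\<close> with
  \<open>eps * R \<ge> 1\<close> is found by counting.\<close>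

abbreviation ScaleLoop :: "com list" where
  "ScaleLoop \<equiv> [While (RLess (RMul (ROf (IV ''R'')) (RV ''eps'')) (ROf (INum 1)))
    [ISet ''R'' (INum 0) (IAdd (IV ''R'') (INum 1))]]"

text \<open>Without top directions \<open>k\<close> may be 0, and then no time proportional to
  \<open>1 / eps\<close> is affordable; \<open>R = m\<close> avoids the counting loop.\<close>

definition Scale :: "com list" where
  "Scale = [Cond (ILess (INum 0) (IV ''k''))
     ([ISet ''R'' (INum 0) (INum 0)] @ ScaleLoop)
     [ISet ''R'' (INum 0) (IV ''m'')]]"

text \<open>Without top directions the quotient in \<open>eta\<close> is a division by zero and
  \<open>eta\<close> is 0; the net is then a single point.\<close>

definition Weights :: "com list" where
  "Weights = [RSet ''tau'' (INum 0) (ROf (INum 0))]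
     @ For ''i'' (IV ''n'') ([RSet ''tau'' (INum 0) (RAdd (RV ''tau'') (RArr ''D'' (IV ''i'')))]
         @ For ''a'' (IV ''q'') [RSet ''S'' (IAdd (IMul (IV ''i'') (IV ''q'')) (IV ''a'')) (RSqrt (RArr ''D'' (IV ''i'')))])
     @ [RSet ''eta'' (INum 0) (RSqrt (RDiv (RMul (RV ''eps'') (RV ''tau'')) (ROf (IV ''k''))))]"

abbreviation MatsTerm :: "rexp" where
  "MatsTerm \<equiv> RMul (RMul (at2 ''Q'' (IArr ''idx'' (IV ''t'')) (IV ''i'')) (RArr ''lam'' (IV ''t'')))
    (at2 ''Q'' (IArr ''idx'' (IV ''t'')) (IV ''j''))"

abbreviation MatsEntry :: "com list" where
  "MatsEntry \<equiv> [RSet ''H'' (IAdd (IMul (IV ''i'') (IV ''m'')) (IV ''j''))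
       (RMul (RMul (RArr ''S'' (IV ''i'')) (RArr ''S'' (IV ''j''))) (at2 ''M'' (IV ''i'') (IV ''j''))),
     RSet ''B'' (IAdd (IMul (IV ''i'') (IV ''m'')) (IV ''j''))
       (RMul (RMul (RArr ''S'' (IV ''i'')) (RArr ''S'' (IV ''j''))) (RSub (at2 ''M'' (IV ''i'') (IV ''j'')) (RV ''u'')))]"

definition Mats :: "com list" where
  "Mats = For ''i'' (IV ''m'') (For ''j'' (IV ''m'')
     (SumLoop ''u'' ''t'' (IV ''k'') (MatsTerm)
      @ MatsEntry))"

abbreviation StartEntry :: "com list" where
  "StartEntry \<equiv> [RSet ''Y'' (IMul (IV ''i'') (IV ''q'')) (ROf (INum 1)), ISet ''y'' (IMul (IV ''i'') (IV ''q'')) (INum 1)]"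

text \<open>\<open>- tau\<close> is a lower bound for the objective on feasible points, so the
  initial vertex meets the invariant of the search without being evaluated.\<close>

definition Start :: "com list" where
  "Start = For ''i'' (IV ''n'') StartEntry
     @ [RSet ''best'' (INum 0) (RSub (ROf (INum 0)) (RV ''tau'')), ISet ''go'' (INum 0) (INum 1)]"

lemma bij_betw_extend:
  assumes "bij_betw f {..<k} A" "l \<notin> A"
  shows "bij_betw (f(k := l)) {..<Suc k} (insert l A)"
proof -
  have "bij_betw (f(k := l)) {..<k} A \<longleftrightarrow> bij_betw f {..<k} A" by (rule bij_betw_cong) simp
  then have "bij_betw (f(k := l)) ({..<k} \<union> {k}) (A \<union> {(f(k := l)) k})"
    using assms by (intro notIn_Un_bij_betw) auto
  then show ?thesis by (simp add: lessThan_Suc)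
qed

context block_form
begin

lemma wp_Select:
  assumes mm: "ints s ''m'' 0 = m" and e: "reals s ''eps'' 0 = eps"
    and Mr: "\<And>i j. i < m \<Longrightarrow> j < m \<Longrightarrow> rowf m (reals s ''M'') i j = M i j"
  defines "Q \<equiv> rowf m (reals s ''Q'')"
  assumes post: "\<And>s'. agree {''k'', ''l'', ''i'', ''j'', ''idx''} {''u'', ''A1'', ''lam''} s s' \<Longrightarrow>
      bij_betw (ints s' ''idx'') {..<ints s' ''k'' 0} (tops Q) \<Longrightarrow>
      (\<And>t. t < ints s' ''k'' 0 \<Longrightarrow> reals s' ''lam'' t = eig Q (ints s' ''idx'' t)) \<Longrightarrow> P s'"
  shows "wp Select (22 * m ^ 3) P s"
proof -
  let ?X = "{''k'', ''l'', ''i'', ''j'', ''idx''}" and ?Y = "{''u'', ''A1'', ''lam''}"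
  let ?I = "\<lambda>l s'. agree ?X ?Y s s' \<and> bij_betw (ints s' ''idx'') {..<ints s' ''k'' 0} (tops Q \<inter> {..<l}) \<and>
      (\<forall>t<ints s' ''k'' 0. reals s' ''lam'' t = eig Q (ints s' ''idx'' t))"
  have "wp Select (1 + (m * ((12 * m\<^sup>2 + ((1 + 1 + 1) + 1)) + 2) + 2)) P s"
    unfolding Select_def
  proof (rule wp_append, rule wp_ISet1, rule wp_For[where I = ?I])
    show "?I 0 (iupd ''l'' 0 0 (iupd ''k'' (ival (INum 0) s) (ival (INum 0) s) s))" by (simp add: agree_refl bij_betw_def)
  next
    fix l s1 assume I: "?I l s1" show "ival (IV ''m'') s1 = m" using mm by (simp add: agreeD[OF conjunct1[OF I]])
  next
    fix s1 assume I: "?I m s1"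
    moreover have "tops Q \<inter> {..<m} = tops Q" by (auto simp: tops_def)
    ultimately show "P s1" by (intro post) auto
  next
    fix l s1 assume I: "?I l s1" and l: "l < m" "ints s1 ''l'' 0 = l"
    have E: "ints s1 ''m'' 0 = m" "reals s1 ''eps'' 0 = eps" "reals s1 ''M'' = reals s ''M''" "reals s1 ''Q'' = reals s ''Q''"
      using mm e by (simp_all add: agreeD[OF conjunct1[OF I]])
    show "wp (Quad ''l'' ''l'' ''A1''
         @ SelectTest) (12 * m\<^sup>2 + ((1 + 1 + 1) + 1))
        (\<lambda>s'. ints s' ''l'' 0 = l \<and> ?I (Suc l) (iupd ''l'' 0 (Suc l) s')) s1"
    proof (rule wp_append, rule wp_Quad[OF E(1) m_pos])
      fix s2 assume a2: "agree {''i'', ''j''} {''u'', ''A1''} s1 s2"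
        and A1: "reals s2 ''A1'' 0 = (\<Sum>i<m. \<Sum>j<m. reals s1 ''Q'' (ints s1 ''l'' 0 * m + i) * reals s1 ''M'' (i * m + j)
          * reals s1 ''Q'' (ints s1 ''l'' 0 * m + j))"
      have A: "reals s2 ''A1'' 0 = eig Q l"
        unfolding A1 bil_def E l(2) using Mr by (intro sum.cong refl) (simp add: rowf_def Q_def)
      have agr: "agree ?X ?Y s s2" by (rule agree_extend[OF conjunct1[OF I] a2]) simp_all
      have K: "ints s2 ''k'' = ints s1 ''k''" "ints s2 ''idx'' = ints s1 ''idx''" "reals s2 ''lam'' = reals s1 ''lam''"
         "ints s2 ''l'' 0 = l" "reals s2 ''eps'' 0 = eps"
        using l E by (simp_all add: agreeD[OF a2])
      show "wp SelectTest ((1 + 1 + 1) + 1)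
         (\<lambda>s'. ints s' ''l'' 0 = l \<and> ?I (Suc l) (iupd ''l'' 0 (Suc l) s')) s2"
      proof (rule wp_Cond1)
        assume "bval (RLess (RMul (ROf (INum 2)) (RV ''eps'')) (RV ''A1'')) s2"
        then have "l \<in> tops Q" using A K l by (simp add: tops_def)
        then have ins: "tops Q \<inter> {..<Suc l} = insert l (tops Q \<inter> {..<l})" by (auto simp: less_Suc_eq)
        have bij: "bij_betw ((ints s1 ''idx'')(ints s1 ''k'' 0 := l)) {..<Suc (ints s1 ''k'' 0)} (insert l (tops Q \<inter> {..<l}))"
          using I by (intro bij_betw_extend) auto
        show "wp [ISet ''idx'' (IV ''k'') (IV ''l''), RSet ''lam'' (IV ''k'') (RV ''A1''),
               ISet ''k'' (INum 0) (IAdd (IV ''k'') (INum 1))] (1 + 1 + 1)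
            (\<lambda>s'. ints s' ''l'' 0 = l \<and> ?I (Suc l) (iupd ''l'' 0 (Suc l) s')) s2"
          by (rule wp_ISet, rule wp_RSet, rule wp_ISet1)
            (use I agr K A bij in \<open>auto simp: ins less_Suc_eq\<close>)
      next
        assume "\<not> bval (RLess (RMul (ROf (INum 2)) (RV ''eps'')) (RV ''A1'')) s2"
        then have "l \<notin> tops Q" using A K l by (simp add: tops_def)
        then have "tops Q \<inter> {..<Suc l} = tops Q \<inter> {..<l}" by (auto simp: less_Suc_eq)
        then show "wp [] (1 + 1 + 1) (\<lambda>s'. ints s' ''l'' 0 = l \<and> ?I (Suc l) (iupd ''l'' 0 (Suc l) s')) s2"
          by (intro wp_Nil) (use I agr K in auto)
      qed
    qed simp_all
  qed
  moreover have "1 + (m * ((12 * m\<^sup>2 + ((1 + 1 + 1) + 1)) + 2) + 2) \<le> 22 * m ^ 3"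
  proof -
    have "1 + (m * ((12 * m\<^sup>2 + ((1 + 1 + 1) + 1)) + 2) + 2) = 12 * m ^ 3 + 6 * m + 3"
      by (simp add: power2_eq_square power3_eq_cube algebra_simps)
    moreover have "m \<le> m ^ 3" "1 \<le> m ^ 3" using m_pos self_le_power[of m 3] by simp_all
    ultimately show ?thesis by linarith
  qed
  ultimately show ?thesis by (rule wp_mono)
qed

lemma wp_Scale:
  assumes mm: "ints s ''m'' 0 = m" and e: "reals s ''eps'' 0 = eps" and k: "ints s ''k'' 0 = card (tops Q)"
    and post: "\<And>s'. agree {''R''} {} s s' \<Longrightarrow> scale_ok (ints s' ''R'' 0) Q \<Longrightarrow>
      (tops Q \<noteq> {} \<Longrightarrow> real (ints s' ''R'' 0) \<le> 1 / eps + 1) \<Longrightarrow> P s'"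
  shows "wp Scale (2 * (if tops Q = {} then 0 else nat \<lceil>1 / eps\<rceil>) + 3) P s"
proof (cases "tops Q = {}")
  case True
  have "wp Scale (1 + 1) P s"
    unfolding Scale_def
  proof (rule wp_Cond1)
    assume "\<not> bval (ILess (INum 0) (IV ''k'')) s"
    show "wp [ISet ''R'' (INum 0) (IV ''m'')] 1 P s"
      by (rule wp_ISet1, rule post) (use True mm m_pos in \<open>auto simp: agree_refl scale_ok_def\<close>)
  qed (use k True in simp)
  then show ?thesis by (rule wp_mono) simp_all
next
  case False
  then have kpos: "0 < ints s ''k'' 0" using k finite_tops[of Q] by (simp add: card_gt_0_iff)
  let ?N = "nat \<lceil>1 / eps\<rceil>"
  \<comment> \<open>The second conjunct records that the previous value of \<open>R\<close> failed
    to reach \<open>1 / eps\<close>, which bounds the final one by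
    \<open>1 / eps + 1\<close>.\<close>
  let ?I = "\<lambda>s'. agree {''R''} {} s s' \<and> (0 < ints s' ''R'' 0 \<longrightarrow> (real (ints s' ''R'' 0) - 1) * eps < 1)"
  have "wp Scale ((1 + (?N * (1 + 1) + 1)) + 1) P s"
    unfolding Scale_def
  proof (rule wp_Cond1)
    show "wp ([ISet ''R'' (INum 0) (INum 0)] @ ScaleLoop) (1 + (?N * (1 + 1) + 1)) P s"
    proof (rule wp_append, rule wp_ISet1, rule wp_While[where I = ?I and \<mu> = "\<lambda>s. ?N - ints s ''R'' 0"])
      fix s1 assume I: "?I s1" and "bval (RLess (RMul (ROf (IV ''R'')) (RV ''eps'')) (ROf (INum 1))) s1"
      then have lt: "real (ints s1 ''R'' 0) * eps < 1" using e by (simp add: agreeD[OF conjunct1[OF I]])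
      then have "real (ints s1 ''R'' 0) < 1 / eps" using eps by (simp add: field_simps)
      then have "ints s1 ''R'' 0 < ?N" by linarith
      then show "wp [ISet ''R'' (INum 0) (IAdd (IV ''R'') (INum 1))] 1
          (\<lambda>s'. ?I s' \<and> ?N - ints s' ''R'' 0 < ?N - ints s1 ''R'' 0) s1"
        by (intro wp_ISet1) (use I lt in auto)
    next
      fix s1 assume I: "?I s1" and "\<not> bval (RLess (RMul (ROf (IV ''R'')) (RV ''eps'')) (ROf (INum 1))) s1"
      then have ge: "1 \<le> real (ints s1 ''R'' 0) * eps" using e by (simp add: agreeD[OF conjunct1[OF I]])
      then have R1: "1 \<le> ints s1 ''R'' 0" by (cases "ints s1 ''R'' 0") auto
      show "P s1"
      proof (rule post)
        show "agree {''R''} {} s s1" using I by blast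
        show "scale_ok (ints s1 ''R'' 0) Q" using ge R1 False by (simp add: scale_ok_def mult.commute)
        have "(real (ints s1 ''R'' 0) - 1) * eps < 1" using I R1 by simp
        then have "real (ints s1 ''R'' 0) - 1 < 1 / eps" using eps by (simp add: field_simps)
        then show "real (ints s1 ''R'' 0) \<le> 1 / eps + 1" by simp
      qed
    qed (auto simp: agree_refl)
  qed (use kpos in simp)
  then show ?thesis by (rule wp_mono) (use False in simp_all)
qed

lemma wp_Weights:
  assumes E: "ints s ''n'' 0 = n" "ints s ''q'' 0 = q" "ints s ''k'' 0 = kk" "reals s ''eps'' 0 = eps"
    and D: "\<And>i. i < n \<Longrightarrow> reals s ''D'' i = d i"
    and post: "\<And>s'. agree {''i'', ''a''} {''tau'', ''S'', ''eta''} s s' \<Longrightarrow> reals s' ''tau'' 0 = tau \<Longrightarrow>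
      (\<And>j. j < m \<Longrightarrow> reals s' ''S'' j = S j) \<Longrightarrow> reals s' ''eta'' 0 = sqrt (eps * tau / kk) \<Longrightarrow> P s'"
  shows "wp Weights (12 * m) P s"
proof -
  let ?X = "{''i'', ''a''}" and ?Y = "{''tau'', ''S'', ''eta''}"
  let ?I = "\<lambda>i s'. agree ?X ?Y s s' \<and> reals s' ''tau'' 0 = (\<Sum>l<i. d l) \<and> (\<forall>j<i * q. reals s' ''S'' j = S j)"
  let ?J = "\<lambda>i a s'. agree ?X ?Y s s' \<and> ints s' ''i'' 0 = i \<and> reals s' ''tau'' 0 = (\<Sum>l<Suc i. d l) \<and> (\<forall>j<i * q + a. reals s' ''S'' j = S j)"
  have "wp Weights (1 + ((n * ((1 + (q * (1 + 2) + 2)) + 2) + 2) + 1)) P s"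
    unfolding Weights_def
  proof (rule wp_append, rule wp_RSet1, rule wp_append, rule wp_For[where I = ?I])
    fix i s1 assume I: "?I i s1" show "ival (IV ''n'') s1 = n" using E by (simp add: agreeD[OF conjunct1[OF I]])
  next
    fix i s1 assume I: "?I i s1" and i: "i < n" "ints s1 ''i'' 0 = i"
    have D1: "reals s1 ''D'' i = d i" using D[OF i(1)] by (simp add: agreeD[OF conjunct1[OF I]])
    show "wp ([RSet ''tau'' (INum 0) (RAdd (RV ''tau'') (RArr ''D'' (IV ''i'')))]
         @ For ''a'' (IV ''q'') [RSet ''S'' (IAdd (IMul (IV ''i'') (IV ''q'')) (IV ''a'')) (RSqrt (RArr ''D'' (IV ''i'')))])
        (1 + (q * (1 + 2) + 2)) (\<lambda>s'. ints s' ''i'' 0 = i \<and> ?I (Suc i) (iupd ''i'' 0 (Suc i) s')) s1"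
    proof (rule wp_append, rule wp_RSet1, rule wp_For[where I = "?J i"])
      fix a s2 assume J: "?J i a s2" show "ival (IV ''q'') s2 = q" using E by (simp add: agreeD[OF conjunct1[OF J]])
    next
      fix a s2 assume J: "?J i a s2" and a: "a < q" "ints s2 ''a'' 0 = a"
      have E2: "ints s2 ''q'' 0 = q" "reals s2 ''D'' i = d i" using E D[OF i(1)] by (simp_all add: agreeD[OF conjunct1[OF J]])
      have "S (i * q + a) = sqrt (d i)" using block_index[OF a(1)] by (simp add: S_def)
      then show "wp [RSet ''S'' (IAdd (IMul (IV ''i'') (IV ''q'')) (IV ''a'')) (RSqrt (RArr ''D'' (IV ''i'')))] 1
          (\<lambda>s'. ints s' ''a'' 0 = a \<and> ?J i (Suc a) (iupd ''a'' 0 (Suc a) s')) s2"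
        by (intro wp_RSet1) (use J a E2 in \<open>auto simp: less_Suc_eq\<close>)
    next
      fix s2 assume "?J i q s2"
      then show "ints s2 ''i'' 0 = i \<and> ?I (Suc i) (iupd ''i'' 0 (Suc i) s2)" by (auto simp: add.commute)
    qed (use I i D1 in auto)
  next
    fix s1 assume I: "?I n s1"
    have E1: "ints s1 ''k'' 0 = kk" "reals s1 ''eps'' 0 = eps" using E by (simp_all add: agreeD[OF conjunct1[OF I]])
    show "wp [RSet ''eta'' (INum 0) (RSqrt (RDiv (RMul (RV ''eps'') (RV ''tau'')) (ROf (IV ''k''))))] 1 P s1"
      by (rule wp_RSet1, rule post) (use I E1 m in \<open>auto simp: tau_def\<close>)
  qed (simp add: agree_refl)
  moreover have "1 + ((n * ((1 + (q * (1 + 2) + 2)) + 2) + 2) + 1) \<le> 12 * m"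
  proof -
    have "1 + ((n * ((1 + (q * (1 + 2) + 2)) + 2) + 2) + 1) = 3 * m + 5 * n + 4" unfolding m by (simp add: algebra_simps)
    moreover have "n \<le> m" "1 \<le> m" using m n q by simp_all
    ultimately show ?thesis by linarith
  qed
  ultimately show ?thesis by (rule wp_mono)
qed

lemma wp_Mats:
  assumes E: "ints s ''m'' 0 = m" "ints s ''k'' 0 = kk" "kk \<le> m"
    and Mr: "\<And>i j. i < m \<Longrightarrow> j < m \<Longrightarrow> rowf m (reals s ''M'') i j = M i j"
    and idx: "bij_betw (ints s ''idx'') {..<kk} (tops Q)"
    and lam: "\<And>t. t < kk \<Longrightarrow> reals s ''lam'' t = eig Q (ints s ''idx'' t)"
    and Q: "Q = rowf m (reals s ''Q'')" and S: "\<And>j. j < m \<Longrightarrow> reals s ''S'' j = S j"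
    and post: "\<And>s'. agree {''i'', ''j'', ''t''} {''u'', ''H'', ''B''} s s' \<Longrightarrow>
      (\<And>i j. i < m \<Longrightarrow> j < m \<Longrightarrow> rowf m (reals s' ''H'') i j = H i j) \<Longrightarrow>
      (\<And>i j. i < m \<Longrightarrow> j < m \<Longrightarrow> rowf m (reals s' ''B'') i j = B Q i j) \<Longrightarrow> P s'"
  shows "wp Mats (16 * m ^ 3) P s"
proof -
  let ?X = "{''i'', ''j'', ''t''}" and ?Y = "{''u'', ''H'', ''B''}"
  let ?done = "\<lambda>i j s'. \<forall>i'<m. \<forall>j'<m. i' < i \<or> (i' = i \<and> j' < j) \<longrightarrow>
    rowf m (reals s' ''H'') i' j' = H i' j' \<and> rowf m (reals s' ''B'') i' j' = B Q i' j'"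
  let ?I = "\<lambda>i s'. agree ?X ?Y s s' \<and> ?done i 0 s'"
  let ?J = "\<lambda>i j s'. agree ?X ?Y s s' \<and> ints s' ''i'' 0 = i \<and> ?done i j s'"
  have "wp Mats (m * ((m * (((3 * kk + 3) + (1 + 1)) + 2) + 2) + 2) + 2) P s"
    unfolding Mats_def
  proof (rule wp_For[where I = ?I])
    fix i s1 assume I: "?I i s1" show "ival (IV ''m'') s1 = m" using E by (simp add: agreeD[OF conjunct1[OF I]])
  next
    fix i s1 assume I: "?I i s1" and i: "i < m" "ints s1 ''i'' 0 = i"
    show "wp (For ''j'' (IV ''m'') (SumLoop ''u'' ''t'' (IV ''k'') MatsTerm @ MatsEntry)) (m * (((3 * kk + 3) + (1 + 1)) + 2) + 2)
        (\<lambda>s'. ints s' ''i'' 0 = i \<and> ?I (Suc i) (iupd ''i'' 0 (Suc i) s')) s1"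
    proof (rule wp_For[where I = "?J i"])
      fix j s2 assume J: "?J i j s2" show "ival (IV ''m'') s2 = m" using E by (simp add: agreeD[OF conjunct1[OF J]])
    next
      fix j s2 assume J: "?J i j s2" and j: "j < m" "ints s2 ''j'' 0 = j"
      show "wp (SumLoop ''u'' ''t'' (IV ''k'') MatsTerm @ MatsEntry) ((3 * kk + 3) + (1 + 1))
         (\<lambda>s'. ints s' ''j'' 0 = j \<and> ?J i (Suc j) (iupd ''j'' 0 (Suc j) s')) s2"
      proof (rule wp_append, rule wp_SumLoop[where N = kk and
            f = "\<lambda>t. Q (ints s ''idx'' t) i * eig Q (ints s ''idx'' t) * Q (ints s ''idx'' t) j"])
        fix s3 assume a: "agree {''t''} {''u''} s2 s3"
        show "ival (IV ''k'') s3 = kk" using E by (simp add: agreeD[OF a] agreeD[OF conjunct1[OF J]])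
      next
        fix t s3 assume a: "agree {''t''} {''u''} s2 s3" and t: "ints s3 ''t'' 0 = t" "t < kk"
        show "rval MatsTerm s3 = Q (ints s ''idx'' t) i * eig Q (ints s ''idx'' t) * Q (ints s ''idx'' t) j"
          using t lam J j E by (simp add: agreeD[OF a] agreeD[OF conjunct1[OF J]]) (simp add: Q rowf_def)
      next
        fix s3 assume a: "agree {''t''} {''u''} s2 s3"
          and u: "reals s3 ''u'' 0 = (\<Sum>t<kk. Q (ints s ''idx'' t) i * eig Q (ints s ''idx'' t) * Q (ints s ''idx'' t) j)"
        have agr: "agree ?X ?Y s s3" by (rule agree_extend[OF conjunct1[OF J] a]) simp_all
        have "reals s3 ''u'' 0 = (\<Sum>l\<in>tops Q. Q l i * eig Q l * Q l j)"
          unfolding u by (rule sum.reindex_bij_betw[OF idx])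
        then have Bij: "B Q i j = S i * S j * (M i j - reals s3 ''u'' 0)" by (simp add: B_def N_def)
        have E3: "ints s3 ''m'' 0 = m" "ints s3 ''i'' 0 = i" "ints s3 ''j'' 0 = j" "reals s3 ''S'' i = S i" "reals s3 ''S'' j = S j"
            "reals s3 ''M'' (i * m + j) = M i j" "reals s3 ''H'' = reals s2 ''H''" "reals s3 ''B'' = reals s2 ''B''"
          using E j i J S Mr[of i j] by (simp_all add: agreeD[OF a] agreeD[OF conjunct1[OF J]] rowf_def)
        show "wp MatsEntry (1 + 1) (\<lambda>s'. ints s' ''j'' 0 = j \<and> ?J i (Suc j) (iupd ''j'' 0 (Suc j) s')) s3"
          by (rule wp_RSet, rule wp_RSet1)
            (use J agr E3 j i in \<open>auto simp: rowf_def flat_index_eq Bij H_def less_Suc_eq\<close>)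
      qed
    next
      fix s2 assume "?J i m s2"
      then show "ints s2 ''i'' 0 = i \<and> ?I (Suc i) (iupd ''i'' 0 (Suc i) s2)" by (auto simp: less_Suc_eq)
    qed (use I i in auto)
  next
    fix s1 assume "?I m s1" then show "P s1" by (intro post) auto
  qed (simp add: agree_refl)
  moreover have "m * ((m * (((3 * kk + 3) + (1 + 1)) + 2) + 2) + 2) + 2 \<le> 16 * m ^ 3"
  proof -
    have "m * ((m * (((3 * kk + 3) + (1 + 1)) + 2) + 2) + 2) + 2 \<le> m * ((m * (((3 * m + 3) + (1 + 1)) + 2) + 2) + 2) + 2"
      using E(3) by (intro add_le_mono mult_le_mono) auto
    also have "\<dots> = 3 * m ^ 3 + 7 * m\<^sup>2 + 4 * m + 2" by (simp add: power2_eq_square power3_eq_cube algebra_simps)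
    also have "\<dots> \<le> 16 * m ^ 3"
      using m_pos power_increasing[of 2 3 m] power_increasing[of 1 3 m] power_increasing[of 0 3 m] by simp
    finally show ?thesis .
  qed
  ultimately show ?thesis by (rule wp_mono)
qed

lemma wp_Start:
  assumes E: "ints s ''n'' 0 = n" "ints s ''q'' 0 = q" "reals s ''tau'' 0 = tau"
    and z: "reals s ''Y'' = (\<lambda>_. 0)" "ints s ''y'' = (\<lambda>_. 0)"
    and post: "\<And>s'. agree {''i'', ''y'', ''go''} {''Y'', ''best''} s s' \<Longrightarrow>
      (\<And>j. j < m \<Longrightarrow> reals s' ''Y'' j = block_vertex q (\<lambda>_. 0) j \<and> real (ints s' ''y'' j) = block_vertex q (\<lambda>_. 0) j) \<Longrightarrow>
      reals s' ''best'' 0 = - tau \<Longrightarrow> ints s' ''go'' 0 = 1 \<Longrightarrow> P s'"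
  shows "wp Start (8 * m) P s"
proof -
  let ?X = "{''i'', ''y'', ''go''}" and ?Y = "{''Y'', ''best''}"
  let ?I = "\<lambda>i s'. agree ?X ?Y s s' \<and> (\<forall>j. reals s' ''Y'' j = (if j mod q = 0 \<and> j div q < i then 1 else 0)
    \<and> ints s' ''y'' j = (if j mod q = 0 \<and> j div q < i then 1 else 0))"
  have "wp Start ((n * ((1 + 1) + 2) + 2) + (1 + 1)) P s"
    unfolding Start_def
  proof (rule wp_append, rule wp_For[where I = ?I])
    fix i s1 assume I: "?I i s1" show "ival (IV ''n'') s1 = n" using E by (simp add: agreeD[OF conjunct1[OF I]])
  next
    fix i s1 assume I: "?I i s1" and i: "i < n" "ints s1 ''i'' 0 = i"
    have E1: "ints s1 ''q'' 0 = q" using E by (simp add: agreeD[OF conjunct1[OF I]])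
    have jq: "j = i * q \<longleftrightarrow> j mod q = 0 \<and> j div q = i" for j using q by auto
    show "wp StartEntry (1 + 1)
        (\<lambda>s'. ints s' ''i'' 0 = i \<and> ?I (Suc i) (iupd ''i'' 0 (Suc i) s')) s1"
      by (rule wp_RSet, rule wp_ISet1) (use I i E1 in \<open>auto simp: jq less_Suc_eq\<close>)
  next
    fix s1 assume I: "?I n s1"
    have E1: "reals s1 ''tau'' 0 = tau" using E by (simp add: agreeD[OF conjunct1[OF I]])
    show "wp [RSet ''best'' (INum 0) (RSub (ROf (INum 0)) (RV ''tau'')), ISet ''go'' (INum 0) (INum 1)] (1 + 1) P s1"
      by (rule wp_RSet, rule wp_ISet1, rule post) (use I E1 div_q_less in \<open>auto simp: block_vertex_def\<close>)
  qed (use z in \<open>auto simp: agree_refl\<close>)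
  moreover have "(n * ((1 + 1) + 2) + 2) + (1 + 1) \<le> 8 * m"
  proof -
    have "n \<le> m" "1 \<le> m" using m n q by simp_all
    then show ?thesis by simp
  qed
  ultimately show ?thesis by (rule wp_mono)
qed

end

section \<open>Search over the net\<close>

abbreviation LinTerm :: "rexp" where
  "LinTerm \<equiv> RMul (RMul (RArr ''lam'' (IV ''t''))
       (RMul (RV ''eta'') (RSub (ROf (IArr ''v'' (IV ''t''))) (ROf (IArr ''v'' (IAdd (IV ''k'') (IV ''t'')))))))
     (at2 ''Q'' (IArr ''idx'' (IV ''t'')) (IV ''j''))"

definition Lin :: "com list" where
  "Lin = VecLoop ''b'' ''t'' (IV ''k'')
     (LinTerm)
     (RMul (RArr ''S'' (IV ''j'')) (RV ''u''))"

abbreviation StepSize :: "rexp" where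
  "StepSize \<equiv> RDiv (ROf (INum 2)) (ROf (IAdd (IV ''f'') (INum 2)))"

definition FrankWolfe :: "com list" where
  "FrankWolfe = For ''f'' (IV ''R'')
     ([RSet ''c'' (INum 0) (StepSize)]
      @ Grad ''B'' (RArr ''b'' (IV ''j'')) @ For ''i'' (IV ''n'') Update)"

text \<open>Frank-Wolfe moves all blocks by one gradient. Rounding recomputes it for every block,
  since each move must not lose anything at the point already reached.\<close>

definition Round :: "com list" where
  "Round = [RSet ''c'' (INum 0) (ROf (INum 1))] @ For ''i'' (IV ''n'') (Grad ''H'' (ROf (INum 0)) @ Update)"

text \<open>With linear part zero, the inner product of \<open>Y\<close> with its half gradient is
  the objective itself.\<close>

definition Eval :: "com list" where
  "Eval = Grad ''H'' (ROf (INum 0))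
     @ SumLoop ''val'' ''j'' (IV ''m'') (RMul (RArr ''Y'' (IV ''j'')) (RArr ''g'' (IV ''j'')))"

text \<open>After rounding, \<open>Y\<close> contains only 0 and 1 at the relevant indices, so a
  sign test converts it into the integer output.\<close>

abbreviation CopyEntry :: "com list" where
  "CopyEntry \<equiv> [Cond (RLess (ROf (INum 0)) (RArr ''Y'' (IV ''j''))) [ISet ''y'' (IV ''j'') (INum 1)] [ISet ''y'' (IV ''j'') (INum 0)]]"

definition Keep :: "com list" where
  "Keep = [Cond (RLess (RV ''best'') (RV ''val''))
     ([RSet ''best'' (INum 0) (RV ''val'')] @ For ''j'' (IV ''m'')
        CopyEntry) []]"

abbreviation OdoTest :: "bexp" where
  "OdoTest \<equiv> BAnd (ILess (IV ''j'') (IMul (INum 2) (IV ''k''))) (BNot (ILess (IV ''sum'') (IMul (IV ''k'') (IV ''R''))))"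

abbreviation OdoStep :: "com list" where
  "OdoStep \<equiv> [Cond (ILess (IV ''j'') (IMul (INum 2) (IV ''k'')))
     [ISet ''v'' (IV ''j'') (IAdd (IArr ''v'' (IV ''j'')) (INum 1)),
      ISet ''sum'' (INum 0) (IAdd (IV ''sum'') (INum 1))]
     [ISet ''go'' (INum 0) (INum 0)]]"

text \<open>During the resets \<open>sum\<close> is the sum of the coordinates from \<open>j\<close>
  on, which is also the total of the modified \<open>v\<close>. Thus one loop finds the position for
  \<open>odo_next\<close> and keeps the total; running past the end clears
  \<open>go\<close>.\<close>

definition Odo :: "com list" where
  "Odo = [ISet ''j'' (INum 0) (INum 0)]
     @ [While (OdoTest)
          [ISet ''sum'' (INum 0) (ISub (IV ''sum'') (IArr ''v'' (IV ''j''))),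
           ISet ''v'' (IV ''j'') (INum 0),
           ISet ''j'' (INum 0) (IAdd (IV ''j'') (INum 1))]]
     @ OdoStep"

definition Net :: "com list" where
  "Net = [While (ILess (INum 0) (IV ''go'')) (Lin @ FrankWolfe @ Round @ Eval @ Keep @ Odo)]"

lemma feas_cong: "(\<And>j. j < n * q \<Longrightarrow> y j = y' j) \<Longrightarrow> feas n q y = feas n q y'"
  unfolding feas_def using block_index_less by simp

lemma maximizes_cong: "(\<And>a. a < q \<Longrightarrow> g (i * q + a) = g' (i * q + a)) \<Longrightarrow> maximizes q i g a = maximizes q i g' a"
  unfolding maximizes_def by auto

text \<open>Polymorphic, because it describes both the real iterate \<open>Y\<close> and the integer
  output \<open>y\<close>.\<close>

definition block_onehot :: "nat \<Rightarrow> (nat \<Rightarrow> 'a::zero_neq_one) \<Rightarrow> nat \<Rightarrow> bool" where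
  "block_onehot q f i \<longleftrightarrow> (\<exists>a<q. \<forall>a'<q. f (i * q + a') = (if a' = a then 1 else 0))"

lemma (in symmetric_form) lq_cong:
  "(\<And>j. j < m \<Longrightarrow> b j = b' j) \<Longrightarrow> (\<And>j. j < m \<Longrightarrow> y j = y' j) \<Longrightarrow> lq b y = lq b' y'"
  unfolding lq_def using bil_cong[of y y' y y'] by simp

lemma (in symmetric_form) bil_self_cong: "(\<And>j. j < m \<Longrightarrow> y j = y' j) \<Longrightarrow> bil y y = bil y' y'"
  by (rule bil_cong)

context block_form
begin

text \<open>Everything that the search reads but never writes, in one predicate that frame
  conditions carry along, together with the facts about \<open>Q\<close> and \<open>R\<close> needed
  for the analysis.\<close>

definition env :: "state \<Rightarrow> (nat \<Rightarrow> nat \<Rightarrow> real) \<Rightarrow> nat \<Rightarrow> nat \<Rightarrow> bool" where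
  "env s Q kk R \<longleftrightarrow> ints s ''n'' 0 = n \<and> ints s ''q'' 0 = q \<and> ints s ''m'' 0 = m \<and> ints s ''k'' 0 = kk \<and> ints s ''R'' 0 = R \<and>
     bij_betw (ints s ''idx'') {..<kk} (tops Q) \<and> (\<forall>t<kk. reals s ''lam'' t = eig Q (ints s ''idx'' t)) \<and>
     (\<forall>j<m. \<forall>i<m. rowf m (reals s ''Q'') j i = Q j i) \<and> (\<forall>j<m. reals s ''S'' j = S j) \<and>
     reals s ''eta'' 0 = sqrt (eps * tau / kk) \<and>
     (\<forall>i<m. \<forall>j<m. rowf m (reals s ''H'') i j = H i j) \<and> (\<forall>i<m. \<forall>j<m. rowf m (reals s ''B'') i j = B Q i j) \<and>
     kk \<le> m \<and> good Q \<and> scale_ok R Q"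

lemma env_agree:
  assumes "agree X Y s s'" "env s Q kk R"
    "{''n'', ''q'', ''m'', ''k'', ''R'', ''idx''} \<inter> X = {}" "{''lam'', ''Q'', ''S'', ''eta'', ''H'', ''B''} \<inter> Y = {}"
  shows "env s' Q kk R"
proof -
  have "ints s' x = ints s x" if "x \<in> {''n'', ''q'', ''m'', ''k'', ''R'', ''idx''}" for x
    using agreeD(1)[OF assms(1), of x] assms(3) that by blast
  moreover have "reals s' x = reals s x" if "x \<in> {''lam'', ''Q'', ''S'', ''eta'', ''H'', ''B''}" for x
    using agreeD(2)[OF assms(1), of x] assms(4) that by blast
  ultimately show ?thesis using assms(2) unfolding env_def by simp
qed

lemma wp_Lin:
  assumes env: "env s Q kk R"
    and post: "\<And>s'. agree {''j'', ''t''} {''u'', ''b''} s s' \<Longrightarrow>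
      (\<And>j. j < m \<Longrightarrow> reals s' ''b'' j = lin Q (ints s ''idx'') kk
        (\<lambda>t. sqrt (eps * tau / kk) * (real (ints s ''v'' t) - real (ints s ''v'' (kk + t)))) j) \<Longrightarrow> P s'"
  shows "wp Lin (12 * m\<^sup>2) P s"
proof -
  let ?\<zeta> = "\<lambda>t. sqrt (eps * tau / kk) * (real (ints s ''v'' t) - real (ints s ''v'' (kk + t)))"
  have E: "ints s ''m'' 0 = m" "ints s ''k'' 0 = kk" "kk \<le> m" "reals s ''eta'' 0 = sqrt (eps * tau / kk)"
    using env by (auto simp: env_def)
  have idx: "ints s ''idx'' t < m" if "t < kk" for t
  proof -
    have "ints s ''idx'' t \<in> tops Q" using env that by (auto simp: env_def bij_betw_def)
    then show ?thesis by (simp add: tops_def)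
  qed
  show ?thesis unfolding Lin_def
  proof (rule wp_VecLoop[OF E(1) m_pos E(3),
        where F = "\<lambda>j t. eig Q (ints s ''idx'' t) * ?\<zeta> t * Q (ints s ''idx'' t) j" and h = "lin Q (ints s ''idx'') kk ?\<zeta>"])
    fix s' assume a: "agree {''j'', ''t''} {''u'', ''b''} s s'"
    show "ival (IV ''k'') s' = kk" using E by (simp add: agreeD[OF a])
  next
    fix j t s' assume a: "agree {''j'', ''t''} {''u'', ''b''} s s'" and jt: "ints s' ''j'' 0 = j" "ints s' ''t'' 0 = t" "j < m" "t < kk"
    have "reals s ''lam'' t = eig Q (ints s ''idx'' t)" "reals s ''Q'' (ints s ''idx'' t * m + j) = Q (ints s ''idx'' t) j"
      using env jt idx by (auto simp: env_def rowf_def)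
    then show "rval (LinTerm) s' = eig Q (ints s ''idx'' t) * ?\<zeta> t * Q (ints s ''idx'' t) j"
      using jt E by (simp add: agreeD[OF a])
  next
    fix j s' assume a: "agree {''j'', ''t''} {''u'', ''b''} s s'" and j: "ints s' ''j'' 0 = j" "j < m"
      and u: "reals s' ''u'' 0 = (\<Sum>t<kk. eig Q (ints s ''idx'' t) * ?\<zeta> t * Q (ints s ''idx'' t) j)"
    have "reals s ''S'' j = S j" using env j by (auto simp: env_def)
    then show "rval (RMul (RArr ''S'' (IV ''j'')) (RV ''u'')) s' = lin Q (ints s ''idx'') kk ?\<zeta> j"
      using j u by (simp add: agreeD[OF a] lin_def)
  qed (use post in auto)
qed

text \<open>Blocks are disjoint and \<open>g\<close> is left alone, so the successive updates amount
  to one Frank-Wolfe step towards a vertex.\<close>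

lemma wp_UpdateAll:
  assumes E: "ints s ''n'' 0 = n" "ints s ''q'' 0 = q"
    and post: "\<And>s' sel. agree {''i'', ''a'', ''sel''} {''Y''} s s' \<Longrightarrow>
      (\<And>i. i < n \<Longrightarrow> maximizes q i (reals s ''g'') (sel i)) \<Longrightarrow>
      (\<And>j. j < m \<Longrightarrow> reals s' ''Y'' j = (1 - reals s ''c'' 0) * reals s ''Y'' j + reals s ''c'' 0 * block_vertex q sel j) \<Longrightarrow> P s'"
  shows "wp (For ''i'' (IV ''n'') Update) (n * (13 * q + 2) + 2) P s"
proof -
  let ?c = "reals s ''c'' 0" and ?Y = "reals s ''Y''"
  let ?I = "\<lambda>i s'. agree {''i'', ''a'', ''sel''} {''Y''} s s' \<and> (\<exists>sel. (\<forall>i'<i. maximizes q i' (reals s ''g'') (sel i')) \<and>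
     reals s' ''Y'' = (\<lambda>j. if j div q < i then (1 - ?c) * ?Y j + ?c * block_vertex q sel j else ?Y j))"
  show ?thesis
  proof (rule wp_For[where I = ?I])
    fix i s1 assume I: "?I i s1" show "ival (IV ''n'') s1 = n" using E by (simp add: agreeD[OF conjunct1[OF I]])
  next
    fix i s1 assume I: "?I i s1" and i: "i < n" "ints s1 ''i'' 0 = i"
    have E1: "ints s1 ''q'' 0 = q" "reals s1 ''g'' = reals s ''g''" "reals s1 ''c'' 0 = ?c"
      using E by (simp_all add: agreeD[OF conjunct1[OF I]])
    obtain sel where sel: "\<And>i'. i' < i \<Longrightarrow> maximizes q i' (reals s ''g'') (sel i')"
      and Y1: "reals s1 ''Y'' = (\<lambda>j. if j div q < i then (1 - ?c) * ?Y j + ?c * block_vertex q sel j else ?Y j)"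
      using I by blast
    show "wp Update (13 * q) (\<lambda>s'. ints s' ''i'' 0 = i \<and> ?I (Suc i) (iupd ''i'' 0 (Suc i) s')) s1"
    proof (rule wp_Update[OF i(2) E1(1) q])
      fix s2 a assume a2: "agree {''a'', ''sel''} {''Y''} s1 s2" and mx: "maximizes q i (reals s1 ''g'') a"
        and Y2: "reals s2 ''Y'' = block_update q i (reals s1 ''c'' 0) a (reals s1 ''Y'')"
      have agr: "agree {''i'', ''a'', ''sel''} {''Y''} s s2" by (rule agree_extend[OF conjunct1[OF I] a2]) simp_all
      have Yeq: "reals s2 ''Y'' = (\<lambda>j. if j div q < Suc i then (1 - ?c) * ?Y j + ?c * block_vertex q (sel(i := a)) j else ?Y j)"
        unfolding Y2 Y1 E1(3) by (intro ext) (auto simp: block_update_def block_vertex_def)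
      have mxs: "\<forall>i'<Suc i. maximizes q i' (reals s ''g'') ((sel(i := a)) i')"
        using sel mx E1(2) by (auto simp: less_Suc_eq)
      show "ints s2 ''i'' 0 = i \<and> ?I (Suc i) (iupd ''i'' 0 (Suc i) s2)"
      proof (intro conjI exI[of _ "sel(i := a)"])
        show "ints s2 ''i'' 0 = i" using i by (simp add: agreeD[OF a2])
        show "agree {''i'', ''a'', ''sel''} {''Y''} s (iupd ''i'' 0 (Suc i) s2)" using agr by simp
      qed (use mxs Yeq in simp_all)
    qed
  next
    fix s1 assume "?I n s1"
    then show "P s1" using div_q_less by (elim conjE exE) (rule post, auto)
  qed (auto simp: agree_refl)
qed

lemma wp_FrankWolfe:
  assumes env: "env s Q kk R" and y: "feas n q (reals s ''Y'')"
    and post: "\<And>s'. agree {''f'', ''j'', ''l'', ''i'', ''a'', ''sel''} {''c'', ''u'', ''g'', ''Y''} s s' \<Longrightarrow>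
      feas n q (reals s' ''Y'') \<Longrightarrow>
      (\<And>z. feas n q z \<Longrightarrow> B.lq Q (reals s ''b'') z - B.lq Q (reals s ''b'') (reals s' ''Y'') \<le> 30 * (eps * tau)) \<Longrightarrow> P s'"
  shows "wp FrankWolfe (34 * R * m\<^sup>2) P s"
proof -
  let ?X = "{''f'', ''j'', ''l'', ''i'', ''a'', ''sel''}" and ?Y = "{''c'', ''u'', ''g'', ''Y''}"
  let ?b = "reals s ''b''"
  \<comment> \<open>The program does not know the comparison point, so the invariant covers all
    feasible \<open>z\<close> at once.\<close>
  let ?I = "\<lambda>t s'. agree ?X ?Y s s' \<and> feas n q (reals s' ''Y'') \<and> (\<forall>z. feas n q z \<longrightarrow> fw_inv Q ?b z R t (reals s' ''Y''))"
  have gq: "good Q" "scale_ok R Q" using env by (auto simp: env_def)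
  have "wp FrankWolfe (R * ((1 + (12 * m\<^sup>2 + (n * (13 * q + 2) + 2))) + 2) + 2) P s"
    unfolding FrankWolfe_def
  proof (rule wp_For[where I = ?I])
    fix t s1 assume I: "?I t s1"
    have "env s1 Q kk R" by (rule env_agree[OF conjunct1[OF I] env]) auto
    then show "ival (IV ''R'') s1 = R" by (simp add: env_def)
  next
    fix t s1 assume I: "?I t s1" and t: "t < R" "ints s1 ''f'' 0 = t"
    define s2 where "s2 = rupd ''c'' 0 (2 / (real t + 2)) s1"
    have agr2: "agree ?X ?Y s s2" using I by (simp add: s2_def)
    have env2: "env s2 Q kk R" by (rule env_agree[OF agr2 env]) auto
    have E2: "ints s2 ''m'' 0 = m" "ints s2 ''n'' 0 = n" "ints s2 ''q'' 0 = q" using env2 by (auto simp: env_def)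
    have b2: "reals s2 ''b'' = ?b" by (simp add: agreeD[OF agr2])
    show "wp ([RSet ''c'' (INum 0) (StepSize)]
      @ Grad ''B'' (RArr ''b'' (IV ''j'')) @ For ''i'' (IV ''n'') Update) (1 + (12 * m\<^sup>2 + (n * (13 * q + 2) + 2)))
      (\<lambda>s'. ints s' ''f'' 0 = t \<and> ?I (Suc t) (iupd ''f'' 0 (Suc t) s')) s1"
    proof (rule wp_append, rule wp_RSet1, rule wp_append)
      have "rupd ''c'' (ival (INum 0) s1) (rval (StepSize) s1) s1 = s2"
        using t by (simp add: s2_def add.commute)
      moreover have "wp (Grad ''B'' (RArr ''b'' (IV ''j''))) (12 * m\<^sup>2) (wp (For ''i'' (IV ''n'') Update) (n * (13 * q + 2) + 2)
         (\<lambda>s'. ints s' ''f'' 0 = t \<and> ?I (Suc t) (iupd ''f'' 0 (Suc t) s'))) s2"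
      proof (rule wp_Grad[OF E2(1) m_pos, where b = ?b])
        fix j s' assume a: "agree {''j'', ''l''} {''u'', ''g''} s2 s'" and j: "ints s' ''j'' 0 = j"
        show "rval (RArr ''b'' (IV ''j'')) s' = ?b j" using j b2 by (simp add: agreeD[OF a])
      next
        fix s3 assume a3: "agree {''j'', ''l''} {''u'', ''g''} s2 s3"
          and g: "\<And>j. j < m \<Longrightarrow> reals s3 ''g'' j = (\<Sum>l<m. reals s2 ''B'' (j * m + l) * reals s2 ''Y'' l) + ?b j"
        have g3: "reals s3 ''g'' j = B.grad Q ?b (reals s1 ''Y'') j" if "j < m" for j
          using g[OF that] env2 that by (simp add: B.grad_def env_def rowf_def s2_def)
        have E3: "ints s3 ''n'' 0 = n" "ints s3 ''q'' 0 = q" "reals s3 ''Y'' = reals s1 ''Y''" "reals s3 ''c'' 0 = 2 / (real t + 2)"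
            "ints s3 ''f'' 0 = t"
          using E2 t by (simp_all add: agreeD[OF a3] s2_def)
        have agr3: "agree ?X ?Y s s3" by (rule agree_extend[OF agr2 a3]) simp_all
        show "wp (For ''i'' (IV ''n'') Update) (n * (13 * q + 2) + 2)
         (\<lambda>s'. ints s' ''f'' 0 = t \<and> ?I (Suc t) (iupd ''f'' 0 (Suc t) s')) s3"
        proof (rule wp_UpdateAll[OF E3(1,2)])
          fix s4 sel assume a4: "agree {''i'', ''a'', ''sel''} {''Y''} s3 s4"
            and mx: "\<And>i. i < n \<Longrightarrow> maximizes q i (reals s3 ''g'') (sel i)"
            and Y4: "\<And>j. j < m \<Longrightarrow> reals s4 ''Y'' j = (1 - reals s3 ''c'' 0) * reals s3 ''Y'' j + reals s3 ''c'' 0 * block_vertex q sel j"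
          let ?y = "reals s1 ''Y''" and ?c = "2 / (real t + 2)"
          let ?y' = "\<lambda>j. (1 - ?c) * ?y j + ?c * block_vertex q sel j"
          have mx': "maximizes q i (B.grad Q ?b ?y) (sel i)" if "i < n" for i
            using mx[OF that] g3 block_index_less[OF that] m
              maximizes_cong[of q "reals s3 ''g''" i "B.grad Q ?b ?y"] by simp
          have Yeq: "reals s4 ''Y'' j = ?y' j" if "j < m" for j using Y4[OF that] E3 by simp
          have "feas n q (block_vertex q sel)" using mx' by (intro feas_block_vertex) (auto simp: maximizes_def)
          then have "feas n q ?y'" using I by (intro feas_convex) auto
          then have f4: "feas n q (reals s4 ''Y'')" using feas_cong[of n q "reals s4 ''Y''" ?y'] Yeq m by simp
          have inv4: "fw_inv Q ?b z R (Suc t) (reals s4 ''Y'')" if z: "feas n q z" for z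
          proof -
            have "fw_inv Q ?b z R (Suc t) ?y'"
              by (rule fw_inv_step[OF gq(1) z gq(2)]) (use I z mx' in auto)
            then show ?thesis unfolding fw_inv_def using B.lq_cong[of ?b ?b "reals s4 ''Y''" ?y' Q] Yeq by simp
          qed
          have agr4: "agree ?X ?Y s s4" by (rule agree_extend[OF agr3 a4]) simp_all
          show "ints s4 ''f'' 0 = t \<and> ?I (Suc t) (iupd ''f'' 0 (Suc t) s4)"
            using agr4 f4 inv4 E3(5) by (simp add: agreeD[OF a4])
        qed
      qed simp_all
      ultimately show "wp (Grad ''B'' (RArr ''b'' (IV ''j''))) (12 * m\<^sup>2) (wp (For ''i'' (IV ''n'') Update) (n * (13 * q + 2) + 2)
         (\<lambda>s'. ints s' ''f'' 0 = t \<and> ?I (Suc t) (iupd ''f'' 0 (Suc t) s')))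
         (rupd ''c'' (ival (INum 0) s1) (rval (StepSize) s1) s1)" by simp
    qed
  next
    fix s1 assume "?I R s1"
    then show "P s1" using fw_inv_final[OF _ gq(2)] by (intro post) auto
  qed (use y in \<open>auto simp: agree_refl fw_inv_def\<close>)
  moreover have "R * ((1 + (12 * m\<^sup>2 + (n * (13 * q + 2) + 2))) + 2) + 2 \<le> 34 * R * m\<^sup>2"
  proof -
    have "n * (13 * q + 2) = 13 * m + 2 * n" using m by (simp add: algebra_simps)
    moreover have "n \<le> m\<^sup>2" "m \<le> m\<^sup>2" "1 \<le> m\<^sup>2" using m n q by (simp_all add: power2_eq_square)
    ultimately have "(1 + (12 * m\<^sup>2 + (n * (13 * q + 2) + 2))) + 2 \<le> 32 * m\<^sup>2" by linarith
    then have "R * ((1 + (12 * m\<^sup>2 + (n * (13 * q + 2) + 2))) + 2) \<le> R * (32 * m\<^sup>2)" by (rule mult_le_mono2)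
    moreover have "1 * 1 \<le> R * m\<^sup>2" using gq(2) m_pos by (intro mult_le_mono) (auto simp: scale_ok_def)
    moreover have "R * (32 * m\<^sup>2) = 32 * (R * m\<^sup>2)" "34 * R * m\<^sup>2 = 34 * (R * m\<^sup>2)" by simp_all
    ultimately show ?thesis by linarith
  qed
  ultimately show ?thesis by (rule wp_mono)
qed

lemma H_blk: "i < m \<Longrightarrow> j < m \<Longrightarrow> i div q = j div q \<Longrightarrow> H i j = 0"
  by (simp add: H_def blk)

lemma wp_GradH:
  assumes env: "env s Q kk R"
    and post: "\<And>s'. agree {''j'', ''l''} {''u'', ''g''} s s' \<Longrightarrow>
      (\<And>j. j < m \<Longrightarrow> reals s' ''g'' j = H.grad (\<lambda>_. 0) (reals s ''Y'') j) \<Longrightarrow> P s'"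
  shows "wp (Grad ''H'' (ROf (INum 0))) (12 * m\<^sup>2) P s"
proof (rule wp_Grad[OF _ m_pos, where b = "\<lambda>_. 0"])
  fix s' assume a: "agree {''j'', ''l''} {''u'', ''g''} s s'"
    and g: "\<And>j. j < m \<Longrightarrow> reals s' ''g'' j = (\<Sum>l<m. reals s ''H'' (j * m + l) * reals s ''Y'' l) + 0"
  show "P s'" by (rule post[OF a]) (use g env in \<open>simp add: H.grad_def env_def rowf_def\<close>)
qed (use env in \<open>auto simp: env_def\<close>)

lemma wp_Round:
  assumes env: "env s Q kk R" and y: "feas n q (reals s ''Y'')"
    and post: "\<And>s'. agree {''i'', ''j'', ''l'', ''a'', ''sel''} {''c'', ''u'', ''g'', ''Y''} s s' \<Longrightarrow>
      feas n q (reals s' ''Y'') \<Longrightarrow> (\<And>i. i < n \<Longrightarrow> block_onehot q (reals s' ''Y'') i) \<Longrightarrow>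
      H.bil (reals s ''Y'') (reals s ''Y'') \<le> H.bil (reals s' ''Y'') (reals s' ''Y'') \<Longrightarrow> P s'"
  shows "wp Round (30 * m ^ 3) P s"
proof -
  let ?X = "{''i'', ''j'', ''l'', ''a'', ''sel''}" and ?Y = "{''c'', ''u'', ''g'', ''Y''}"
  let ?I = "\<lambda>i s'. agree ?X ?Y s s' \<and> reals s' ''c'' 0 = 1 \<and> feas n q (reals s' ''Y'') \<and> (\<forall>i'<i. block_onehot q (reals s' ''Y'') i') \<and>
    H.bil (reals s ''Y'') (reals s ''Y'') \<le> H.bil (reals s' ''Y'') (reals s' ''Y'')"
  have "wp Round (1 + (n * ((12 * m\<^sup>2 + 13 * q) + 2) + 2)) P s"
    unfolding Round_def
  proof (rule wp_append, rule wp_RSet1, rule wp_For[where I = ?I])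
    fix i s1 assume I: "?I i s1"
    have "env s1 Q kk R" by (rule env_agree[OF conjunct1[OF I] env]) auto
    then show "ival (IV ''n'') s1 = n" by (simp add: env_def)
  next
    fix i s1 assume I: "?I i s1" and i: "i < n" "ints s1 ''i'' 0 = i"
    have env1: "env s1 Q kk R" by (rule env_agree[OF conjunct1[OF I] env]) auto
    show "wp (Grad ''H'' (ROf (INum 0)) @ Update) (12 * m\<^sup>2 + 13 * q)
        (\<lambda>s'. ints s' ''i'' 0 = i \<and> ?I (Suc i) (iupd ''i'' 0 (Suc i) s')) s1"
    proof (rule wp_append, rule wp_GradH[OF env1])
      fix s2 assume a2: "agree {''j'', ''l''} {''u'', ''g''} s1 s2"
        and g2: "\<And>j. j < m \<Longrightarrow> reals s2 ''g'' j = H.grad (\<lambda>_. 0) (reals s1 ''Y'') j"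
      have E2: "ints s2 ''i'' 0 = i" "ints s2 ''q'' 0 = q" "reals s2 ''Y'' = reals s1 ''Y''" "reals s2 ''c'' 0 = 1"
        using env1 i I by (simp_all add: agreeD[OF a2] env_def)
      have agr2: "agree ?X ?Y s s2" by (rule agree_extend[OF conjunct1[OF I] a2]) simp_all
      show "wp Update (13 * q) (\<lambda>s'. ints s' ''i'' 0 = i \<and> ?I (Suc i) (iupd ''i'' 0 (Suc i) s')) s2"
      proof (rule wp_Update[OF E2(1,2) q])
        fix s3 a assume a3: "agree {''a'', ''sel''} {''Y''} s2 s3" and mx: "maximizes q i (reals s2 ''g'') a"
          and Y3: "reals s3 ''Y'' = block_update q i (reals s2 ''c'' 0) a (reals s2 ''Y'')"
        have Y3': "reals s3 ''Y'' = block_update q i 1 a (reals s1 ''Y'')" using Y3 E2 by simp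
        have mx': "maximizes q i (H.grad (\<lambda>_. 0) (reals s1 ''Y'')) a"
          using mx g2 block_index_less[OF i(1)] m
            maximizes_cong[of q "reals s2 ''g''" i "H.grad (\<lambda>_. 0) (reals s1 ''Y'')"] by simp
        have aq: "a < q" using mx by (simp add: maximizes_def)
        have "H.bil (reals s1 ''Y'') (reals s1 ''Y'') \<le> H.bil (reals s3 ''Y'') (reals s3 ''Y'')"
          unfolding Y3' by (rule H.block_rounding[OF m H_blk _ i(1) mx']) (use I in auto)
        moreover have "feas n q (reals s3 ''Y'')"
          unfolding Y3' by (rule feas_block_update[OF _ aq]) (use I in auto)
        \<comment> \<open>An update leaves the other blocks alone, so vertices once reached
          persist.\<close>
        moreover have "block_onehot q (reals s3 ''Y'') i'" if "i' < Suc i" for i'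
        proof (cases "i' = i")
          case True
          then show ?thesis unfolding Y3' block_onehot_def using aq
            by (intro exI[of _ a]) (simp add: block_update_def block_index)
        next
          case False
          then have "block_onehot q (reals s1 ''Y'') i'" using I that by simp
          then show ?thesis unfolding Y3' block_onehot_def using False by (simp add: block_update_def block_index)
        qed
        moreover have "agree ?X ?Y s s3" by (rule agree_extend[OF agr2 a3]) simp_all
        ultimately show "ints s3 ''i'' 0 = i \<and> ?I (Suc i) (iupd ''i'' 0 (Suc i) s3)"
          using E2 I by (simp add: agreeD[OF a3])
      qed
    qed
  next
    fix s1 assume "?I n s1" then show "P s1" by (intro post) auto
  qed (use y in \<open>auto simp: agree_refl\<close>)
  moreover have "1 + (n * ((12 * m\<^sup>2 + 13 * q) + 2) + 2) \<le> 30 * m ^ 3"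
  proof -
    have "n * m\<^sup>2 \<le> m * m\<^sup>2" using m q by (intro mult_le_mono1) simp
    then have "n * m\<^sup>2 \<le> m ^ 3" by (simp add: power2_eq_square power3_eq_cube)
    moreover have "n * ((12 * m\<^sup>2 + 13 * q) + 2) = 12 * (n * m\<^sup>2) + 13 * m + 2 * n" using m by (simp add: algebra_simps)
    moreover have "m \<le> m ^ 3" "1 \<le> m ^ 3" using m_pos self_le_power[of m 3] by simp_all
    moreover have "n \<le> m" using m q by simp
    ultimately show ?thesis by linarith
  qed
  ultimately show ?thesis by (rule wp_mono)
qed

lemma wp_Eval:
  assumes env: "env s Q kk R"
    and post: "\<And>s'. agree {''j'', ''l''} {''u'', ''g'', ''val''} s s' \<Longrightarrow>
      reals s' ''val'' 0 = H.bil (reals s ''Y'') (reals s ''Y'') \<Longrightarrow> P s'"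
  shows "wp Eval (18 * m\<^sup>2) P s"
proof -
  have "wp Eval (12 * m\<^sup>2 + (3 * m + 3)) P s"
    unfolding Eval_def
  proof (rule wp_append, rule wp_GradH[OF env])
    fix s1 assume a1: "agree {''j'', ''l''} {''u'', ''g''} s s1"
      and g: "\<And>j. j < m \<Longrightarrow> reals s1 ''g'' j = H.grad (\<lambda>_. 0) (reals s ''Y'') j"
    show "wp (SumLoop ''val'' ''j'' (IV ''m'') (RMul (RArr ''Y'' (IV ''j'')) (RArr ''g'' (IV ''j'')))) (3 * m + 3) P s1"
    proof (rule wp_SumLoop[where f = "\<lambda>j. H.grad (\<lambda>_. 0) (reals s ''Y'') j * reals s ''Y'' j"])
      fix s2 assume a2: "agree {''j''} {''val''} s1 s2"
      show "ival (IV ''m'') s2 = m" using env by (simp add: agreeD[OF a2] agreeD[OF a1] env_def)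
    next
      fix j s2 assume a2: "agree {''j''} {''val''} s1 s2" and j: "ints s2 ''j'' 0 = j" "j < m"
      show "rval (RMul (RArr ''Y'' (IV ''j'')) (RArr ''g'' (IV ''j''))) s2 = H.grad (\<lambda>_. 0) (reals s ''Y'') j * reals s ''Y'' j"
        using j g by (simp add: agreeD[OF a2] agreeD(2)[OF a1, of "''Y''"])
    next
      fix s2 assume a2: "agree {''j''} {''val''} s1 s2"
        and v: "reals s2 ''val'' 0 = (\<Sum>j<m. H.grad (\<lambda>_. 0) (reals s ''Y'') j * reals s ''Y'' j)"
      show "P s2"
      proof (rule post)
        show "agree {''j'', ''l''} {''u'', ''g'', ''val''} s s2" by (rule agree_trans[OF a1 a2]) auto
        show "reals s2 ''val'' 0 = H.bil (reals s ''Y'') (reals s ''Y'')" unfolding v H.sum_grad by simp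
      qed
    qed
  qed
  moreover have "m \<le> m\<^sup>2" "1 \<le> m\<^sup>2" using m_pos by (simp_all add: power2_eq_square)
  then have "12 * m\<^sup>2 + (3 * m + 3) \<le> 18 * m\<^sup>2" by linarith
  ultimately show ?thesis by (rule wp_mono)
qed

lemma wp_Keep:
  assumes mm: "ints s ''m'' 0 = m"
    and post: "\<And>s'. agree {''j'', ''y''} {''best''} s s' \<Longrightarrow>
      (reals s' ''best'' 0 = reals s ''best'' 0 \<and> ints s' ''y'' = ints s ''y'' \<and> reals s ''val'' 0 \<le> reals s ''best'' 0)
      \<or> (reals s' ''best'' 0 = reals s ''val'' 0 \<and> reals s ''best'' 0 < reals s ''val'' 0
        \<and> (\<forall>j<m. ints s' ''y'' j = (if 0 < reals s ''Y'' j then 1 else 0))) \<Longrightarrow> P s'"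
  shows "wp Keep (8 * m) P s"
proof -
  let ?I = "\<lambda>i s'. agree {''j'', ''y''} {''best''} s s' \<and> reals s' ''best'' 0 = reals s ''val'' 0 \<and>
    (\<forall>j<i. ints s' ''y'' j = (if 0 < reals s ''Y'' j then 1 else 0))"
  have "wp Keep ((1 + (m * ((1 + 1) + 2) + 2)) + 1) P s"
    unfolding Keep_def
  proof (rule wp_Cond1)
    assume "bval (RLess (RV ''best'') (RV ''val'')) s"
    then have lt: "reals s ''best'' 0 < reals s ''val'' 0" by simp
    show "wp ([RSet ''best'' (INum 0) (RV ''val'')] @ For ''j'' (IV ''m'')
        CopyEntry)
        (1 + (m * ((1 + 1) + 2) + 2)) P s"
    proof (rule wp_append, rule wp_RSet1, rule wp_For[where I = ?I])
      fix i s1 assume I: "?I i s1" show "ival (IV ''m'') s1 = m" using mm by (simp add: agreeD[OF conjunct1[OF I]])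
    next
      fix i s1 assume I: "?I i s1" and i: "i < m" "ints s1 ''j'' 0 = i"
      have Y: "reals s1 ''Y'' = reals s ''Y''" by (simp add: agreeD[OF conjunct1[OF I]])
      show "wp CopyEntry
          (1 + 1) (\<lambda>s'. ints s' ''j'' 0 = i \<and> ?I (Suc i) (iupd ''j'' 0 (Suc i) s')) s1"
      proof (rule wp_Cond1)
        assume "bval (RLess (ROf (INum 0)) (RArr ''Y'' (IV ''j''))) s1"
        then show "wp [ISet ''y'' (IV ''j'') (INum 1)] 1 (\<lambda>s'. ints s' ''j'' 0 = i \<and> ?I (Suc i) (iupd ''j'' 0 (Suc i) s')) s1"
          by (intro wp_ISet1) (use I i Y in \<open>auto simp: less_Suc_eq\<close>)
      next
        assume "\<not> bval (RLess (ROf (INum 0)) (RArr ''Y'' (IV ''j''))) s1"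
        then show "wp [ISet ''y'' (IV ''j'') (INum 0)] 1 (\<lambda>s'. ints s' ''j'' 0 = i \<and> ?I (Suc i) (iupd ''j'' 0 (Suc i) s')) s1"
          by (intro wp_ISet1) (use I i Y in \<open>auto simp: less_Suc_eq\<close>)
      qed
    next
      fix s1 assume "?I m s1" then show "P s1" using lt by (intro post) auto
    qed (auto simp: agree_refl)
  next
    assume "\<not> bval (RLess (RV ''best'') (RV ''val'')) s"
    then show "wp [] (1 + (m * ((1 + 1) + 2) + 2)) P s" by (intro wp_Nil post) (auto simp: agree_refl)
  qed
  then show ?thesis by (rule wp_mono) (use m_pos in auto)
qed

lemma wp_Odo:
  assumes E: "ints s ''k'' 0 = kk" "ints s ''R'' 0 = R" and kk: "kk \<le> m"
    and v: "ints s ''v'' \<in> simplex_points (2 * kk) (kk * R)" and sm: "ints s ''sum'' 0 = (\<Sum>i<2 * kk. ints s ''v'' i)"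
    and nxt: "\<And>s' j. agree {''j'', ''v'', ''sum'', ''go''} {} s s' \<Longrightarrow> j < 2 * kk \<Longrightarrow> (\<Sum>i=j..<2 * kk. ints s ''v'' i) < kk * R \<Longrightarrow>
      (\<And>i. i < j \<Longrightarrow> (\<Sum>l=i..<2 * kk. ints s ''v'' l) = kk * R) \<Longrightarrow> ints s' ''v'' = odo_next j (ints s ''v'') \<Longrightarrow>
      ints s' ''sum'' 0 = (\<Sum>i<2 * kk. ints s' ''v'' i) \<Longrightarrow> ints s' ''go'' = ints s ''go'' \<Longrightarrow> P s'"
    and last: "\<And>s'. agree {''j'', ''v'', ''sum'', ''go''} {} s s' \<Longrightarrow> ints s' ''go'' 0 = 0 \<Longrightarrow>
      (\<And>i. i < 2 * kk \<Longrightarrow> (\<Sum>l=i..<2 * kk. ints s ''v'' l) = kk * R) \<Longrightarrow> P s'"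
  shows "wp Odo (21 * m) P s"
proof -
  let ?K = "2 * kk" and ?b = "kk * R" and ?v = "ints s ''v''"
  let ?X = "{''j'', ''v'', ''sum'', ''go''}"
  let ?I = "\<lambda>s'. agree ?X {} s s' \<and> ints s' ''go'' = ints s ''go'' \<and> ints s' ''j'' 0 \<le> ?K \<and>
     ints s' ''v'' = (\<lambda>i. if i < ints s' ''j'' 0 then 0 else ?v i) \<and>
     ints s' ''sum'' 0 = (\<Sum>i=ints s' ''j'' 0..<?K. ?v i) \<and> (\<forall>i<ints s' ''j'' 0. (\<Sum>l=i..<?K. ?v l) = ?b)"
  let ?body = "[ISet ''sum'' (INum 0) (ISub (IV ''sum'') (IArr ''v'' (IV ''j''))),
           ISet ''v'' (IV ''j'') (INum 0), ISet ''j'' (INum 0) (IAdd (IV ''j'') (INum 1))]"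
  \<comment> \<open>Suffix sums never exceed the budget, so \<open>\<not> sum < k * R\<close>
    identifies a full suffix.\<close>
  have le: "(\<Sum>l=i..<?K. ?v l) \<le> ?b" if "i \<le> ?K" for i
    using v sum_split_at[OF that, of ?v] by (simp add: simplex_points_def)
  have "wp Odo (1 + ((?K * ((1 + 1 + 1) + 1) + 1) + ((1 + 1) + 1))) P s"
    unfolding Odo_def
  proof (rule wp_append, rule wp_ISet1, rule wp_append, rule wp_While[where I = ?I and \<mu> = "\<lambda>s'. ?K - ints s' ''j'' 0"])
    fix s1 assume I: "?I s1"
      and "bval (OdoTest) s1"
    then have j: "ints s1 ''j'' 0 < ?K" and ge: "?b \<le> ints s1 ''sum'' 0"
      using E by (simp_all add: agreeD[OF conjunct1[OF I]])
    define j where "j = ints s1 ''j'' 0"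
    have jK: "j < ?K" using j by (simp add: j_def)
    have full: "(\<Sum>l=j..<?K. ?v l) = ?b" using ge I le[of j] jK by (simp add: j_def)
    have split: "(\<Sum>l=j..<?K. ?v l) = ?v j + (\<Sum>l=Suc j..<?K. ?v l)" using jK by (rule sum.atLeast_Suc_lessThan)
    show "wp ?body (1 + 1 + 1) (\<lambda>s'. ?I s' \<and> ?K - ints s' ''j'' 0 < ?K - ints s1 ''j'' 0) s1"
      by (rule wp_ISet, rule wp_ISet, rule wp_ISet1)
        (use I full split jK in \<open>auto simp: j_def[symmetric] less_Suc_eq fun_eq_iff\<close>)
  next
    fix s1 assume I: "?I s1"
      and nb: "\<not> bval (OdoTest) s1"
    have E1: "ints s1 ''k'' 0 = kk" "ints s1 ''R'' 0 = R" using E by (simp_all add: agreeD[OF conjunct1[OF I]])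
    define j where "j = ints s1 ''j'' 0"
    show "wp OdoStep ((1 + 1) + 1) P s1"
    proof (rule wp_Cond1)
      assume "bval (ILess (IV ''j'') (IMul (INum 2) (IV ''k''))) s1"
      then have jK: "j < ?K" using E1 by (simp add: j_def)
      have lt: "(\<Sum>i=j..<?K. ?v i) < ?b" using nb jK I E1 by (simp add: j_def)
      have odo: "(\<lambda>i. if i < j then 0 else ?v i)(j := Suc (?v j)) = odo_next j ?v"
        by (auto simp: odo_next_def fun_eq_iff)
      have osum: "(\<Sum>i<?K. odo_next j ?v i) = Suc (\<Sum>i=j..<?K. ?v i)"
      proof -
        have "(\<Sum>i<?K. odo_next j ?v i) = (\<Sum>i<j. odo_next j ?v i) + (\<Sum>i=j..<?K. odo_next j ?v i)"
          using jK by (intro sum_split_at) simp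
        moreover have "(\<Sum>i<j. odo_next j ?v i) = 0" by (simp add: odo_next_def)
        moreover have "(\<Sum>i=j..<?K. odo_next j ?v i) = Suc (\<Sum>i=j..<?K. ?v i)"
          using jK by (simp add: sum.atLeast_Suc_lessThan odo_next_def)
        ultimately show ?thesis by simp
      qed
      show "wp [ISet ''v'' (IV ''j'') (IAdd (IArr ''v'' (IV ''j'')) (INum 1)),
           ISet ''sum'' (INum 0) (IAdd (IV ''sum'') (INum 1))] (1 + 1) P s1"
        by (rule wp_ISet, rule wp_ISet1, rule nxt[of _ j])
          (use I jK lt odo osum in \<open>auto simp: j_def[symmetric]\<close>)
    next
      assume "\<not> bval (ILess (IV ''j'') (IMul (INum 2) (IV ''k''))) s1"
      then have jK: "j = ?K" using E1 I by (simp add: j_def)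
      have "wp [ISet ''go'' (INum 0) (INum 0)] 1 P s1"
        by (rule wp_ISet1, rule last) (use I jK in \<open>auto simp: j_def[symmetric]\<close>)
      then show "wp [ISet ''go'' (INum 0) (INum 0)] (1 + 1) P s1" by (rule wp_mono) simp_all
    qed
  qed (use sm in \<open>auto simp: agree_refl lessThan_atLeast0\<close>)
  then show ?thesis by (rule wp_mono) (use kk m_pos in auto)
qed

lemma wp_Net:
  assumes env: "env s0 Q kk R" and y0: "feas n q (reals s0 ''Y'')"
    and oh: "\<And>i. i < n \<Longrightarrow> block_onehot q (ints s0 ''y'') i"
    and best0: "reals s0 ''best'' 0 \<le> H.bil (\<lambda>j. real (ints s0 ''y'' j)) (\<lambda>j. real (ints s0 ''y'' j))"
    and v0: "ints s0 ''v'' = (\<lambda>_. 0)" "ints s0 ''sum'' 0 = 0" "ints s0 ''go'' 0 = 1" and z: "feas n q z"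
    and post: "\<And>s'. (\<And>i. i < n \<Longrightarrow> block_onehot q (ints s' ''y'') i) \<Longrightarrow>
      H.bil z z - 31 * (eps * tau) \<le> H.bil (\<lambda>j. real (ints s' ''y'' j)) (\<lambda>j. real (ints s' ''y'' j)) \<Longrightarrow> P s'"
  shows "wp Net (card (simplex_points (2 * kk) (kk * R)) * (130 * R * m ^ 3)) P s0"
proof -
  let ?K = "2 * kk" and ?b = "kk * R"
  let ?XS = "simplex_points ?K ?b"
  let ?X = "{''j'', ''l'', ''t'', ''f'', ''i'', ''a'', ''sel'', ''v'', ''sum'', ''go'', ''y''}"
  let ?Y = "{''u'', ''b'', ''c'', ''g'', ''Y'', ''val'', ''best''}"
  let ?idx = "ints s0 ''idx''"
  let ?\<eta> = "sqrt (eps * tau / kk)"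
  let ?target = "H.bil z z - 31 * (eps * tau)"
  let ?yv = "\<lambda>s. \<lambda>j. real (ints s ''y'' j)"
  have gq: "good Q" "scale_ok R Q" "kk \<le> m" "bij_betw ?idx {..<kk} (tops Q)" using env by (auto simp: env_def)
  \<comment> \<open>The net point near the projection of \<open>z\<close>. It is unknown to the
    program and occurs only in the invariant.\<close>
  obtain vs where vs0: "\<forall>i\<ge>?K. vs i = 0" "(\<Sum>i<?K. vs i) \<le> ?b" and
    near: "(\<Sum>t<kk. eig Q (?idx t) * (xi Q (\<lambda>j. S j * z j) (?idx t) - ?\<eta> * (real (vs t) - real (vs (kk + t))))\<^sup>2) \<le> eps * tau"
    using net_point_exists[OF gq(1,4,2) z] by blast
  have vs: "vs \<in> ?XS" using vs0 by (simp add: simplex_points_def)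
  \<comment> \<open>Once the enumeration has passed \<open>vs\<close>, \<open>best\<close> has
    reached the target. \<open>best\<close> is a lower bound for the value of \<open>y\<close> and
    not always equal to it, because it starts at \<open>- tau\<close>.\<close>
  let ?I = "\<lambda>s. agree ?X ?Y s0 s \<and> feas n q (reals s ''Y'') \<and> (\<forall>i<n. block_onehot q (ints s ''y'') i) \<and>
    reals s ''best'' 0 \<le> H.bil (?yv s) (?yv s) \<and>
    (if ints s ''go'' 0 = 0 then ?target \<le> reals s ''best'' 0
     else ints s ''v'' \<in> ?XS \<and> ints s ''sum'' 0 = (\<Sum>i<?K. ints s ''v'' i) \<and> (colex ?K vs (ints s ''v'') \<longrightarrow> ?target \<le> reals s ''best'' 0))"
  \<comment> \<open>The points still ahead, plus one for the current point.\<close>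
  let ?\<mu> = "\<lambda>s. if ints s ''go'' 0 = 0 then 0 else Suc (card {w \<in> ?XS. colex ?K (ints s ''v'') w})"
  let ?T = "12 * m\<^sup>2 + (34 * R * m\<^sup>2 + (30 * m ^ 3 + (18 * m\<^sup>2 + (8 * m + 21 * m))))"
  have body: "wp (Lin @ FrankWolfe @ Round @ Eval @ Keep @ Odo) ?T (\<lambda>s'. ?I s' \<and> ?\<mu> s' < ?\<mu> s) s"
    if I: "?I s" and go: "0 < ints s ''go'' 0" for s
  proof -
    have env1: "env s Q kk R" by (rule env_agree[OF conjunct1[OF I] env]) auto
    have idx: "ints s ''idx'' = ?idx" by (simp add: agreeD[OF conjunct1[OF I]])
    let ?v = "ints s ''v''"
    have v: "?v \<in> ?XS" "ints s ''sum'' 0 = (\<Sum>i<?K. ?v i)" "colex ?K vs ?v \<Longrightarrow> ?target \<le> reals s ''best'' 0"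
      using I go by auto
    let ?\<zeta> = "\<lambda>t. ?\<eta> * (real (?v t) - real (?v (kk + t)))"
    show ?thesis
    proof (rule wp_append, rule wp_Lin[OF env1])
      fix s1 assume a1: "agree {''j'', ''t''} {''u'', ''b''} s s1"
        and b1: "\<And>j. j < m \<Longrightarrow> reals s1 ''b'' j = lin Q (ints s ''idx'') kk ?\<zeta> j"
      have agr1: "agree ?X ?Y s0 s1" by (rule agree_extend[OF conjunct1[OF I] a1]) simp_all
      have env1: "env s1 Q kk R" by (rule env_agree[OF agr1 env]) auto
      have Y1: "feas n q (reals s1 ''Y'')" using I by (simp add: agreeD[OF a1])
      show "wp (FrankWolfe @ Round @ Eval @ Keep @ Odo) (34 * R * m\<^sup>2 + (30 * m ^ 3 + (18 * m\<^sup>2 + (8 * m + 21 * m))))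
         (\<lambda>s'. ?I s' \<and> ?\<mu> s' < ?\<mu> s) s1"
      proof (rule wp_append, rule wp_FrankWolfe[OF env1 Y1])
        fix s2 assume a2: "agree {''f'', ''j'', ''l'', ''i'', ''a'', ''sel''} {''c'', ''u'', ''g'', ''Y''} s1 s2"
          and Y2: "feas n q (reals s2 ''Y'')"
          and gap: "\<And>z. feas n q z \<Longrightarrow> B.lq Q (reals s1 ''b'') z - B.lq Q (reals s1 ''b'') (reals s2 ''Y'') \<le> 30 * (eps * tau)"
        have agr2: "agree ?X ?Y s0 s2" by (rule agree_extend[OF agr1 a2]) simp_all
        have env2: "env s2 Q kk R" by (rule env_agree[OF agr2 env]) auto
        \<comment> \<open>At \<open>v = vs\<close> the relaxation is nearly tight at
          \<open>z\<close>, so the fractional point already meets the target; rounding does not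
          decrease its value.\<close>
        have hit: "?target \<le> H.bil (reals s2 ''Y'') (reals s2 ''Y'')" if eq: "?v = vs"
        proof (rule relaxation_near_opt[OF gq(4), where \<zeta> = ?\<zeta>])
          show "(\<Sum>t<kk. eig Q (?idx t) * (xi Q (\<lambda>j. S j * z j) (?idx t) - ?\<zeta> t)\<^sup>2) \<le> eps * tau"
            using near unfolding eq .
          have "B.lq Q (reals s1 ''b'') w = B.lq Q (lin Q ?idx kk ?\<zeta>) w" for w
            by (rule B.lq_cong) (use b1 idx in auto)
          then show "B.lq Q (lin Q ?idx kk ?\<zeta>) z - B.lq Q (lin Q ?idx kk ?\<zeta>) (reals s2 ''Y'') \<le> 30 * (eps * tau)"
            using gap[OF z] by simp
        qed
        show "wp (Round @ Eval @ Keep @ Odo) (30 * m ^ 3 + (18 * m\<^sup>2 + (8 * m + 21 * m))) (\<lambda>s'. ?I s' \<and> ?\<mu> s' < ?\<mu> s) s2"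
        proof (rule wp_append, rule wp_Round[OF env2 Y2])
          fix s3 assume a3: "agree {''i'', ''j'', ''l'', ''a'', ''sel''} {''c'', ''u'', ''g'', ''Y''} s2 s3"
            and Y3: "feas n q (reals s3 ''Y'')" "\<And>i. i < n \<Longrightarrow> block_onehot q (reals s3 ''Y'') i"
            and imp: "H.bil (reals s2 ''Y'') (reals s2 ''Y'') \<le> H.bil (reals s3 ''Y'') (reals s3 ''Y'')"
          have agr3: "agree ?X ?Y s0 s3" by (rule agree_extend[OF agr2 a3]) simp_all
          have env3: "env s3 Q kk R" by (rule env_agree[OF agr3 env]) auto
          show "wp (Eval @ Keep @ Odo) (18 * m\<^sup>2 + (8 * m + 21 * m)) (\<lambda>s'. ?I s' \<and> ?\<mu> s' < ?\<mu> s) s3"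
          proof (rule wp_append, rule wp_Eval[OF env3])
            fix s4 assume a4: "agree {''j'', ''l''} {''u'', ''g'', ''val''} s3 s4"
              and val: "reals s4 ''val'' 0 = H.bil (reals s3 ''Y'') (reals s3 ''Y'')"
            have agr4: "agree ?X ?Y s0 s4" by (rule agree_extend[OF agr3 a4]) simp_all
            have env4: "env s4 Q kk R" by (rule env_agree[OF agr4 env]) auto
            have K4: "reals s4 ''best'' = reals s ''best''" "ints s4 ''y'' = ints s ''y''" "ints s4 ''v'' = ?v"
                "ints s4 ''sum'' = ints s ''sum''" "ints s4 ''go'' = ints s ''go''" "reals s4 ''Y'' = reals s3 ''Y''"
              by (simp_all add: agreeD[OF a4] agreeD[OF a3] agreeD[OF a2] agreeD[OF a1])
            show "wp (Keep @ Odo) (8 * m + 21 * m) (\<lambda>s'. ?I s' \<and> ?\<mu> s' < ?\<mu> s) s4"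
            proof (rule wp_append, rule wp_Keep)
              show "ints s4 ''m'' 0 = m" using env4 by (simp add: env_def)
              fix s5 assume a5: "agree {''j'', ''y''} {''best''} s4 s5"
                and keep: "(reals s5 ''best'' 0 = reals s4 ''best'' 0 \<and> ints s5 ''y'' = ints s4 ''y'' \<and> reals s4 ''val'' 0 \<le> reals s4 ''best'' 0)
                  \<or> (reals s5 ''best'' 0 = reals s4 ''val'' 0 \<and> reals s4 ''best'' 0 < reals s4 ''val'' 0
                    \<and> (\<forall>j<m. ints s5 ''y'' j = (if 0 < reals s4 ''Y'' j then 1 else 0)))"
              have agr5: "agree ?X ?Y s0 s5" by (rule agree_extend[OF agr4 a5]) simp_all
              have env5: "env s5 Q kk R" by (rule env_agree[OF agr5 env]) auto
              have K5: "ints s5 ''v'' = ?v" "ints s5 ''sum'' = ints s ''sum''" "ints s5 ''go'' = ints s ''go''" "reals s5 ''Y'' = reals s3 ''Y''"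
                using K4 by (simp_all add: agreeD[OF a5])
              have y5: "(\<forall>i<n. block_onehot q (ints s5 ''y'') i) \<and> reals s5 ''best'' 0 \<le> H.bil (?yv s5) (?yv s5)"
                using keep
              proof
                assume "reals s5 ''best'' 0 = reals s4 ''best'' 0 \<and> ints s5 ''y'' = ints s4 ''y'' \<and> reals s4 ''val'' 0 \<le> reals s4 ''best'' 0"
                then show ?thesis using I K4 by simp
              next
                assume k: "reals s5 ''best'' 0 = reals s4 ''val'' 0 \<and> reals s4 ''best'' 0 < reals s4 ''val'' 0
                    \<and> (\<forall>j<m. ints s5 ''y'' j = (if 0 < reals s4 ''Y'' j then 1 else 0))"
                have yb: "ints s5 ''y'' (i * q + a') = (if a' = a then 1 else 0) \<and> real (ints s5 ''y'' (i * q + a')) = reals s3 ''Y'' (i * q + a')"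
                  if "i < n" "a' < q" "\<forall>a'<q. reals s3 ''Y'' (i * q + a') = (if a' = a then 1 else 0)" for i a a'
                  using k that block_index_less[OF that(1,2)] m K4(6) by auto
                have "block_onehot q (ints s5 ''y'') i" if i: "i < n" for i
                  using Y3(2)[OF i] yb[OF i] unfolding block_onehot_def by blast
                moreover have "?yv s5 j = reals s3 ''Y'' j" if j: "j < m" for j
                proof -
                  obtain a where "\<forall>a'<q. reals s3 ''Y'' (j div q * q + a') = (if a' = a then 1 else 0)"
                    using Y3(2)[OF div_q_less[OF j]] by (auto simp: block_onehot_def)
                  from yb[OF div_q_less[OF j] mod_less_divisor[OF q, of j] this] show ?thesis by simp
                qed
                then have "H.bil (?yv s5) (?yv s5) = H.bil (reals s3 ''Y'') (reals s3 ''Y'')" by (rule H.bil_self_cong)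
                ultimately show ?thesis using k val by simp
              qed
              have best5: "?target \<le> reals s5 ''best'' 0" if "vs = ?v \<or> colex ?K vs ?v"
                using that
              proof
                assume "vs = ?v"
                then have "?target \<le> reals s4 ''val'' 0" using hit imp val by simp
                then show ?thesis using keep by auto
              next
                assume "colex ?K vs ?v"
                then show ?thesis using v(3) keep K4(1) by auto
              qed
              show "wp Odo (21 * m) (\<lambda>s'. ?I s' \<and> ?\<mu> s' < ?\<mu> s) s5"
              proof (rule wp_Odo[of _ kk R])
                show "ints s5 ''k'' 0 = kk" "ints s5 ''R'' 0 = R" "kk \<le> m" using env5 by (auto simp: env_def)
                show "ints s5 ''v'' \<in> ?XS" "ints s5 ''sum'' 0 = (\<Sum>i<?K. ints s5 ''v'' i)" using v K5 by simp_all
              next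
                fix s6 j assume a6: "agree {''j'', ''v'', ''sum'', ''go''} {} s5 s6" and j: "j < ?K"
                  "(\<Sum>i=j..<?K. ints s5 ''v'' i) < ?b" "\<And>i. i < j \<Longrightarrow> (\<Sum>l=i..<?K. ints s5 ''v'' l) = ?b"
                  and v6: "ints s6 ''v'' = odo_next j (ints s5 ''v'')" and s6: "ints s6 ''sum'' 0 = (\<Sum>i<?K. ints s6 ''v'' i)"
                  and go6: "ints s6 ''go'' = ints s5 ''go''"
                have lt: "(\<Sum>i=j..<?K. ?v i) < ?b" using j(2) K5(1) by simp
                have full: "(\<Sum>l=i..<?K. ?v l) = ?b" if "i < j" for i using j(3)[OF that] K5(1) by simp
                have od1: "ints s6 ''v'' \<in> ?XS" "colex ?K ?v (ints s6 ''v'')"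
                  unfolding v6 K5(1) using odo_next(1,2)[OF v(1) j(1) lt full] by simp_all
                have od3: "w = ?v \<or> colex ?K w ?v" if "w \<in> ?XS" "colex ?K w (ints s6 ''v'')" for w
                  by (rule odo_next(3)[OF v(1) j(1) lt full that(1)]) (use that(2) in \<open>simp_all add: v6 K5(1)\<close>)
                have agr6: "agree ?X ?Y s0 s6" by (rule agree_extend[OF agr5 a6]) simp_all
                have K6: "reals s6 ''Y'' = reals s3 ''Y''" "ints s6 ''y'' = ints s5 ''y''" "reals s6 ''best'' = reals s5 ''best''"
                  using K5 by (simp_all add: agreeD[OF a6])
                have "{w \<in> ?XS. colex ?K (ints s6 ''v'') w} \<subset> {w \<in> ?XS. colex ?K ?v w}"
                proof
                  show "{w \<in> ?XS. colex ?K (ints s6 ''v'') w} \<subseteq> {w \<in> ?XS. colex ?K ?v w}"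
                    using colex_trans[OF od1(2)] by auto
                  show "{w \<in> ?XS. colex ?K (ints s6 ''v'') w} \<noteq> {w \<in> ?XS. colex ?K ?v w}"
                    using od1(1,2) colex_irrefl[of ?K "ints s6 ''v''"] by auto
                qed
                then have "card {w \<in> ?XS. colex ?K (ints s6 ''v'') w} < card {w \<in> ?XS. colex ?K ?v w}"
                  by (intro psubset_card_mono) (simp add: finite_simplex_points)
                \<comment> \<open>No net point lies strictly between \<open>v\<close> and its
                  successor, so a \<open>vs\<close> before the successor is \<open>v\<close> itself
                  or was passed earlier.\<close>
                moreover have "colex ?K vs (ints s6 ''v'') \<longrightarrow> ?target \<le> reals s6 ''best'' 0"
                  using od3[OF vs] best5 K6 by auto
                ultimately show "?I s6 \<and> ?\<mu> s6 < ?\<mu> s"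
                  using agr6 K6 Y3 y5 go6 K5(3) go od1(1) s6 by simp
              next
                fix s6 assume a6: "agree {''j'', ''v'', ''sum'', ''go''} {} s5 s6" and go6: "ints s6 ''go'' 0 = 0"
                  and full: "\<And>i. i < ?K \<Longrightarrow> (\<Sum>l=i..<?K. ints s5 ''v'' l) = ?b"
                have "vs = ?v \<or> colex ?K vs ?v"
                  by (rule odo_last[OF v(1) _ vs]) (use full K5 in auto)
                then have "?target \<le> reals s5 ''best'' 0" by (rule best5)
                moreover have agr6: "agree ?X ?Y s0 s6" by (rule agree_extend[OF agr5 a6]) simp_all
                moreover have K6: "reals s6 ''Y'' = reals s3 ''Y''" "ints s6 ''y'' = ints s5 ''y''" "reals s6 ''best'' = reals s5 ''best''"
                  using K5 by (simp_all add: agreeD[OF a6])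
                ultimately show "?I s6 \<and> ?\<mu> s6 < ?\<mu> s" using Y3 y5 go6 go by simp
              qed
            qed
          qed
        qed
      qed
    qed
  qed
  have card1: "?\<mu> s0 \<le> card ?XS"
  proof -
    have "{w \<in> ?XS. colex ?K (ints s0 ''v'') w} \<subset> ?XS"
      using colex_irrefl[of ?K "ints s0 ''v''"] v0(1) by (auto simp: simplex_points_def)
    then have "card {w \<in> ?XS. colex ?K (ints s0 ''v'') w} < card ?XS"
      by (intro psubset_card_mono finite_simplex_points)
    then show ?thesis by simp
  qed
  have "wp Net (card ?XS * (?T + 1) + 1) P s0"
    unfolding Net_def
  proof (rule wp_While[where I = ?I and \<mu> = ?\<mu>])
    fix s assume "?I s" "bval (ILess (INum 0) (IV ''go'')) s"
    then show "wp (Lin @ FrankWolfe @ Round @ Eval @ Keep @ Odo) ?T (\<lambda>s'. ?I s' \<and> ?\<mu> s' < ?\<mu> s) s"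
      by (intro body) simp_all
  next
    fix s assume I: "?I s" and "\<not> bval (ILess (INum 0) (IV ''go'')) s"
    then have "ints s ''go'' 0 = 0" by simp
    then show "P s" using I by (intro post) auto
  next
    \<comment> \<open>The zero vector is a least point, so nothing has been passed yet.\<close>
    have "\<not> colex ?K vs (ints s0 ''v'')" unfolding v0(1) by (simp add: colex_def)
    then show "?I s0" using y0 oh best0 v0 by (simp add: agree_refl simplex_points_def)
  qed (rule card1)
  moreover have "card ?XS * (?T + 1) + 1 \<le> card ?XS * (130 * R * m ^ 3)"
  proof -
    have R: "1 \<le> R" using gq(2) by (simp add: scale_ok_def)
    have p: "m\<^sup>2 \<le> m ^ 3" "m \<le> m ^ 3" "1 \<le> m ^ 3"
      using m_pos power_increasing[of 2 3 m] power_increasing[of 1 3 m] by simp_all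
    have "1 * m ^ 3 \<le> R * m ^ 3" using R by (rule mult_le_mono1)
    then have Rm: "m ^ 3 \<le> R * m ^ 3" by (simp only: mult_1)
    have "34 * (R * m\<^sup>2) \<le> 34 * (R * m ^ 3)" using p(1) by simp
    moreover have "34 * R * m\<^sup>2 = 34 * (R * m\<^sup>2)" "130 * R * m ^ 3 = 130 * (R * m ^ 3)" by simp_all
    ultimately have "?T + 2 \<le> 130 * R * m ^ 3" using p Rm by linarith
    then have "card ?XS * (?T + 2) \<le> card ?XS * (130 * R * m ^ 3)" by (rule mult_le_mono2)
    moreover have "1 \<le> card ?XS" using card1 v0(3) by simp
    moreover have "card ?XS * (?T + 2) = card ?XS * (?T + 1) + card ?XS" by simp
    ultimately show ?thesis by linarith
  qed
  ultimately show ?thesis by (rule wp_mono)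
qed

end

section \<open>The whole program and its running time\<close>

definition prog :: "com list" where
  "prog = Init @ Jacobi @ Select @ Scale @ Weights @ Mats @ Start @ Net"

lemma one_plus_inverse_power_le: "0 < R \<Longrightarrow> ((real R + 1) / real R) ^ R \<le> 3"
proof -
  assume R: "0 < R"
  have "((real R + 1) / real R) ^ R \<le> exp (1 / real R) ^ R"
    using exp_ge_add_one_self[of "1 / real R"] R by (intro power_mono) (simp_all add: field_simps)
  also have "\<dots> = exp 1" using R by (simp flip: exp_of_nat_mult)
  also have "\<dots> \<le> 3" by (rule exp_le)
  finally show ?thesis .
qed

text \<open>The weight \<open>x = R / (R + 1)\<close> balances the two factors: its inverse to the
  power \<open>k * R\<close> is at most \<open>3^k\<close>, and \<open>1 / (1 - x)\<close> is just
  \<open>R + 1\<close>.\<close>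

lemma card_simplex_points_net:
  assumes R: "0 < R"
  shows "real (card (simplex_points (2 * k) (k * R))) \<le> (3 * (real R + 1)\<^sup>2) ^ k"
proof -
  have x: "0 < real R / (real R + 1)" "real R / (real R + 1) < 1" using R by (simp_all add: field_simps)
  have "real (card (simplex_points (2 * k) (k * R)))
      \<le> (1 / (real R / (real R + 1))) ^ (k * R) * (1 / (1 - real R / (real R + 1))) ^ (2 * k)"
    by (rule card_simplex_points[OF x])
  also have "1 - real R / (real R + 1) = 1 / (real R + 1)" using R by (simp add: field_simps)
  finally have "real (card (simplex_points (2 * k) (k * R))) \<le> (((real R + 1) / real R) ^ R) ^ k * ((real R + 1)\<^sup>2) ^ k"
    by (simp add: power_mult[symmetric] mult.commute[of k R])
  also have "\<dots> \<le> 3 ^ k * ((real R + 1)\<^sup>2) ^ k"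
    using one_plus_inverse_power_le[OF R] by (intro mult_right_mono power_mono) auto
  finally show ?thesis by (simp add: power_mult_distrib)
qed

context block_form
begin

text \<open>Diagonal entries are at most 1 in absolute value, and at most \<open>eps * m\<close> if
  \<open>k = 0\<close>. The number occurs only in the analysis, so it may depend on
  \<open>k\<close>.\<close>

definition pmax :: real where "pmax = (if k = 0 then m * (eps * m)\<^sup>2 else m)"

lemma pmax_ok: "pmax_ok pmax"
  unfolding pmax_ok_def pmax_def using pot_le pot_le_if_rank_0 by auto

lemma inv_eps_gt_1: "1 < 1 / eps" using eps by simp

lemma inv_eps_power_ge_1: "1 \<le> (1 / eps) ^ j" using inv_eps_gt_1 by (intro one_le_power) simp

lemma inv_eps_power_mono: "i \<le> j \<Longrightarrow> (1 / eps) ^ i \<le> (1 / eps) ^ j"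
  using inv_eps_gt_1 by (intro power_increasing) auto

text \<open>For \<open>k = 0\<close> the powers of \<open>eps\<close> in budget and gain cancel and
  leave \<open>m^5 / 2\<close>. Otherwise the factor \<open>(1 / eps)^2\<close> is absorbed by the
  exponent \<open>2 * k\<close>.\<close>

lemma rots_le: "real (rots pmax Q) \<le> m ^ 5 * (1 / eps) ^ (2 * k)"
proof -
  have pot0: "0 \<le> pot Q" unfolding pot_def by (intro sum_nonneg) auto
  have p0: "0 \<le> pmax" using eps by (simp add: pmax_def)
  have f: "0 \<le> (real m)\<^sup>2 / (2 * eps\<^sup>2)" using eps by simp
  have "(pmax - pot Q) * ((real m)\<^sup>2 / (2 * eps\<^sup>2)) \<le> pmax * ((real m)\<^sup>2 / (2 * eps\<^sup>2))"
    using pot0 f by (intro mult_right_mono) auto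
  also have "\<dots> \<le> m ^ 5 * (1 / eps) ^ (2 * k)"
  proof (cases "k = 0")
    case True
    have pm: "pmax = m * (eps * m)\<^sup>2" unfolding pmax_def using True by simp
    have eq: "pmax * ((real m)\<^sup>2 / (2 * eps\<^sup>2)) = real m ^ 5 / 2"
      unfolding pm using eps by (simp add: field_simps power2_eq_square eval_nat_numeral)
    have "real m ^ 5 / 2 \<le> real m ^ 5 * 1" by simp
    also have "\<dots> \<le> real m ^ 5 * (1 / eps) ^ (2 * k)" by (intro mult_left_mono inv_eps_power_ge_1) simp
    finally show ?thesis unfolding eq by simp
  next
    case False
    have "pmax * ((real m)\<^sup>2 / (2 * eps\<^sup>2)) = real m ^ 3 / 2 * (1 / eps) ^ 2"
      using False eps by (simp add: pmax_def field_simps power2_eq_square eval_nat_numeral)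
    also have "\<dots> \<le> real m ^ 5 * (1 / eps) ^ (2 * k)"
    proof (rule mult_mono)
      have "real m ^ 3 / 2 \<le> real m ^ 3" by simp
      also have "\<dots> \<le> real m ^ 5" using m_pos by (intro power_increasing) auto
      finally show "real m ^ 3 / 2 \<le> real m ^ 5" .
      show "(1 / eps) ^ 2 \<le> (1 / eps) ^ (2 * k)" using False by (intro inv_eps_power_mono) simp
    qed auto
    finally show ?thesis by simp
  qed
  finally have "(pmax - pot Q) * ((real m)\<^sup>2 / (2 * eps\<^sup>2)) \<le> m ^ 5 * (1 / eps) ^ (2 * k)" .
  moreover have "0 \<le> m ^ 5 * (1 / eps) ^ (2 * k)" using eps by simp
  ultimately show ?thesis unfolding rots_def by linarith
qed

text \<open>A diagonal entry above \<open>2 * eps\<close> is at most 1. This lets powers of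
  \<open>1 / eps\<close> absorb absolute constants.\<close>

lemma eps_lt_half: "good Q \<Longrightarrow> tops Q \<noteq> {} \<Longrightarrow> 2 < 1 / eps"
proof -
  assume Q: "good Q" and "tops Q \<noteq> {}"
  then obtain j where "j < m" "2 * eps < eig Q j" by (auto simp: tops_def)
  then have "2 * eps < 1" using eig_bound[of Q j] Q by (auto simp: good_def)
  then show ?thesis using eps by (simp add: field_simps)
qed

text \<open>With \<open>u = 1 / eps > 2\<close>, both \<open>3 \<le> u^2\<close> and
  \<open>R + 1 \<le> u^2\<close> hold, so each top direction costs
  \<open>3 * (R + 1)^2 \<le> u^6\<close> net points. The Frank-Wolfe steps contribute the remaining
  \<open>2 * k\<close> of the exponent. Without top directions there is one net point and
  \<open>R = m\<close>.\<close>

lemma net_time_le: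
  assumes Q: "good Q" and R: "scale_ok R Q" "tops Q \<noteq> {} \<Longrightarrow> real R \<le> 1 / eps + 1" and kk: "kk = card (tops Q)"
  shows "real (card (simplex_points (2 * kk) (kk * R)) * (130 * R * m ^ 3)) \<le> 130 * m ^ 4 * (1 / eps) ^ (8 * k)"
proof (cases "tops Q = {}")
  case True
  then have "kk = 0" "R = m" using kk R by (auto simp: scale_ok_def)
  then have "real (card (simplex_points (2 * kk) (kk * R)) * (130 * R * m ^ 3)) = 130 * real m ^ 4 * 1"
    by (simp add: simplex_points_0 eval_nat_numeral)
  also have "\<dots> \<le> 130 * real m ^ 4 * (1 / eps) ^ (8 * k)"
    by (intro mult_left_mono inv_eps_power_ge_1) auto
  finally show ?thesis by simp
next
  case False
  define u where "u = 1 / eps"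
  have u: "2 < u" unfolding u_def by (rule eps_lt_half[OF Q False])
  have uu: "2 * u \<le> u\<^sup>2" "4 \<le> u\<^sup>2" using u mult_mono[of 2 u 2 u] by (simp_all add: power2_eq_square)
  have Ru: "real R + 1 \<le> u\<^sup>2" using R(2)[OF False] u uu(1) by (simp add: u_def)
  have Rpos: "0 < R" using R by (simp add: scale_ok_def)
  have kkk: "kk \<le> k" using card_tops_le[OF Q] kk by simp
  have kk1: "1 \<le> kk" using False kk finite_tops[of Q] by (simp add: Suc_le_eq card_gt_0_iff)
  have "3 * (real R + 1)\<^sup>2 \<le> u\<^sup>2 * (u\<^sup>2)\<^sup>2"
    using uu(2) Ru by (intro mult_mono power_mono) auto
  also have "\<dots> = u ^ 6" by (simp flip: power_mult power_add)
  finally have "(3 * (real R + 1)\<^sup>2) ^ kk \<le> (u ^ 6) ^ kk" by (intro power_mono) auto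
  also have "\<dots> \<le> u ^ (6 * k)"
    unfolding power_mult[symmetric] using u kkk by (intro power_increasing) auto
  finally have c: "real (card (simplex_points (2 * kk) (kk * R))) \<le> u ^ (6 * k)"
    using card_simplex_points_net[OF Rpos, of kk] by linarith
  have "real R \<le> u\<^sup>2" using Ru by simp
  also have "\<dots> \<le> u ^ (2 * k)" using u kk1 kkk by (intro power_increasing) auto
  finally have r: "real R \<le> u ^ (2 * k)" .
  have "real (card (simplex_points (2 * kk) (kk * R)) * (130 * R * m ^ 3))
      = (real (card (simplex_points (2 * kk) (kk * R))) * real R) * (130 * real m ^ 3)" by simp
  also have "\<dots> \<le> (u ^ (6 * k) * u ^ (2 * k)) * (130 * real m ^ 4)"
    using c r u m_pos by (intro mult_mono) (auto intro!: power_increasing)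
  also have "\<dots> = 130 * m ^ 4 * u ^ (8 * k)" by (simp flip: power_add)
  finally show ?thesis by (simp add: u_def)
qed

text \<open>Counting up to \<open>1 / eps\<close> happens only if there is a top direction, and then
  \<open>k \<ge> 1\<close> pays for it.\<close>

lemma scale_time_le:
  assumes Q: "good Q"
  shows "real (2 * (if tops Q = {} then 0 else nat \<lceil>1 / eps\<rceil>) + 3) \<le> 7 * (1 / eps) ^ k"
proof (cases "tops Q = {}")
  case True
  then show ?thesis using inv_eps_power_ge_1[of k] by simp
next
  case False
  have "0 < card (tops Q)" using False finite_tops by (simp add: card_gt_0_iff)
  then have "1 \<le> k" using card_tops_le[OF Q] by linarith
  then have "(1 / eps) ^ 1 \<le> (1 / eps) ^ k" by (rule inv_eps_power_mono)
  then have pow: "1 / eps \<le> (1 / eps) ^ k" by (simp only: power_one_right)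
  have "real (nat \<lceil>1 / eps\<rceil>) \<le> 1 / eps + 1" using inv_eps_gt_1 by linarith
  then have "2 * real (nat \<lceil>1 / eps\<rceil>) + 3 \<le> 7 * (1 / eps) ^ k" using pow inv_eps_gt_1 by linarith
  then show ?thesis using False by (simp only: if_False of_nat_add of_nat_mult of_nat_numeral)
qed

lemma wp_prog:
  assumes E: "ints s ''n'' 0 = n" "ints s ''q'' 0 = q" "reals s ''eps'' 0 = eps"
    and D: "\<And>i. i < n \<Longrightarrow> reals s ''D'' i = d i"
    and Mr: "\<And>i j. i < m \<Longrightarrow> j < m \<Longrightarrow> rowf m (reals s ''M'') i j = M i j"
    and Z: "reals s ''Q'' = (\<lambda>_. 0)" "reals s ''Y'' = (\<lambda>_. 0)" "ints s ''y'' = (\<lambda>_. 0)" "ints s ''v'' = (\<lambda>_. 0)"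
      "ints s ''sum'' 0 = 0"
    and z: "feas n q z"
  shows "\<exists>T. real T \<le> 601 * real m ^ 9 * (1 / eps) ^ (8 * k) \<and>
    wp prog T (\<lambda>s'. (\<forall>i<n. block_onehot q (ints s' ''y'') i) \<and>
      H.bil z z - 31 * (eps * tau) \<le> H.bil (\<lambda>j. real (ints s' ''y'' j)) (\<lambda>j. real (ints s' ''y'' j))) s"
proof -
  \<comment> \<open>The true costs depend on the basis that the run produces. These budgets depend
    on \<open>m\<close>, \<open>eps\<close> and \<open>k\<close> only, so they can be fixed
    beforehand.\<close>
  define TJ where "TJ = nat \<lfloor>400 * real m ^ 9 * (1 / eps) ^ (2 * k)\<rfloor>"
  define TS where "TS = nat \<lfloor>7 * (1 / eps) ^ k\<rfloor>"
  define TN where "TN = nat \<lfloor>130 * real m ^ 4 * (1 / eps) ^ (8 * k)\<rfloor>"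
  let ?G = "\<lambda>s'. (\<forall>i<n. block_onehot q (ints s' ''y'') i) \<and>
      H.bil z z - 31 * (eps * tau) \<le> H.bil (\<lambda>j. real (ints s' ''y'' j)) (\<lambda>j. real (ints s' ''y'' j))"
  let ?T = "6 * m + (TJ + (22 * m ^ 3 + (TS + (12 * m + (16 * m ^ 3 + (8 * m + TN))))))"
  have "wp prog ?T ?G s"
    unfolding prog_def
  proof (rule wp_append, rule wp_Init[OF E(1,2) m m_pos Z(1)])
    fix s1 assume a1: "agree {''m'', ''i''} {''Q''} s s1" and m1: "ints s1 ''m'' 0 = m"
      and Q1: "\<And>j i. j < m \<Longrightarrow> i < m \<Longrightarrow> rowf m (reals s1 ''Q'') j i = (if i = j then 1 else 0)"
    let ?Q1 = "rowf m (reals s1 ''Q'')"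
    have orth1: "orth ?Q1"
      unfolding orth_def
    proof (intro allI impI)
      fix i l assume il: "i < m" "l < m"
      have "(\<Sum>j<m. ?Q1 j i * ?Q1 j l) = (\<Sum>j<m. if j = i then (if i = l then 1 else 0) else 0)"
        using il by (intro sum.cong refl) (auto simp: Q1)
      then show "(\<Sum>j<m. ?Q1 j i * ?Q1 j l) = (if i = l then 1 else 0)" using il by simp
    qed
    \<comment> \<open>For the standard basis these are the diagonal entries of \<open>M\<close>,
      which lie in the vanishing blocks.\<close>
    have "eig ?Q1 j = 0" if j: "j < m" for j
    proof -
      have "?Q1 j i * M i l * ?Q1 j l = 0" if "i < m" "l < m" for i l
        using that j blk[of j j] by (simp add: Q1)
      then show ?thesis unfolding bil_def by (intro sum.neutral ballI) auto
    qed
    then have tr1: "tr ?Q1 = 0" by (simp add: tr_def)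
    have Mr1: "rowf m (reals s1 ''M'') i j = M i j" if "i < m" "j < m" for i j using Mr[OF that] by (simp add: agreeD[OF a1])
    have e1: "reals s1 ''eps'' 0 = eps" using E by (simp add: agreeD[OF a1])
    have "real ((rots pmax ?Q1 + 1) * (200 * m ^ 4)) \<le> 400 * real m ^ 9 * (1 / eps) ^ (2 * k)"
    proof -
      have one: "1 * 1 \<le> real m ^ 5 * (1 / eps) ^ (2 * k)"
        using m_pos eps by (intro mult_mono inv_eps_power_ge_1) auto
      have "real (rots pmax ?Q1) + 1 \<le> 2 * (real m ^ 5 * (1 / eps) ^ (2 * k))" using rots_le[of ?Q1] one by simp
      then have "(real (rots pmax ?Q1) + 1) * (200 * real m ^ 4) \<le> 2 * (real m ^ 5 * (1 / eps) ^ (2 * k)) * (200 * real m ^ 4)"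
        by (rule mult_right_mono) simp
      also have "\<dots> = 400 * (real m ^ 5 * real m ^ 4) * (1 / eps) ^ (2 * k)" by simp
      also have "real m ^ 5 * real m ^ 4 = real m ^ 9" by (simp flip: power_add)
      finally show ?thesis by (simp only: of_nat_mult of_nat_add of_nat_1 of_nat_numeral of_nat_power)
    qed
    then have tj: "(rots pmax ?Q1 + 1) * (200 * m ^ 4) \<le> TJ" unfolding TJ_def by (rule le_nat_floor)
    show "wp (Jacobi @ Select @ Scale @ Weights @ Mats @ Start @ Net)
      (TJ + (22 * m ^ 3 + (TS + (12 * m + (16 * m ^ 3 + (8 * m + TN)))))) ?G s1"
    proof (rule wp_append, rule wp_mono[OF _ tj], rule wp_Jacobi[OF m1 e1 Mr1 orth1 tr1 pmax_ok,
          where P = "wp (Select @ Scale @ Weights @ Mats @ Start @ Net)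
            (22 * m ^ 3 + (TS + (12 * m + (16 * m ^ 3 + (8 * m + TN))))) ?G"])
      fix s2 assume a2: "agree {''p'', ''r'', ''i'', ''j''} {''A1'', ''A2'', ''A3'', ''u'', ''th'', ''c'', ''s'', ''Q''} s1 s2"
        and good: "good (rowf m (reals s2 ''Q''))"
      define Q where "Q = rowf m (reals s2 ''Q'')"
      have good: "good Q" using good by (simp add: Q_def)
      have E2: "ints s2 ''m'' 0 = m" "reals s2 ''eps'' 0 = eps" using m1 e1 by (simp_all add: agreeD[OF a2])
      have Mr2: "rowf m (reals s2 ''M'') i j = M i j" if "i < m" "j < m" for i j using Mr1[OF that] by (simp add: agreeD[OF a2])
      show "wp (Select @ Scale @ Weights @ Mats @ Start @ Net) (22 * m ^ 3 + (TS + (12 * m + (16 * m ^ 3 + (8 * m + TN))))) ?G s2"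
      proof (rule wp_append, rule wp_Select[OF E2 Mr2, folded Q_def])
        fix s3 assume a3: "agree {''k'', ''l'', ''i'', ''j'', ''idx''} {''u'', ''A1'', ''lam''} s2 s3"
          and idx3: "bij_betw (ints s3 ''idx'') {..<ints s3 ''k'' 0} (tops Q)"
          and lam3: "\<And>t. t < ints s3 ''k'' 0 \<Longrightarrow> reals s3 ''lam'' t = eig Q (ints s3 ''idx'' t)"
        define kk where "kk = ints s3 ''k'' 0"
        have kk: "kk = card (tops Q)" using bij_betw_same_card[OF idx3] by (simp add: kk_def)
        have E3: "ints s3 ''m'' 0 = m" "reals s3 ''eps'' 0 = eps" using E2 by (simp_all add: agreeD[OF a3])
        have "card (tops Q) \<le> card {..<m}" by (rule card_mono) (auto simp: tops_def)
        then have kkm: "kk \<le> m" using kk by simp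
        have ts: "2 * (if tops Q = {} then 0 else nat \<lceil>1 / eps\<rceil>) + 3 \<le> TS"
          unfolding TS_def by (rule le_nat_floor[OF scale_time_le[OF good]])
        show "wp (Scale @ Weights @ Mats @ Start @ Net) (TS + (12 * m + (16 * m ^ 3 + (8 * m + TN)))) ?G s3"
        proof (rule wp_append, rule wp_mono[OF _ ts], rule wp_Scale[OF E3,
              where P = "wp (Weights @ Mats @ Start @ Net) (12 * m + (16 * m ^ 3 + (8 * m + TN))) ?G"])
          show "ints s3 ''k'' 0 = card (tops Q)" using kk by (simp add: kk_def)
          fix s4 assume a4: "agree {''R''} {} s3 s4" and R4: "scale_ok (ints s4 ''R'' 0) Q"
            "tops Q \<noteq> {} \<Longrightarrow> real (ints s4 ''R'' 0) \<le> 1 / eps + 1"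
          define R where "R = ints s4 ''R'' 0"
          note AD4 = agreeD[OF a4] agreeD[OF a3] agreeD[OF a2] agreeD[OF a1]
          have E4: "ints s4 ''n'' 0 = n" "ints s4 ''q'' 0 = q" "ints s4 ''k'' 0 = kk" "reals s4 ''eps'' 0 = eps"
            using E by (simp_all add: AD4 kk_def)
          have D4: "reals s4 ''D'' i = d i" if "i < n" for i using D[OF that] by (simp add: AD4)
          show "wp (Weights @ Mats @ Start @ Net) (12 * m + (16 * m ^ 3 + (8 * m + TN))) ?G s4"
          proof (rule wp_append, rule wp_Weights[OF E4 D4])
            fix s5 assume a5: "agree {''i'', ''a''} {''tau'', ''S'', ''eta''} s4 s5" and tau5: "reals s5 ''tau'' 0 = tau"
              and S5: "\<And>j. j < m \<Longrightarrow> reals s5 ''S'' j = S j" and eta5: "reals s5 ''eta'' 0 = sqrt (eps * tau / kk)"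
            note AD5 = agreeD[OF a5] AD4
            have E5: "ints s5 ''m'' 0 = m" "ints s5 ''k'' 0 = kk" using E3 E4 by (simp_all add: agreeD[OF a5] agreeD[OF a4])
            have Mr5: "rowf m (reals s5 ''M'') i j = M i j" if "i < m" "j < m" for i j using Mr[OF that] by (simp add: AD5)
            have idx5: "bij_betw (ints s5 ''idx'') {..<kk} (tops Q)" using idx3 by (simp add: agreeD[OF a5] agreeD[OF a4] kk_def)
            have lam5: "reals s5 ''lam'' t = eig Q (ints s5 ''idx'' t)" if "t < kk" for t
              using lam3 that by (simp add: agreeD[OF a5] agreeD[OF a4] kk_def)
            have Q5: "Q = rowf m (reals s5 ''Q'')" by (simp add: Q_def agreeD[OF a5] agreeD[OF a4] agreeD[OF a3])
            show "wp (Mats @ Start @ Net) (16 * m ^ 3 + (8 * m + TN)) ?G s5"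
            proof (rule wp_append, rule wp_Mats[OF E5 kkm Mr5 idx5 lam5 Q5 S5])
              fix s6 assume a6: "agree {''i'', ''j'', ''t''} {''u'', ''H'', ''B''} s5 s6"
                and H6: "\<And>i j. i < m \<Longrightarrow> j < m \<Longrightarrow> rowf m (reals s6 ''H'') i j = H i j"
                and B6: "\<And>i j. i < m \<Longrightarrow> j < m \<Longrightarrow> rowf m (reals s6 ''B'') i j = B Q i j"
              note AD6 = agreeD[OF a6] AD5
              have E6: "ints s6 ''n'' 0 = n" "ints s6 ''q'' 0 = q" "reals s6 ''tau'' 0 = tau"
                using E tau5 by (simp_all add: agreeD[OF a6] AD5)
              have Z6: "reals s6 ''Y'' = (\<lambda>_. 0)" "ints s6 ''y'' = (\<lambda>_. 0)" using Z by (simp_all add: AD6)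
              show "wp (Start @ Net) (8 * m + TN) ?G s6"
              proof (rule wp_append, rule wp_Start[OF E6 Z6])
                fix s7 assume a7: "agree {''i'', ''y'', ''go''} {''Y'', ''best''} s6 s7"
                  and Y7: "\<And>j. j < m \<Longrightarrow> reals s7 ''Y'' j = block_vertex q (\<lambda>_. 0) j \<and> real (ints s7 ''y'' j) = block_vertex q (\<lambda>_. 0) j"
                  and best7: "reals s7 ''best'' 0 = - tau" and go7: "ints s7 ''go'' 0 = 1"
                note AD7 = agreeD[OF a7] AD6
                have env7: "env s7 Q kk R"
                  unfolding env_def
                  using E6 E5 idx5 lam5 Q5 S5 eta5 H6 B6 kkm good R4(1)
                  by (simp add: agreeD[OF a7] agreeD[OF a6] R_def agreeD[OF a5])
                have fv: "feas n q (block_vertex q (\<lambda>_. 0))" using q by (intro feas_block_vertex)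
                have fY: "feas n q (reals s7 ''Y'')"
                  using feas_cong[of n q "reals s7 ''Y''" "block_vertex q (\<lambda>_. 0)"] Y7 fv m by simp
                have fy: "feas n q (\<lambda>j. real (ints s7 ''y'' j))"
                  using feas_cong[of n q "\<lambda>j. real (ints s7 ''y'' j)" "block_vertex q (\<lambda>_. 0)"] Y7 fv m by simp
                have oh: "block_onehot q (ints s7 ''y'') i" if i: "i < n" for i
                  unfolding block_onehot_def
                proof (intro exI[of _ 0] conjI allI impI)
                  fix a' assume a': "a' < q"
                  have "i * q + a' < m" using block_index_less[OF i a'] m by simp
                  from Y7[OF this] show "ints s7 ''y'' (i * q + a') = (if a' = 0 then 1 else 0)"
                    using block_index[OF a', of i] by (auto simp: block_vertex_def split: if_splits)
                qed (use q in simp)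
                \<comment> \<open>The norm bound limits the absolute value of the objective by the
                  squared norm of the scaled vector, which is at most \<open>tau\<close>.\<close>
                have b7: "reals s7 ''best'' 0 \<le> H.bil (\<lambda>j. real (ints s7 ''y'' j)) (\<lambda>j. real (ints s7 ''y'' j))"
                  using norm[of "\<lambda>j. S j * real (ints s7 ''y'' j)"] scaled_norm_le[OF fy] unfolding H_bil best7 by linarith
                have v7: "ints s7 ''v'' = (\<lambda>_. 0)" "ints s7 ''sum'' 0 = 0" using Z by (simp_all add: AD7)
                have "real (card (simplex_points (2 * kk) (kk * R)) * (130 * R * m ^ 3)) \<le> 130 * m ^ 4 * (1 / eps) ^ (8 * k)"
                  by (rule net_time_le[OF good _ _ kk]) (use R4 in \<open>simp_all add: R_def\<close>)
                then have tn: "card (simplex_points (2 * kk) (kk * R)) * (130 * R * m ^ 3) \<le> TN"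
                  unfolding TN_def by (intro le_nat_floor) (simp only: of_nat_mult of_nat_power of_nat_numeral)
                show "wp Net TN ?G s7"
                  by (rule wp_mono[OF wp_Net[OF env7 fY oh b7 v7 go7 z, where P = ?G] tn]) auto
              qed
            qed
          qed
        qed auto
      qed
    qed auto
  qed
  moreover have "real ?T \<le> 601 * real m ^ 9 * (1 / eps) ^ (8 * k)"
  proof -
    let ?z = "real m ^ 9 * (1 / eps) ^ (8 * k)"
    have mz: "real m ^ i * (1 / eps) ^ j \<le> ?z" if "i \<le> 9" "j \<le> 8 * k" for i j
      using that m_pos eps by (intro mult_mono inv_eps_power_mono power_increasing) auto
    have 1: "real m \<le> ?z" "real m ^ 3 \<le> ?z" "(1 / eps) ^ k \<le> ?z" using mz[of 1 0] mz[of 3 0] mz[of 0 k] by simp_all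
    have x: "0 \<le> 400 * real m ^ 9 * (1 / eps) ^ (2 * k)" "0 \<le> 7 * (1 / eps) ^ k" "0 \<le> 130 * real m ^ 4 * (1 / eps) ^ (8 * k)"
      using eps by simp_all
    have "real TJ \<le> 400 * (real m ^ 9 * (1 / eps) ^ (2 * k))" "real TS \<le> 7 * (1 / eps) ^ k" "real TN \<le> 130 * (real m ^ 4 * (1 / eps) ^ (8 * k))"
      unfolding TJ_def TS_def TN_def
      using of_nat_floor[OF x(1)] of_nat_floor[OF x(2)] of_nat_floor[OF x(3)] by (simp_all only: mult.assoc)
    \<comment> \<open>The coefficients 26, 38, 400, 7 and 130 add up to 601.\<close>
    moreover have "real ?T = 26 * real m + 38 * real m ^ 3 + real TJ + real TS + real TN" by simp
    moreover note 1 mz[of 9 "2 * k"] mz[of 4 "8 * k"]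
    ultimately have "real ?T \<le> 601 * ?z" by simp
    then show ?thesis by simp
  qed
  ultimately show ?thesis by blast
qed

end

section \<open>The instance given by matrices\<close>

text \<open>Cauchy-Schwarz for the normalized vector and its image, whose norm is at most 1.\<close>

lemma op_norm_form_bound:
  assumes M: "M \<in> carrier_mat m m" and op: "op_norm M \<le> 1"
  shows "\<bar>\<Sum>i<m. \<Sum>j<m. x i * M $$ (i, j) * x j\<bar> \<le> (\<Sum>i<m. (x i)\<^sup>2)"
proof -
  let ?Mv = "\<lambda>w i. \<Sum>j<m. M $$ (i, j) * w j"
  have n2: "vec_norm2 (Matrix.vec m w) = sqrt (\<Sum>i<m. (w i)\<^sup>2)" for w
    by (simp add: vec_norm2_def scalar_prod_def power2_eq_square lessThan_atLeast0)
  have Mv: "M *\<^sub>v Matrix.vec m w = Matrix.vec m (?Mv w)" for w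
    using M by (intro eq_vecI) (auto simp: scalar_prod_def lessThan_atLeast0)
  let ?ball = "{v \<in> carrier_vec (dim_col M). vec_norm2 v \<le> 1}"
  have vecE: "v = Matrix.vec m (vec_index v)" if "v \<in> carrier_vec m" for v :: "real Matrix.vec"
    using that by (intro eq_vecI) auto
  \<comment> \<open>A supremum of reals says something about the members only for a set bounded
    above; a crude entrywise bound is enough here.\<close>
  have bdd: "bdd_above ((\<lambda>v. vec_norm2 (M *\<^sub>v v)) ` ?ball)"
  proof (rule bdd_aboveI2)
    fix v assume "v \<in> ?ball"
    then have v: "v \<in> carrier_vec m" "vec_norm2 v \<le> 1" using M by auto
    define w where "w = vec_index v"
    have vw: "v = Matrix.vec m w" unfolding w_def by (rule vecE[OF v(1)])
    have s1: "(\<Sum>i<m. (w i)\<^sup>2) \<le> 1" using v(2) unfolding vw n2 by simp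
    have w1: "\<bar>w j\<bar> \<le> 1" if "j < m" for j
    proof -
      have "(w j)\<^sup>2 \<le> (\<Sum>i<m. (w i)\<^sup>2)" by (rule member_le_sum) (use that in auto)
      then have "(w j)\<^sup>2 \<le> 1" using s1 by linarith
      then show ?thesis by (simp only: abs_square_le_1)
    qed
    have "(?Mv w i)\<^sup>2 \<le> (\<Sum>j<m. \<bar>M $$ (i, j)\<bar>)\<^sup>2" for i
    proof (rule abs_le_square_iff[THEN iffD1])
      have "\<bar>?Mv w i\<bar> \<le> (\<Sum>j<m. \<bar>M $$ (i, j) * w j\<bar>)" by (rule sum_abs)
      also have "\<dots> \<le> (\<Sum>j<m. \<bar>M $$ (i, j)\<bar> * 1)"
        using w1 by (intro sum_mono) (auto simp: abs_mult intro!: mult_left_le)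
      finally show "\<bar>?Mv w i\<bar> \<le> \<bar>\<Sum>j<m. \<bar>M $$ (i, j)\<bar>\<bar>" by (simp add: sum_nonneg)
    qed
    then show "vec_norm2 (M *\<^sub>v v) \<le> sqrt (\<Sum>i<m. (\<Sum>j<m. \<bar>M $$ (i, j)\<bar>)\<^sup>2)"
      unfolding vw Mv n2 by (intro real_sqrt_le_mono sum_mono)
  qed
  have ball: "vec_norm2 (M *\<^sub>v v) \<le> 1" if "v \<in> ?ball" for v
    using op cSUP_upper[OF that bdd] unfolding op_norm_def by (rule order_trans[rotated])
  define s where "s = (\<Sum>i<m. (x i)\<^sup>2)"
  have s0: "0 \<le> s" unfolding s_def by (intro sum_nonneg) auto
  show ?thesis
  proof (cases "s = 0")
    case True
    then have "x i = 0" if "i < m" for i using that unfolding s_def by (subst (asm) sum_nonneg_eq_0_iff) auto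
    then show ?thesis by (simp add: sum_nonneg)
  next
    case False
    then have sp: "0 < s" using s0 by simp
    define w where "w i = x i / sqrt s" for i
    have xw: "x i = sqrt s * w i" for i using sp by (simp add: w_def)
    have w1: "(\<Sum>i<m. (w i)\<^sup>2) = 1"
      using sp by (simp add: w_def power_divide s_def[symmetric] flip: sum_divide_distrib)
    have "vec_norm2 (M *\<^sub>v Matrix.vec m w) \<le> 1"
      by (rule ball) (use M w1 in \<open>simp add: n2\<close>)
    then have Mw: "(\<Sum>i<m. (?Mv w i)\<^sup>2) \<le> 1" unfolding Mv n2 by simp
    have "(\<Sum>i<m. w i * ?Mv w i)\<^sup>2 \<le> (\<Sum>i<m. (w i)\<^sup>2) * (\<Sum>i<m. (?Mv w i)\<^sup>2)"
      by (rule Cauchy_Schwarz_ineq_sum)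
    also have "\<dots> \<le> 1" using w1 Mw by simp
    finally have cs: "\<bar>\<Sum>i<m. w i * ?Mv w i\<bar> \<le> 1" by (simp add: abs_square_le_1)
    have "(\<Sum>i<m. \<Sum>j<m. x i * M $$ (i, j) * x j) = (\<Sum>i<m. \<Sum>j<m. s * (w i * (M $$ (i, j) * w j)))"
      unfolding xw using s0 by (intro sum.cong refl) (simp add: mult_ac)
    also have "\<dots> = s * (\<Sum>i<m. w i * ?Mv w i)" by (simp only: sum_distrib_left)
    finally have "\<bar>\<Sum>i<m. \<Sum>j<m. x i * M $$ (i, j) * x j\<bar> = s * \<bar>\<Sum>i<m. w i * ?Mv w i\<bar>"
      using s0 by (simp only: abs_mult abs_of_nonneg)
    also have "\<dots> \<le> s * 1" using cs s0 by (rule mult_left_mono)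
    finally show ?thesis by (simp add: s_def)
  qed
qed

text \<open>The position of an entry in a submatrix is the number of smaller selected indices, which
  for consecutive indices is the offset in the block and thus below \<open>q\<close>.\<close>

lemma zero_block_entry:
  assumes M: "M \<in> carrier_mat (n * q) (n * q)"
    and blocks: "\<forall>i<n. submatrix M {i * q..<(i + 1) * q} {i * q..<(i + 1) * q} = 0\<^sub>m q q"
    and ij: "i < n * q" "j < n * q" "i div q = j div q"
  shows "M $$ (i, j) = 0"
proof -
  define b where "b = i div q"
  have q: "0 < q" using ij(1) by (cases q) auto
  have b: "b < n" using ij(1) by (simp add: b_def less_mult_imp_div_less)
  let ?I = "{b * q..<(b + 1) * q}"
  have in_blk: "l \<in> ?I" if "l div q = b" for l
    using that q div_mult_mod_eq[of l q] mod_less_divisor[OF q, of l] by (auto simp: algebra_simps)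
  have iI: "i \<in> ?I" "j \<in> ?I" using in_blk ij(3) by (auto simp: b_def)
  have cnt: "card {a \<in> ?I. a < l} < q" if "l \<in> ?I" for l
  proof -
    have l: "b * q \<le> l" "l < b * q + q" using that by simp_all
    have "{a \<in> ?I. a < l} = {b * q..<l}" using l by auto
    then have "card {a \<in> ?I. a < l} = l - b * q" by (simp only: card_atLeastLessThan)
    then show ?thesis using l by linarith
  qed
  have "M $$ (i, j) = submatrix M ?I ?I $$ (card {a \<in> ?I. a < i}, card {a \<in> ?I. a < j})"
    using M ij iI by (intro submatrix_index_card[symmetric]) auto
  also have "submatrix M ?I ?I = 0\<^sub>m q q" using blocks b by simp
  finally show ?thesis using cnt[OF iI(1)] cnt[OF iI(2)] by simp
qed

lemma kron_one_diagonal: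
  assumes D: "D \<in> carrier_mat n n" "diagonal_mat D" and q: "0 < q"
  defines "E \<equiv> kron D (1\<^sub>m q)"
  shows "E \<in> carrier_mat (n * q) (n * q)" "diagonal_mat E" "\<And>i. i < n * q \<Longrightarrow> E $$ (i, i) = D $$ (i div q, i div q)"
proof -
  have E: "E = Matrix.mat (n * q) (n * q) (\<lambda>(i, j). D $$ (i div q, j div q) * (1\<^sub>m q) $$ (i mod q, j mod q))"
    using D(1) by (simp add: E_def kron_def)
  show "E \<in> carrier_mat (n * q) (n * q)" by (simp add: E)
  show "E $$ (i, i) = D $$ (i div q, i div q)" if "i < n * q" for i using that q by (simp add: E)
  show "diagonal_mat E"
    unfolding diagonal_mat_def
  proof (intro allI impI)
    fix i j assume "i < dim_row E" "j < dim_col E" and ne: "i \<noteq> j"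
    then have ij: "i < n * q" "j < n * q" by (simp_all add: E)
    show "E $$ (i, j) = 0"
    proof (cases "i div q = j div q")
      case True
      then have "i mod q \<noteq> j mod q" using ne by (metis div_mult_mod_eq)
      then show ?thesis using ij q by (simp add: E)
    next
      case False
      have "i div q < n" "j div q < n" using ij by (simp_all add: less_mult_imp_div_less)
      then have "D $$ (i div q, j div q) = 0" using D False by (simp add: diagonal_mat_def)
      then show ?thesis using ij by (simp add: E)
    qed
  qed
qed

lemma scaled_quadratic_form:
  fixes f :: "nat \<Rightarrow> real"
  assumes M: "M \<in> carrier_mat m m" and y: "y \<in> carrier_vec m"
  defines "R \<equiv> Matrix.mat m m (\<lambda>(i, j). if i = j then f i else 0)"
  shows "scalar_prod y ((R * M * R) *\<^sub>v y) = (\<Sum>i<m. \<Sum>j<m. vec_index y i * (f i * f j * M $$ (i, j)) * vec_index y j)"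
proof -
  have R: "R \<in> carrier_mat m m" by (simp add: R_def)
  have RM: "(R * M) $$ (i, j) = f i * M $$ (i, j)" if "i < m" "j < m" for i j
  proof -
    have "(R * M) $$ (i, j) = (\<Sum>l<m. (if i = l then f i else 0) * M $$ (l, j))"
      using M that by (simp add: R_def scalar_prod_def lessThan_atLeast0)
    also have "\<dots> = (\<Sum>l<m. if l = i then f i * M $$ (i, j) else 0)" by (intro sum.cong refl) auto
    finally show ?thesis using that by simp
  qed
  define A where "A = R * M"
  have A: "A \<in> carrier_mat m m" using R M by (simp add: A_def)
  have AR: "(A * R) $$ (i, j) = f i * f j * M $$ (i, j)" if "i < m" "j < m" for i j
  proof -
    have "(A * R) $$ (i, j) = (\<Sum>l<m. A $$ (i, l) * (if l = j then f l else 0))"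
      using A that by (simp add: R_def scalar_prod_def lessThan_atLeast0)
    also have "\<dots> = (\<Sum>l<m. if l = j then A $$ (i, j) * f j else 0)" by (intro sum.cong refl) auto
    also have "\<dots> = A $$ (i, j) * f j" using that by simp
    finally show ?thesis using RM[OF that] by (simp add: A_def)
  qed
  define C where "C = A * R"
  have C: "C \<in> carrier_mat m m" using A R by (simp add: C_def)
  have "scalar_prod y (C *\<^sub>v y) = (\<Sum>i<m. vec_index y i * (\<Sum>j<m. C $$ (i, j) * vec_index y j))"
    using C y by (simp add: scalar_prod_def lessThan_atLeast0)
  also have "\<dots> = (\<Sum>i<m. \<Sum>j<m. vec_index y i * (f i * f j * M $$ (i, j)) * vec_index y j)"
    unfolding sum_distrib_left by (intro sum.cong refl) (simp add: AR C_def)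
  finally show ?thesis by (simp add: C_def A_def)
qed

section \<open>One-hot outputs and the approximation guarantee\<close>

lemma finite_one_hot_blocks: "finite (one_hot_blocks n q)"
proof (rule finite_subset)
  show "one_hot_blocks n q \<subseteq> Matrix.vec (n * q) ` ({..<n * q} \<rightarrow>\<^sub>E {0, 1})"
  proof
    fix y assume "y \<in> one_hot_blocks n q"
    then have y: "y \<in> carrier_vec (n * q)" "\<forall>j<n * q. vec_index y j \<in> {0, 1}" by (auto simp: one_hot_blocks_def)
    have "y = Matrix.vec (n * q) (restrict (vec_index y) {..<n * q})" using y(1) by (intro eq_vecI) auto
    moreover have "restrict (vec_index y) {..<n * q} \<in> {..<n * q} \<rightarrow>\<^sub>E {0, 1}" using y(2) by auto
    ultimately show "y \<in> Matrix.vec (n * q) ` ({..<n * q} \<rightarrow>\<^sub>E {0, 1})" by blast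
  qed
qed (intro finite_imageI finite_PiE, auto)

lemma one_hot_blocks_feas:
  assumes "y \<in> one_hot_blocks n q" shows "feas n q (vec_index y)"
  unfolding feas_def
proof (intro conjI allI impI)
  fix j assume "j < n * q"
  then have "vec_index y j \<in> {0, 1}" using assms by (simp add: one_hot_blocks_def)
  then show "0 \<le> vec_index y j" by auto
next
  fix i assume i: "i < n"
  have ex1: "\<exists>!a. a < q \<and> vec_index y (i * q + a) = 1" using assms i by (simp add: one_hot_blocks_def)
  then obtain a where a: "a < q" "vec_index y (i * q + a) = 1" by blast
  have "vec_index y (i * q + a') = (if a' = a then 1 else 0)" if "a' < q" for a'
  proof -
    have "vec_index y (i * q + a') \<in> {0, 1}"
      using assms block_index_less[OF i that] by (simp add: one_hot_blocks_def)
    then show ?thesis using ex1 a that by auto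
  qed
  then have "(\<Sum>a'<q. vec_index y (i * q + a')) = (\<Sum>a'<q. if a' = a then 1 else 0)" by (intro sum.cong refl) simp
  then show "(\<Sum>a'<q. vec_index y (i * q + a')) = 1" using a by simp
qed

lemma output_vec_one_hot:
  assumes oh: "\<And>i. i < n \<Longrightarrow> block_onehot q (ints s ''y'') i" and q: "0 < q"
  shows "output_vec (n * q) s \<in> one_hot_blocks n q"
proof -
  have idx: "vec_index (output_vec (n * q) s) j = real (ints s ''y'' j)" if "j < n * q" for j
    using that by (simp add: output_vec_def)
  have "vec_index (output_vec (n * q) s) j \<in> {0, 1}" if j: "j < n * q" for j
  proof -
    have "block_onehot q (ints s ''y'') (j div q)" using oh j by (simp add: less_mult_imp_div_less)
    then obtain a where "\<forall>a'<q. ints s ''y'' (j div q * q + a') = (if a' = a then 1 else 0)"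
      by (auto simp: block_onehot_def)
    then have "ints s ''y'' (j div q * q + j mod q) = (if j mod q = a then 1 else 0)"
      using mod_less_divisor[OF q, of j] by blast
    then show ?thesis using idx[OF j] by (auto split: if_splits)
  qed
  moreover have "\<exists>!a. a < q \<and> vec_index (output_vec (n * q) s) (i * q + a) = 1" if i: "i < n" for i
  proof -
    obtain a where a: "a < q" "\<forall>a'<q. ints s ''y'' (i * q + a') = (if a' = a then 1 else 0)"
      using oh[OF i] by (auto simp: block_onehot_def)
    show ?thesis
      by (rule ex1I[of _ a]) (use a idx block_index_less[OF i] in \<open>auto split: if_splits\<close>)
  qed
  ultimately show ?thesis by (simp add: one_hot_blocks_def output_vec_def)
qed

theorem theorem3p1:
  shows "\<exists>(P :: com list) (a :: nat) (c :: nat) (C :: real).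
    \<forall>(\<epsilon> :: real) (n :: nat) (q :: nat) (M :: real mat) (D :: real mat).
      0 < \<epsilon> \<and> \<epsilon> < 1 \<and> 0 < n \<and> 0 < q \<and>
      M \<in> carrier_mat (n * q) (n * q) \<and> M\<^sup>T = M \<and> op_norm M \<le> 1 \<and>
      (\<forall>i<n. submatrix M {i * q..<(i + 1) * q} {i * q..<(i + 1) * q} = 0\<^sub>m q q) \<and>
      D \<in> carrier_mat n n \<and> diagonal_mat D \<and> (\<forall>i<n. 0 \<le> D $$ (i, i)) \<longrightarrow>
      (let k = rank_ge \<epsilon> M;
           E = kron D (1\<^sub>m q);
           \<Phi> = (\<lambda>y. scalar_prod y ((psd_sqrt E * M * psd_sqrt E) *\<^sub>v y));
           OPT = Max (\<Phi> ` one_hot_blocks n q);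
           s = input_state \<epsilon> n q M D
       in \<exists>t :: nat.
            real t \<le> real a * real (n * q) ^ a * (1 / \<epsilon>) ^ (c * k) \<and>
            halts_within t P s \<and>
            set_pmf (output_pmf t P s (n * q)) \<subseteq> one_hot_blocks n q \<and>
            measure_pmf.expectation (output_pmf t P s (n * q)) \<Phi> \<ge> OPT - C * (\<epsilon> * mat_trace D))"
proof -
  \<comment> \<open>One constant is both factor and exponent of the polynomial, so it has to
    dominate 601 as well as 9. The loss 31 is 30 from Frank-Wolfe and 1 from the net.\<close>
  obtain a :: nat where a: "601 \<le> a" by blast
  show ?thesis
  proof (rule exI[of _ prog], rule exI[of _ a], rule exI[of _ 8], rule exI[of _ 31], intro allI impI, elim conjE)
    fix \<epsilon> :: real and n q :: nat and M D :: "real mat"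
    assume eps: "0 < \<epsilon>" "\<epsilon> < 1" and n: "0 < n" and q: "0 < q"
      and M: "M \<in> carrier_mat (n * q) (n * q)" "M\<^sup>T = M" "op_norm M \<le> 1"
      and blocks: "\<forall>i<n. submatrix M {i * q..<(i + 1) * q} {i * q..<(i + 1) * q} = 0\<^sub>m q q"
      and D: "D \<in> carrier_mat n n" "diagonal_mat D" "\<forall>i<n. 0 \<le> D $$ (i, i)"
    define m where "m = n * q"
    define k where "k = rank_ge \<epsilon> M"
    define E where "E = kron D (1\<^sub>m q)"
    define \<Phi> where "\<Phi> = (\<lambda>y. scalar_prod y ((psd_sqrt E * M * psd_sqrt E) *\<^sub>v y))"
    define s where "s = input_state \<epsilon> n q M D"
    have Mm: "M \<in> carrier_mat m m" using M(1) by (simp add: m_def)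
    interpret symmetric_form m "\<lambda>i j. M $$ (i, j)"
    proof
      fix i j assume "i < m" "j < m"
      then have "M\<^sup>T $$ (j, i) = M $$ (i, j)" using Mm by simp
      then show "M $$ (i, j) = M $$ (j, i)" using M(2) by simp
    qed
    interpret block_form m "\<lambda>i j. M $$ (i, j)" n q "\<lambda>i. D $$ (i, i)" \<epsilon> k
    proof
      show "\<bar>bil x x\<bar> \<le> (\<Sum>i<m. (x i)\<^sup>2)" for x
        unfolding bil_def by (rule op_norm_form_bound[OF Mm M(3)])
      show "M $$ (i, j) = 0" if "i < m" "j < m" "i div q = j div q" for i j
        by (rule zero_block_entry[OF M(1) blocks]) (use that in \<open>auto simp: m_def\<close>)
      show "e \<le> k" if "\<And>c. \<exists>t<e. c t \<noteq> 0 \<Longrightarrow> \<epsilon> * (\<Sum>i<m. (\<Sum>t<e. c t * W t i)\<^sup>2)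
          < bil (\<lambda>i. \<Sum>t<e. c t * W t i) (\<lambda>i. \<Sum>t<e. c t * W t i)" for e W
        unfolding k_def by (rule rank_ge_lower[OF Mm M(2)]) (use that in \<open>simp add: bil_def\<close>)
    qed (use eps n q D in \<open>auto simp: m_def\<close>)
    note Ed = kron_one_diagonal[OF D(1,2) q, folded E_def m_def]
    have E0: "0 \<le> E $$ (i, i)" if "i < m" for i
      using Ed(3)[OF that] D(3) div_q_less[OF that] by simp
    have sq: "psd_sqrt E = Matrix.mat m m (\<lambda>(i, j). if i = j then S i else 0)"
    proof -
      have "psd_sqrt E = Matrix.mat m m (\<lambda>(i, j). if i = j then sqrt (E $$ (i, i)) else 0)"
        by (rule psd_sqrt_diagonal[OF Ed(1,2)]) (rule E0)
      also have "\<dots> = Matrix.mat m m (\<lambda>(i, j). if i = j then S i else 0)"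
        using Ed(3) by (intro eq_matI) (auto simp: S_def)
      finally show ?thesis .
    qed
    have \<Phi>: "\<Phi> y = H.bil (vec_index y) (vec_index y)" if "y \<in> carrier_vec m" for y
      unfolding \<Phi>_def sq scaled_quadratic_form[OF Mm that] H.bil_def H_def ..
    have tau: "mat_trace D = tau" using D(1) by (simp add: mat_trace_def tau_def)
    have fin: "finite (\<Phi> ` one_hot_blocks n q)" by (intro finite_imageI finite_one_hot_blocks)
    \<comment> \<open>A maximum needs a nonempty set; the vector that selects the first entry of
      each block belongs to it.\<close>
    have "block_onehot q (\<lambda>j. if j mod q = 0 then 1 else 0 :: nat) i" for i
      unfolding block_onehot_def using q by (intro exI[of _ 0]) (auto simp: block_index)
    then have "output_vec (n * q) \<lparr>ints = (\<lambda>_ j. if j mod q = 0 then 1 else 0), reals = (\<lambda>_ _. 0)\<rparr> \<in> one_hot_blocks n q"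
      using q by (intro output_vec_one_hot) simp_all
    then have ne: "\<Phi> ` one_hot_blocks n q \<noteq> {}" by blast
    \<comment> \<open>An optimal vector is the comparison point of the analysis.\<close>
    from Max_in[OF fin ne] obtain z where z: "z \<in> one_hot_blocks n q" "Max (\<Phi> ` one_hot_blocks n q) = \<Phi> z" by auto
    have zc: "z \<in> carrier_vec m" using z(1) by (simp add: one_hot_blocks_def m_def)
    have "\<exists>T. real T \<le> 601 * real m ^ 9 * (1 / \<epsilon>) ^ (8 * k) \<and>
      wp prog T (\<lambda>s'. (\<forall>i<n. block_onehot q (ints s' ''y'') i) \<and>
        H.bil (vec_index z) (vec_index z) - 31 * (\<epsilon> * tau) \<le> H.bil (\<lambda>j. real (ints s' ''y'' j)) (\<lambda>j. real (ints s' ''y'' j))) s"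
    proof (rule wp_prog)
      show "rowf m (reals s ''M'') i j = M $$ (i, j)" if "i < m" "j < m" for i j
      proof -
        have "i * m + j < m * m" using block_index_less[OF that] .
        then show ?thesis using block_index[OF that(2), of i] by (simp add: rowf_def s_def input_state_def m_def[symmetric])
      qed
    qed (use one_hot_blocks_feas[OF z(1)] in \<open>simp_all add: s_def input_state_def\<close>)
    then obtain T where T: "real T \<le> 601 * real m ^ 9 * (1 / \<epsilon>) ^ (8 * k)"
      and wpT: "wp prog T (\<lambda>s'. (\<forall>i<n. block_onehot q (ints s' ''y'') i) \<and>
        H.bil (vec_index z) (vec_index z) - 31 * (\<epsilon> * tau) \<le> H.bil (\<lambda>j. real (ints s' ''y'' j)) (\<lambda>j. real (ints s' ''y'' j))) s"
      by blast
    obtain t s' where t: "t \<le> T" and run0: "run t (prog, s) = return_pmf ([], s')"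
      and G: "(\<forall>i<n. block_onehot q (ints s' ''y'') i) \<and>
        H.bil (vec_index z) (vec_index z) - 31 * (\<epsilon> * tau) \<le> H.bil (\<lambda>j. real (ints s' ''y'' j)) (\<lambda>j. real (ints s' ''y'' j))"
      by (rule wp_run[OF wpT])
    note oh = conjunct1[OF G] and val = conjunct2[OF G]
    let ?y = "output_vec (n * q) s'"
    have yo: "?y \<in> one_hot_blocks n q" using oh q by (intro output_vec_one_hot) auto
    \<comment> \<open>The output distribution is a point mass, so the expectation is a single value
      of \<open>\<Phi>\<close>.\<close>
    have out: "output_pmf t prog s (n * q) = return_pmf ?y" by (simp add: output_pmf_def run0)
    have "H.bil (vec_index ?y) (vec_index ?y) = H.bil (\<lambda>j. real (ints s' ''y'' j)) (\<lambda>j. real (ints s' ''y'' j))"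
      by (rule H.bil_self_cong) (simp add: output_vec_def m_def)
    moreover have "?y \<in> carrier_vec m" by (simp add: output_vec_def m_def)
    ultimately have good: "\<Phi> z - 31 * (\<epsilon> * tau) \<le> \<Phi> ?y" using val by (simp add: \<Phi> zc)
    have t1: "real t \<le> real a * real (n * q) ^ a * (1 / \<epsilon>) ^ (8 * k)"
    proof -
      have "real t \<le> real T" using t by (simp only: of_nat_le_iff)
      also have "\<dots> \<le> 601 * real m ^ 9 * (1 / \<epsilon>) ^ (8 * k)" by (rule T)
      also have "\<dots> \<le> real a * real m ^ a * (1 / \<epsilon>) ^ (8 * k)"
        using m_pos eps a by (intro mult_right_mono mult_mono power_increasing) auto
      finally show ?thesis by (simp only: m_def)
    qed
    have t2: "halts_within t prog s" by (simp add: halts_within_def run0)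
    have t3: "set_pmf (output_pmf t prog s (n * q)) \<subseteq> one_hot_blocks n q" using yo by (simp add: out)
    have t4: "Max (\<Phi> ` one_hot_blocks n q) - 31 * (\<epsilon> * mat_trace D) \<le> measure_pmf.expectation (output_pmf t prog s (n * q)) \<Phi>"
      using good by (simp add: out z(2) tau)
    show "let k = rank_ge \<epsilon> M;
             E = kron D (1\<^sub>m q);
             \<Phi> = (\<lambda>y. scalar_prod y ((psd_sqrt E * M * psd_sqrt E) *\<^sub>v y));
             OPT = Max (\<Phi> ` one_hot_blocks n q);
             s = input_state \<epsilon> n q M D
         in \<exists>t :: nat.
              real t \<le> real a * real (n * q) ^ a * (1 / \<epsilon>) ^ (8 * k) \<and>
              halts_within t prog s \<and>
              set_pmf (output_pmf t prog s (n * q)) \<subseteq> one_hot_blocks n q \<and>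
              measure_pmf.expectation (output_pmf t prog s (n * q)) \<Phi> \<ge> OPT - 31 * (\<epsilon> * mat_trace D)"
      unfolding Let_def
      by (intro exI[of _ t] conjI)
        (rule t1[unfolded k_def], rule t2[unfolded s_def], rule t3[unfolded s_def], rule t4[unfolded \<Phi>_def E_def s_def])
  qed
qed

end
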